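(* Let $p(\rho)=\rho^\gamma$ with $\gamma\ge 1$. Let $\rho_\pm>0$ and $v_\pm=(v_{\pm1},v_{\pm2})\in\mathbb{R}^2$ be constants such that the self-similar solution to the Riemann problem for the two-dimensional compressible isentropic Euler system with initial data $$(\rho^0(x),v^0(x))=\begin{cases}(\rho_-,v_-) & \text{if } x_2<0,\\ (\rho_+,v_+) & \text{if } x_2>0,\end{cases}$$ consists of an admissible $1$-shock and an admissible $3$-shock, i.e. such that $v_{-1}=v_{+1}$ and $$v_{+2}-v_{-2}<-\sqrt{\frac{(\rho_--\rho_+)(p(\rho_-)-p(\rho_+))}{\rho_-\rho_+}}.$$ Then there exist infinitely many (bounded) admissible weak solutions $(\rho,v)$ on $\mathbb{R}^2\times[0,\infty)$ of the compressible isentropic Euler system with these initial data.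
   Context: The compressible isentropic Euler system in two space dimensions, $x=(x_1,x_2)\in\mathbb{R}^2$, for the density $\rho$ and velocity $v$ is $$\partial_t\rho+\mathrm{div}_x(\rho v)=0,\qquad \partial_t(\rho v)+\mathrm{div}_x(\rho v\otimes v)+\nabla_x[p(\rho)]=0,\qquad \rho(\cdot,0)=\rho^0,\ v(\cdot,0)=v^0 .$$ The internal energy $\varepsilon$ is given by $p(r)=r^2\varepsilon'(r)$: $\varepsilon(\rho)=\rho^{\gamma-1}/(\gamma-1)$ if $\gamma>1$ and $\varepsilon(\rho)=\log\rho$ if $\gamma=1$. Weak solution: a pair $(\rho,v)\in L^\infty(\mathbb{R}^2\times[0,\infty))$ such that for every scalar $\psi$ and every $\mathbb{R}^2$-valued $\phi$ in $C_c^\infty(\mathbb{R}^2\times[0,\infty))$ $$\int_0^\infty\!\!\int_{\mathbb{R}^2}[\rho\,\partial_t\psi+\rho v\cdot\nabla_x\psi]\,dx\,dt+\int_{\mathbb{R}^2}\rho^0(x)\psi(x,0)\,dx=0,$$ $$\int_0^\infty\!\!\int_{\mathbb{R}^2}[\rho v\cdot\partial_t\phi+\rho v\otimes v:\nabla_x\phi+p(\rho)\,\mathrm{div}_x\phi]\,dx\,dt+\int_{\mathbb{R}^2}\rho^0(x)v^0(x)\cdot\phi(x,0)\,dx=0.$$ Admissible: a bounded weak solution such that for every nonnegative $\varphi\in C_c^\infty(\mathbb{R}^2\times[0,\infty))$ $$\int_0^\infty\!\!\int_{\mathbb{R}^2}\Big[\Big(\rho\varepsilon(\rho)+\rho\tfrac{|v|^2}{2}\Big)\partial_t\varphi+\Big(\rho\varepsilon(\rho)+\rho\tfrac{|v|^2}{2}+p(\rho)\Big)v\cdot\nabla_x\varphi\Big]dx\,dt+\int_{\mathbb{R}^2}\Big(\rho^0\varepsilon(\rho^0)+\rho^0\tfrac{|v^0|^2}{2}\Big)\varphi(x,0)\,dx\ge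 0 .$$ *)

theory Defs
  imports "HOL-Analysis.Analysis"
begin

text \<open>Functions of class \<open>C\<^sup>k\<close> on a finite-dimensional space: all iterated directional
  derivatives up to order \<open>k\<close> exist and are continuous.\<close>

primrec Ck :: "nat \<Rightarrow> ('a::euclidean_space \<Rightarrow> 'b::real_normed_vector) \<Rightarrow> bool" where
  "Ck 0 f \<longleftrightarrow> continuous_on UNIV f"
| "Ck (Suc k) f \<longleftrightarrow>
     (\<forall>z. f differentiable (at z)) \<and> (\<forall>h. Ck k (\<lambda>z. frechet_derivative f (at z) h))"

text \<open>A point of space-time is a pair \<open>(x, t)\<close>.\<close>

type_synonym spacetime = "(real^2) \<times> real"

definition future :: "spacetime set" where
  "future = UNIV \<times> {0..}"

text \<open>Elements of \<open>C\<^sub>c\<^sup>\<infinity>\<close> of the closed half-space \<^const>\<open>future\<close> are the restrictions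
  to it of elements of \<open>C\<^sub>c\<^sup>\<infinity>\<close> of the whole space; they need not vanish at \<open>t = 0\<close>. They are
  represented by such an extension, whose values at \<open>t < 0\<close> are never used.\<close>

definition test_function :: "(spacetime \<Rightarrow> 'b::real_normed_vector) \<Rightarrow> bool" where
  "test_function \<phi> \<longleftrightarrow> (\<forall>k. Ck k \<phi>) \<and> compact (closure {z. \<phi> z \<noteq> 0})"

definition dt :: "(spacetime \<Rightarrow> 'b::real_normed_vector) \<Rightarrow> spacetime \<Rightarrow> 'b" where
  "dt \<phi> z = frechet_derivative \<phi> (at z) (0, 1)"

definition dx :: "2 \<Rightarrow> (spacetime \<Rightarrow> 'b::real_normed_vector) \<Rightarrow> spacetime \<Rightarrow> 'b" where
  "dx j \<phi> z = frechet_derivative \<phi> (at z) (axis j 1, 0)"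

definition grad_x :: "(spacetime \<Rightarrow> real) \<Rightarrow> spacetime \<Rightarrow> real^2" where
  "grad_x \<psi> z = (\<chi> j. dx j \<psi> z)"

definition jacobian_x :: "(spacetime \<Rightarrow> real^2) \<Rightarrow> spacetime \<Rightarrow> real^2^2" where
  "jacobian_x \<phi> z = (\<chi> i j. dx j \<phi> z $ i)"

definition div_x :: "(spacetime \<Rightarrow> real^2) \<Rightarrow> spacetime \<Rightarrow> real" where
  "div_x \<phi> z = (\<Sum>j\<in>UNIV. dx j \<phi> z $ j)"

definition tensor_product :: "real^2 \<Rightarrow> real^2 \<Rightarrow> real^2^2" (infixl "\<otimes>\<^sub>t" 75) where
  "a \<otimes>\<^sub>t b = (\<chi> i j. a $ i * b $ j)"

definition frobenius :: "real^2^2 \<Rightarrow> real^2^2 \<Rightarrow> real" where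
  "frobenius A B = (\<Sum>i\<in>UNIV. \<Sum>j\<in>UNIV. A $ i $ j * B $ i $ j)"

definition pressure :: "real \<Rightarrow> real \<Rightarrow> real" where
  "pressure \<gamma> r = r powr \<gamma>"

definition internal_energy :: "real \<Rightarrow> real \<Rightarrow> real" where
  "internal_energy \<gamma> r = (if \<gamma> = 1 then ln r else r powr (\<gamma> - 1) / (\<gamma> - 1))"

lemma pressure_eq_deriv_internal_energy:
  assumes "r > 0"
  shows "(internal_energy \<gamma> has_real_derivative pressure \<gamma> r / r\<^sup>2) (at r)"
proof (cases "\<gamma> = 1")
  case True
  then have "internal_energy \<gamma> = ln"
    by (auto simp: internal_energy_def)
  with True assms show ?thesis
    by (auto simp: pressure_def power2_eq_square intro!: derivative_eq_intros)
next
  case False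
  have eq: "r powr \<gamma> / r\<^sup>2 = r powr (\<gamma> - 2)"
    using assms by (simp add: powr_diff powr_numeral)
  have "internal_energy \<gamma> = (\<lambda>r. r powr (\<gamma> - 1) / (\<gamma> - 1))"
    using False by (auto simp: internal_energy_def)
  moreover have "((\<lambda>r. r powr (\<gamma> - 1) / (\<gamma> - 1)) has_real_derivative
      (\<gamma> - 1) * r powr (\<gamma> - 1 - 1) / (\<gamma> - 1)) (at r)"
    using assms by (intro DERIV_cdivide has_real_derivative_powr)
  ultimately show ?thesis
    using False eq by (simp add: pressure_def)
qed

definition energy :: "real \<Rightarrow> real \<Rightarrow> real^2 \<Rightarrow> real" where
  "energy \<gamma> r u = r * internal_energy \<gamma> r + r * ((norm u)\<^sup>2 / 2)"

definition Linfty :: "(spacetime \<Rightarrow> 'b::{real_normed_vector, second_countable_topology}) \<Rightarrow> bool" where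
  "Linfty f \<longleftrightarrow> f \<in> borel_measurable (lebesgue_on future) \<and>
     (\<exists>C. AE z in lebesgue_on future. norm (f z) \<le> C)"

text \<open>The density is required to be positive almost everywhere: this is what makes
  \<open>\<rho> powr \<gamma>\<close> and \<open>ln \<rho>\<close> meaningful, and it rules out vacuum regions, on which every
  velocity field would trivially be allowed.
  All integrands below are bounded with bounded support, hence integrable.\<close>

definition weak_solution ::
  "real \<Rightarrow> (real^2 \<Rightarrow> real) \<Rightarrow> (real^2 \<Rightarrow> real^2) \<Rightarrow>
   (spacetime \<Rightarrow> real) \<Rightarrow> (spacetime \<Rightarrow> real^2) \<Rightarrow> bool" where
  "weak_solution \<gamma> \<rho>0 v0 \<rho> v \<longleftrightarrow>
     Linfty \<rho> \<and> Linfty v \<and> (AE z in lebesgue_on future. \<rho> z > 0) \<and>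
     (\<forall>\<psi> :: spacetime \<Rightarrow> real. test_function \<psi> \<longrightarrow>
        (LINT z|lebesgue_on future. \<rho> z * dt \<psi> z + (\<rho> z *\<^sub>R v z) \<bullet> grad_x \<psi> z)
        + (LINT x|lebesgue. \<rho>0 x * \<psi> (x, 0)) = 0) \<and>
     (\<forall>\<phi> :: spacetime \<Rightarrow> real^2. test_function \<phi> \<longrightarrow>
        (LINT z|lebesgue_on future. (\<rho> z *\<^sub>R v z) \<bullet> dt \<phi> z
           + \<rho> z * frobenius (v z \<otimes>\<^sub>t v z) (jacobian_x \<phi> z)
           + pressure \<gamma> (\<rho> z) * div_x \<phi> z)
        + (LINT x|lebesgue. (\<rho>0 x *\<^sub>R v0 x) \<bullet> \<phi> (x, 0)) = 0)"

definition admissible_weak_solution ::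
  "real \<Rightarrow> (real^2 \<Rightarrow> real) \<Rightarrow> (real^2 \<Rightarrow> real^2) \<Rightarrow>
   (spacetime \<Rightarrow> real) \<Rightarrow> (spacetime \<Rightarrow> real^2) \<Rightarrow> bool" where
  "admissible_weak_solution \<gamma> \<rho>0 v0 \<rho> v \<longleftrightarrow>
     weak_solution \<gamma> \<rho>0 v0 \<rho> v \<and>
     (\<forall>\<phi> :: spacetime \<Rightarrow> real. test_function \<phi> \<and> (\<forall>z\<in>future. \<phi> z \<ge> 0) \<longrightarrow>
        (LINT z|lebesgue_on future. energy \<gamma> (\<rho> z) (v z) * dt \<phi> z
           + (energy \<gamma> (\<rho> z) (v z) + pressure \<gamma> (\<rho> z)) * (v z \<bullet> grad_x \<phi> z))
        + (LINT x|lebesgue. energy \<gamma> (\<rho>0 x) (v0 x) * \<phi> (x, 0)) \<ge> 0)"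

text \<open>Riemann data jumping across the line \<open>x\<^sub>2 = 0\<close>; the value on this null set is irrelevant.\<close>

definition riemann_data :: "'b \<Rightarrow> 'b \<Rightarrow> real^2 \<Rightarrow> 'b" where
  "riemann_data l r x = (if x $ 2 < 0 then l else r)"

definition ae_equal ::
  "(spacetime \<Rightarrow> real) \<times> (spacetime \<Rightarrow> real^2) \<Rightarrow>
   (spacetime \<Rightarrow> real) \<times> (spacetime \<Rightarrow> real^2) \<Rightarrow> bool" where
  "ae_equal s s' \<longleftrightarrow>
     (AE z in lebesgue_on future. fst s z = fst s' z \<and> snd s z = snd s' z)"

end

theory Submission
  imports Defs
begin

text \<open>
  The middle state of the two-shock fan is replaced by a strict subsolution. Its density is slightly
  below that of the two-shock solution and its momentum flux contains an extra stress
  \<open>r \<delta> Id\<close>, compensated by the energy \<open>r (a\<^sup>2 + \<beta>\<^sup>2 + 2 \<delta>) / 2\<close>. The energy inequality is strict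
  at admissible shocks (the trapezoid rule for the convex function \<open>1/\<rho> \<mapsto> p(\<rho>)\<close>), so it survives
  for small \<open>\<delta>\<close>. In the open wedge of the middle state the density is kept constant and the
  velocity is perturbed by convex integration: localized plane waves solving the linear system
  \<open>div V = 0\<close>, \<open>\<partial>\<^sub>t V + div U = 0\<close> are added repeatedly, each time increasing \<open>\<integral> |V|\<^sup>2\<close> by a definite
  amount, until \<open>|V|\<^sup>2 = C\<close> and \<open>U\<close> is the traceless part of \<open>V \<otimes> V\<close> almost everywhere. Since
  \<open>|V|\<^sup>2\<close> and \<open>\<rho>\<close> are then constant in the wedge, pressure and energy density are too, and the nonlinear
  balance laws reduce to the jump conditions on the two boundary lines of the wedge.
\<close>

section \<open>Integration on Euclidean space\<close>

text \<open>Where \<open>|V|^2 = C\<close>, the tensor of the velocity is its traceless part plus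
  \<open>C/2\<close> times the identity. For the constant state \<open>V0\<close> the remainder is
  \<open>|V0|^2/2\<close>, so the stress \<open>\<delta>\<close> is accounted for exactly when
  \<open>C = |V0|^2 + 2 \<delta>\<close>, and the traceless part may start at its exact value,
  \<open>Z0 = V0\<^sup>2\<close>. The stress enlarges the velocity drop across both outer jumps at a
  given density. The two drops must still add up to the prescribed total, and this forces the
  density of the middle state down. In the wedge the energy flux is a constant times
  \<open>V\<close>, so a divergence-free perturbation leaves the energy balance untouched. Obstacle:
  one step of convex integration draws its uniform gap to the constraint from compactness, but the
  wedge is unbounded. The construction therefore runs on bounded shells, and the pieces are glued.
  Weak convergence would not pass to the limit in the quadratic relation
  \<open>Z = V\<^sup>2\<close>; strong convergence in \<open>L\<^sup>2\<close> comes from the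
  control of inner products between increments and iterates.\<close>

lemma continuous_bounded_support_bounded:
  fixes f :: "'a::euclidean_space \<Rightarrow> 'b::real_normed_vector"
  assumes "continuous_on UNIV f" and "\<And>x. norm x > R \<Longrightarrow> f x = 0"
  obtains K where "K \<ge> 0" "\<And>x. norm (f x) \<le> K"
proof -
  have "compact (f ` cball 0 R)"
    by (intro compact_continuous_image continuous_on_subset[OF assms(1)]) auto
  then obtain K where K: "\<And>y. y \<in> f ` cball 0 R \<Longrightarrow> norm y \<le> K"
    using bounded_iff compact_imp_bounded by metis
  have "norm (f x) \<le> max K 0" for x
  proof (cases "norm x > R")
    case True
    then show ?thesis using assms(2) by simp
  next
    case False
    then have "f x \<in> f ` cball 0 R" by auto
    then show ?thesis using K by fastforce
  qed
  then show thesis using that[of "max K 0"] by auto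
qed

lemma integrable_bounded_support:
  fixes f :: "'a::euclidean_space \<Rightarrow> 'b::{banach, second_countable_topology}"
  assumes "f \<in> borel_measurable borel" and "\<And>x. norm x > R \<Longrightarrow> f x = 0"
    and "\<And>x. norm (f x) \<le> K"
  shows "integrable lborel f"
proof (rule Bochner_Integration.integrable_bound)
  show "integrable lborel (\<lambda>x. indicator (cball 0 R) x * K)"
    by (intro integrable_mult_left integrable_real_indicator) (auto simp: emeasure_lborel_cball_finite[unfolded infinity_ennreal_def])
  show "f \<in> borel_measurable lborel" using assms(1) by simp
  show "AE x in lborel. norm (f x) \<le> norm (indicator (cball 0 R) x * K)"
  proof (intro AE_I2)
    fix x
    show "norm (f x) \<le> norm (indicator (cball 0 R) x * K)"
    proof (cases "norm x > R")
      case False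
      then have "x \<in> cball 0 R" by auto
      then show ?thesis using assms(3)[of x] by (simp add: abs_if)
    qed (use assms(2) in simp)
  qed
qed

lemma integrable_continuous_bounded_support:
  fixes f :: "'a::euclidean_space \<Rightarrow> 'b::{banach, second_countable_topology}"
  assumes "continuous_on UNIV f" and "\<And>x. norm x > R \<Longrightarrow> f x = 0"
  shows "integrable lborel f"
proof -
  obtain K where "\<And>x. norm (f x) \<le> K"
    using continuous_bounded_support_bounded[OF assms] by metis
  then show ?thesis
    using integrable_bounded_support[of f R K] assms borel_measurable_continuous_onI by blast
qed

lemma integral_translate:
  fixes f :: "'a::euclidean_space \<Rightarrow> 'b::{banach, second_countable_topology}"
  assumes "f \<in> borel_measurable borel"
  shows "(LINT x|lborel. f (x + c)) = integral\<^sup>L lborel f"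
proof -
  have "integral\<^sup>L lborel f = integral\<^sup>L (distr lborel borel ((+) c)) f"
    by (simp add: lborel_distr_plus)
  also have "\<dots> = (LINT x|lborel. f (c + x))"
    using assms by (intro integral_distr) auto
  finally show ?thesis by (simp add: add.commute)
qed

lemma dominated_convergence_bounded_support:
  fixes f :: "'a::euclidean_space \<Rightarrow> 'b::{banach, second_countable_topology}"
  assumes "f \<in> borel_measurable borel" "\<And>n. s n \<in> borel_measurable borel"
    and "AE x in lborel. (\<lambda>n. s n x) \<longlonglongrightarrow> f x"
    and "\<And>n x. norm x > R \<Longrightarrow> s n x = 0"
    and "\<And>n x. norm (s n x) \<le> K"
  shows "(\<lambda>n. integral\<^sup>L lborel (s n)) \<longlonglongrightarrow> integral\<^sup>L lborel f"
proof (rule integral_dominated_convergence[where w = "\<lambda>x. indicator (cball 0 R) x * K"])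
  show "integrable lborel (\<lambda>x::'a. indicator (cball 0 R) x * K)"
    by (intro integrable_mult_left integrable_real_indicator) (auto simp: emeasure_lborel_cball_finite[unfolded infinity_ennreal_def])
  show "AE x in lborel. norm (s n x) \<le> indicator (cball 0 R) x * K" for n
  proof (intro AE_I2)
    fix x
    show "norm (s n x) \<le> indicator (cball 0 R) x * K"
      using assms(4)[of x n] assms(5)[of n x] by (cases "norm x > R") (auto simp: indicator_def)
  qed
qed (use assms in auto)

text \<open>The mean value theorem bounds every quotient by \<open>K\<close>, so dominated
  convergence applies. \<open>S\<close> is arbitrary because the limit is used twice: for
  translation-invariant sets, where the integral vanishes, and for the sets \<open>half\<close>,
  where it has a sign.\<close>

lemma difference_quotient_tendsto:
  fixes f :: "'a::euclidean_space \<Rightarrow> real"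
  assumes f: "continuous_on UNIV f" "\<And>x. norm x > R \<Longrightarrow> f x = 0"
    and g: "g \<in> borel_measurable borel" "\<And>x. \<bar>g x\<bar> \<le> K"
    and deriv: "\<And>x. ((\<lambda>s. f (x + s *\<^sub>R e)) has_real_derivative g x) (at 0)"
    and S: "S \<in> sets borel"
  shows "(\<lambda>n. (LINT x|lborel. indicator S x * (f (x + inverse (real (Suc n)) *\<^sub>R e) - f x)) * real (Suc n))
    \<longlonglongrightarrow> (LINT x|lborel. indicator S x * g x)"
proof -
  have deriv': "((\<lambda>s. f (x + s *\<^sub>R e)) has_real_derivative g (x + t *\<^sub>R e)) (at t)" for x t
  proof -
    have "((\<lambda>s. f ((x + t *\<^sub>R e) + s *\<^sub>R e)) has_real_derivative g (x + t *\<^sub>R e)) (at (t - t))"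
      using deriv[of "x + t *\<^sub>R e"] by simp
    then have "((\<lambda>s. f ((x + t *\<^sub>R e) + (s - t) *\<^sub>R e)) has_real_derivative g (x + t *\<^sub>R e) * 1) (at t)"
      by (intro DERIV_chain2[where g = "\<lambda>s. s - t"]) (auto intro!: derivative_eq_intros)
    then show ?thesis by (simp add: algebra_simps)
  qed
  have lip: "\<bar>f (x + s *\<^sub>R e) - f x\<bar> \<le> K * s" if "s > 0" for x s
  proof -
    have "\<exists>z>0. z < s \<and> f (x + s *\<^sub>R e) - f (x + 0 *\<^sub>R e) = (s - 0) * g (x + z *\<^sub>R e)"
      by (rule MVT2[of 0 s "\<lambda>s. f (x + s *\<^sub>R e)" "\<lambda>t. g (x + t *\<^sub>R e)", OF that deriv'])
    then obtain z where "f (x + s *\<^sub>R e) - f (x + 0 *\<^sub>R e) = (s - 0) * g (x + z *\<^sub>R e)" by blast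
    then show ?thesis
      using g(2)[of "x + z *\<^sub>R e"] that by (simp add: abs_mult mult.commute mult_right_mono)
  qed
  let ?h = "\<lambda>n. inverse (real (Suc n))"
  let ?s = "\<lambda>n x. indicator S x * (f (x + ?h n *\<^sub>R e) - f x) * real (Suc n)"
  have fm: "f \<in> borel_measurable borel" using f(1) borel_measurable_continuous_onI by blast
  have fms: "(\<lambda>x. f (x + c)) \<in> borel_measurable borel" for c
    by (rule measurable_compose[OF _ fm]) auto
  have "(\<lambda>n. integral\<^sup>L lborel (?s n)) \<longlonglongrightarrow> (LINT x|lborel. indicator S x * g x)"
  proof (rule dominated_convergence_bounded_support[where R = "R + norm e" and K = K])
    show "(\<lambda>x. indicator S x * g x) \<in> borel_measurable borel" using g S by auto
    show "?s n \<in> borel_measurable borel" for n using fms[of "?h n *\<^sub>R e"] fm S by auto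
    show "AE x in lborel. (\<lambda>n. ?s n x) \<longlonglongrightarrow> indicator S x * g x"
    proof (intro AE_I2)
      fix x
      have "((\<lambda>s. (f (x + s *\<^sub>R e) - f x) / s) \<longlongrightarrow> g x) (at 0)"
        using deriv[of x] by (simp add: has_field_derivative_iff)
      moreover have "filterlim ?h (at 0) sequentially"
        unfolding filterlim_at
        by (intro conjI LIMSEQ_inverse_real_of_nat always_eventually allI) auto
      ultimately have "(\<lambda>n. (f (x + ?h n *\<^sub>R e) - f x) / ?h n) \<longlonglongrightarrow> g x"
        by (rule filterlim_compose)
      then have "(\<lambda>n. indicator S x * ((f (x + ?h n *\<^sub>R e) - f x) / ?h n)) \<longlonglongrightarrow> indicator S x * g x"
        by (intro tendsto_intros)
      then show "(\<lambda>n. ?s n x) \<longlonglongrightarrow> indicator S x * g x"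
        by (simp add: divide_inverse mult.assoc)
    qed
    show "?s n x = 0" if "norm x > R + norm e" for n x
    proof -
      have "norm (?h n *\<^sub>R e) \<le> norm e" using mult_right_mono[of "?h n" 1 "norm e"] by (simp add: inverse_eq_divide)
      moreover have "norm x \<le> norm (x + ?h n *\<^sub>R e) + norm (?h n *\<^sub>R e)"
        by (metis add_diff_cancel_right' norm_triangle_ineq4)
      ultimately have "norm (x + ?h n *\<^sub>R e) > R" using that by linarith
      then show ?thesis using f(2)[of x] f(2)[of "x + ?h n *\<^sub>R e"] that norm_ge_zero[of e] by simp
    qed
    show "norm (?s n x) \<le> K" for n x
    proof -
      have "\<bar>f (x + ?h n *\<^sub>R e) - f x\<bar> * real (Suc n) \<le> K * ?h n * real (Suc n)"
        by (intro mult_right_mono lip) auto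
      also have "\<dots> = K" by (simp add: field_simps)
      finally have *: "\<bar>f (x + ?h n *\<^sub>R e) - f x\<bar> * real (Suc n) \<le> K" .
      have "norm (?s n x) \<le> 1 * \<bar>f (x + ?h n *\<^sub>R e) - f x\<bar> * real (Suc n)"
        by (simp add: abs_mult indicator_def)
      then show ?thesis using * by linarith
    qed
  qed
  then show ?thesis by simp
qed

text \<open>Translation along \<open>e\<close> preserves both Lebesgue measure and \<open>S\<close>,
  so all difference quotients have integral zero.\<close>

lemma integral_directional_derivative_eq_0:
  fixes f :: "'a::euclidean_space \<Rightarrow> real"
  assumes f: "continuous_on UNIV f" "\<And>x. norm x > R \<Longrightarrow> f x = 0"
    and g: "g \<in> borel_measurable borel" "\<And>x. \<bar>g x\<bar> \<le> K"
    and deriv: "\<And>x. ((\<lambda>s. f (x + s *\<^sub>R e)) has_real_derivative g x) (at 0)"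
    and S: "S \<in> sets borel" "\<And>x s. x + s *\<^sub>R e \<in> S \<longleftrightarrow> x \<in> S"
  shows "(LINT x|lborel. indicator S x * g x) = 0"
proof -
  have int: "integrable lborel (\<lambda>x. indicator S x * f x)"
    using integrable_real_mult_indicator[OF _ integrable_continuous_bounded_support[OF f], of S] S
    by (simp add: mult.commute)
  have eq: "indicator S (x + c *\<^sub>R e) * f (x + c *\<^sub>R e) = indicator S x * f (x + c *\<^sub>R e)" for c x
    using S(2)[of x c] by (simp add: indicator_def)
  have m: "(\<lambda>x. indicator S x * f x) \<in> borel_measurable borel"
    using int by auto
  have z: "(LINT x|lborel. indicator S x * (f (x + c *\<^sub>R e) - f x)) = 0" for c
  proof -
    have i2: "integrable lborel (\<lambda>x. indicator S x * f (x + c *\<^sub>R e))"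
    proof -
      have "integrable (distr lborel borel ((+) (c *\<^sub>R e))) (\<lambda>x. indicator S x * f x)"
        using int by (simp add: lborel_distr_plus)
      then have "integrable lborel (\<lambda>x. indicator S (c *\<^sub>R e + x) * f (c *\<^sub>R e + x))"
        by (subst (asm) integrable_distr_eq) (use m in auto)
      then show ?thesis by (simp add: add.commute eq)
    qed
    have "(LINT x|lborel. indicator S x * (f (x + c *\<^sub>R e) - f x)) =
        (LINT x|lborel. indicator S x * f (x + c *\<^sub>R e)) - (LINT x|lborel. indicator S x * f x)"
      using int i2 by (simp add: right_diff_distrib)
    also have "(LINT x|lborel. indicator S x * f (x + c *\<^sub>R e)) = (LINT x|lborel. indicator S x * f x)"
      using integral_translate[OF m, of "c *\<^sub>R e"] by (simp add: eq)
    finally show ?thesis by simp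
  qed
  have "(\<lambda>n. (LINT x|lborel. indicator S x * (f (x + inverse (real (Suc n)) *\<^sub>R e) - f x)) * real (Suc n))
    \<longlonglongrightarrow> (LINT x|lborel. indicator S x * g x)"
    by (rule difference_quotient_tendsto[OF f g deriv S(1)])
  then show ?thesis by (simp add: z LIMSEQ_const_iff)
qed

text \<open>The shift \<open>h n\<close> is half a wavelength: it changes the sign of the cosine.
  Twice the integral is therefore the integral of \<open>g x - g (x + h n)\<close> against the
  cosine, and \<open>h n\<close> tends to zero.\<close>

lemma Riemann_Lebesgue_continuous:
  fixes g :: "'a::euclidean_space \<Rightarrow> real"
  assumes g: "continuous_on UNIV g" "\<And>x. norm x > R \<Longrightarrow> g x = 0" and \<xi>: "\<xi> \<noteq> 0"
  shows "(\<lambda>n. LINT x|lborel. g x * cos (real n * (\<xi> \<bullet> x))) \<longlonglongrightarrow> 0"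
proof -
  define h where "h n = (pi / (real n * (\<xi> \<bullet> \<xi>))) *\<^sub>R \<xi>" for n
  have hlim: "h \<longlonglongrightarrow> 0"
  proof -
    have "(\<lambda>n. (pi / (\<xi> \<bullet> \<xi>)) * inverse (real n)) \<longlonglongrightarrow> (pi / (\<xi> \<bullet> \<xi>)) * 0"
      by (intro tendsto_intros lim_inverse_n)
    then have "(\<lambda>n. ((pi / (\<xi> \<bullet> \<xi>)) * inverse (real n)) *\<^sub>R \<xi>) \<longlonglongrightarrow> 0 *\<^sub>R \<xi>"
      by (intro tendsto_intros) simp
    then show ?thesis by (simp add: h_def[abs_def] field_simps)
  qed
  then have "Bseq h" by (meson convergent_def convergent_imp_Bseq)
  then obtain B where B: "B > 0" "\<And>n. norm (h n) \<le> B" unfolding Bseq_def by auto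
  obtain K where K: "\<And>x. norm (g x) \<le> K"
    using continuous_bounded_support_bounded[OF g] by metis
  have gm: "g \<in> borel_measurable borel" using g(1) borel_measurable_continuous_onI by blast
  have gms: "(\<lambda>x. g (x + c)) \<in> borel_measurable borel" for c
    by (rule measurable_compose[OF _ gm]) auto
  have gi: "integrable lborel (\<lambda>x. g (x + c) * cos (real n * (\<xi> \<bullet> x)))" for c n
  proof (rule integrable_continuous_bounded_support[where R = "R + norm c"])
    show "continuous_on UNIV (\<lambda>x. g (x + c) * cos (real n * (\<xi> \<bullet> x)))"
      by (intro continuous_intros continuous_on_compose2[OF g(1)]) auto
    show "g (x + c) * cos (real n * (\<xi> \<bullet> x)) = 0" if "norm x > R + norm c" for x
      using g(2)[of "x + c"] that norm_triangle_ineq4[of "x + c" c] by simp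
  qed
  have half: "2 * (LINT x|lborel. g x * cos (real n * (\<xi> \<bullet> x))) =
      (LINT x|lborel. (g x - g (x + h n)) * cos (real n * (\<xi> \<bullet> x)))" if "n > 0" for n
  proof -
    have ph: "real n * (\<xi> \<bullet> h n) = pi" using that \<xi> by (simp add: h_def)
    have "(LINT x|lborel. g x * cos (real n * (\<xi> \<bullet> x))) =
        (LINT x|lborel. g (x + h n) * cos (real n * (\<xi> \<bullet> (x + h n))))"
      by (rule integral_translate[symmetric, of "\<lambda>x. g x * cos (real n * (\<xi> \<bullet> x))" "h n"])
         (use gm in auto)
    also have "\<dots> = (LINT x|lborel. - (g (x + h n) * cos (real n * (\<xi> \<bullet> x))))"
      by (intro Bochner_Integration.integral_cong) (auto simp: inner_add_right distrib_left ph)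
    also have "\<dots> = - (LINT x|lborel. g (x + h n) * cos (real n * (\<xi> \<bullet> x)))" by simp
    finally have "(LINT x|lborel. g x * cos (real n * (\<xi> \<bullet> x))) =
      - (LINT x|lborel. g (x + h n) * cos (real n * (\<xi> \<bullet> x)))" .
    then show ?thesis using gi[of 0 n] gi[of "h n" n] by (simp add: left_diff_distrib)
  qed
  have "(\<lambda>n. LINT x|lborel. (g x - g (x + h n)) * cos (real n * (\<xi> \<bullet> x))) \<longlonglongrightarrow> (LINT x|(lborel::'a measure). 0)"
  proof (rule dominated_convergence_bounded_support[where R = "R + B" and K = "2 * K"])
    show "(\<lambda>x. (g x - g (x + h n)) * cos (real n * (\<xi> \<bullet> x))) \<in> borel_measurable borel" for n
      using gm gms[of "h n"] by auto
    show "AE x in lborel. (\<lambda>n. (g x - g (x + h n)) * cos (real n * (\<xi> \<bullet> x))) \<longlonglongrightarrow> 0"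
    proof (intro AE_I2)
      fix x
      have "(\<lambda>n. g (x + h n)) \<longlonglongrightarrow> g (x + 0)"
        using g(1) by (intro isCont_tendsto_compose[of _ g] tendsto_intros hlim)
          (auto simp: continuous_on_eq_continuous_at)
      then have "(\<lambda>n. g x - g (x + h n)) \<longlonglongrightarrow> g x - g x" by (intro tendsto_intros) auto
      then have l0: "(\<lambda>n. \<bar>g x - g (x + h n)\<bar>) \<longlonglongrightarrow> 0" using tendsto_rabs_zero by simp
      show "(\<lambda>n. (g x - g (x + h n)) * cos (real n * (\<xi> \<bullet> x))) \<longlonglongrightarrow> 0"
        by (rule Lim_null_comparison[OF always_eventually l0]) (auto simp: abs_mult mult_left_le)
    qed
    show "(g x - g (x + h n)) * cos (real n * (\<xi> \<bullet> x)) = 0" if "norm x > R + B" for n x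
      using g(2)[of x] g(2)[of "x + h n"] B(1) B(2)[of n] that norm_triangle_ineq4[of "x + h n" "h n"] by simp
    show "norm ((g x - g (x + h n)) * cos (real n * (\<xi> \<bullet> x))) \<le> 2 * K" for n x
    proof -
      have "norm ((g x - g (x + h n)) * cos (real n * (\<xi> \<bullet> x))) \<le> \<bar>g x - g (x + h n)\<bar>"
        by (auto simp: abs_mult mult_left_le)
      also have "\<dots> \<le> 2 * K" using K[of x] K[of "x + h n"] by (simp add: abs_if split: if_splits)
      finally show ?thesis .
    qed
  qed auto
  then have "(\<lambda>n. (1/2) * (LINT x|lborel. (g x - g (x + h n)) * cos (real n * (\<xi> \<bullet> x)))) \<longlonglongrightarrow> (1/2) * 0"
    by (intro tendsto_intros) simp
  then have "(\<lambda>n. (1/2) * (LINT x|lborel. (g x - g (x + h n)) * cos (real n * (\<xi> \<bullet> x)))) \<longlonglongrightarrow> 0"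
    by (simp only: mult_zero_right)
  then show ?thesis
  proof (rule Lim_transform_eventually)
    show "\<forall>\<^sub>F n in sequentially. (1/2) * (LINT x|lborel. (g x - g (x + h n)) * cos (real n * (\<xi> \<bullet> x)))
       = (LINT x|lborel. g x * cos (real n * (\<xi> \<bullet> x)))"
      using eventually_gt_at_top[of 0]
    proof eventually_elim
      case (elim n)
      show ?case unfolding half[OF elim, symmetric] by simp
    qed
  qed
qed

section \<open>Geometry of the constraint set\<close>

text \<open>A velocity is a complex number \<open>V\<close>, and \<open>Z = 2 (A + i B)\<close> encodes the traceless symmetric matrix
  \<open>U\<close> with rows \<open>(A, B)\<close> and \<open>(B, -A)\<close>; the traceless part of \<open>V \<otimes> V\<close> corresponds to \<open>V\<^sup>2\<close>. The value below is
  twice the largest eigenvalue of \<open>V \<otimes> V - U\<close>, so subsolutions are the states where it is less than \<open>C\<close>.\<close>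

definition subsol_energy :: "complex \<Rightarrow> complex \<Rightarrow> real" where
  "subsol_energy V Z = (cmod V)\<^sup>2 + cmod (V\<^sup>2 - Z)"

text \<open>In the frame rotated by \<open>W\<close> the velocity is \<open>v\<close>. The slope
  \<open>2 * Im v\<close> is the one that cancels the imaginary part of \<open>2 * s * v\<close>, so
  that \<open>V\<^sup>2 - Z\<close> moves by a real multiple of \<open>W\<^sup>2\<close>.\<close>

lemma subsol_energy_frame:
  fixes V W Z :: complex
  assumes "cmod W = 1"
  defines "v \<equiv> V / W"
  shows "subsol_energy (V + of_real s * W) (Z + of_real s * (\<i> * of_real (2 * Im v) * W\<^sup>2)) =
    (Re v + s)\<^sup>2 + (Im v)\<^sup>2 + cmod ((V\<^sup>2 - Z) / W\<^sup>2 + of_real (2 * s * Re v + s\<^sup>2))"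
proof -
  have W: "W \<noteq> 0" using assms(1) by auto
  have V: "V = W * v" using W by (simp add: v_def)
  have a: "V + of_real s * W = W * (v + of_real s)" by (simp add: V algebra_simps)
  have b: "(V + of_real s * W)\<^sup>2 - (Z + of_real s * (\<i> * of_real (2 * Im v) * W\<^sup>2)) =
    W\<^sup>2 * ((V\<^sup>2 - Z) / W\<^sup>2 + of_real (2 * s * Re v + s\<^sup>2))"
  proof -
    have *: "2 * v = 2 * of_real (Re v) + 2 * \<i> * of_real (Im v)"
      by (simp add: complex_eq_iff)
    have "(V + of_real s * W)\<^sup>2 - (Z + of_real s * (\<i> * of_real (2 * Im v) * W\<^sup>2)) =
      V\<^sup>2 - Z + W\<^sup>2 * (of_real s * (2 * v) + (of_real s)\<^sup>2 - of_real s * \<i> * of_real (2 * Im v))"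
      by (simp add: V power2_eq_square algebra_simps)
    also have "\<dots> = V\<^sup>2 - Z + W\<^sup>2 * of_real (2 * s * Re v + s\<^sup>2)"
      unfolding * by (simp add: algebra_simps)
    finally show ?thesis using W by (simp add: field_simps)
  qed
  have c: "(cmod (W * (v + of_real s)))\<^sup>2 = (Re v + s)\<^sup>2 + (Im v)\<^sup>2"
    using assms(1) by (simp add: norm_mult cmod_power2)
  show ?thesis unfolding subsol_energy_def b unfolding a c using assms(1) by (simp add: norm_mult norm_power)
qed

text \<open>The plane-wave directions are \<open>(W, i r W\<^sup>2)\<close> with \<open>r\<close> real. If \<open>Z\<close> is far from \<open>V\<^sup>2\<close>, the choice
  \<open>W\<^sup>2 = - (V\<^sup>2 - Z) / |V\<^sup>2 - Z|\<close> makes the energy constant along the segment; otherwise the energy is far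
  below \<open>C\<close>, and for \<open>W\<close> orthogonal to \<open>V\<close> it grows only quadratically.\<close>

lemma subsol_energy_segment:
  fixes V Z :: complex
  assumes C: "subsol_energy V Z < C"
  defines "s0 \<equiv> (C - (cmod V)\<^sup>2) / (8 * sqrt C)"
  obtains W r where "cmod W = 1"
    "\<And>s. \<bar>s\<bar> \<le> s0 \<Longrightarrow>
      subsol_energy (V + of_real s * W) (Z + of_real s * (\<i> * of_real r * W\<^sup>2)) \<le> (C + subsol_energy V Z) / 2"
proof -
  define e m L where "e = subsol_energy V Z" and "m = cmod (V\<^sup>2 - Z)" and "L = C - (cmod V)\<^sup>2"
  have em: "e = (cmod V)\<^sup>2 + m" by (simp add: e_def m_def subsol_energy_def)
  have m0: "m \<ge> 0" by (simp add: m_def)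
  have eC: "e < C" using C e_def by simp
  have C0: "C > 0" using eC em m0 by (smt (verit) zero_le_power2)
  have L0: "L > 0" using eC em m0 by (simp add: L_def)
  have VC: "(cmod V)\<^sup>2 \<le> C" "L \<le> C" using L0 by (auto simp: L_def)
  have VsC: "cmod V \<le> sqrt C" using VC by (intro real_le_rsqrt)
  have sC: "sqrt C > 0" "sqrt C * sqrt C = C" using C0 by auto
  have s0: "s0 = L / (8 * sqrt C)" by (simp add: s0_def L_def)
  have s0p: "s0 > 0" using s0 L0 sC by simp
  \<comment> \<open>The factor 8 in \<open>s0\<close> serves the estimate \<open>2 * s0 * sqrt C +
    s0\<^sup>2 \<le> L / 4 + L / 64 \<le> L / 2\<close> of the first case.\<close>
  have s0C: "8 * (s0 * sqrt C) = L" using sC s0 by simp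
  have s0le: "8 * s0 \<le> sqrt C"
  proof -
    have "8 * s0 * sqrt C \<le> sqrt C * sqrt C" using s0C sC VC by simp
    then show ?thesis using sC(1) mult_le_cancel_right_pos by blast
  qed
  show thesis
  proof (cases "m \<ge> L / 2")
    case True
    then have mpos: "m > 0" using L0 by linarith
    define W where "W = csqrt (- ((V\<^sup>2 - Z) / of_real m))"
    have W2: "W\<^sup>2 = - ((V\<^sup>2 - Z) / of_real m)" by (simp add: W_def)
    have "cmod (W\<^sup>2) = 1"
      unfolding W2 using mpos by (simp add: norm_divide m_def[symmetric])
    then have "(cmod W)\<^sup>2 = 1" by (simp add: norm_power)
    then have W1: "cmod W = 1" using power2_eq_imp_eq[of "cmod W" 1] by simp
    have q: "(V\<^sup>2 - Z) / W\<^sup>2 = - of_real m"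
    proof -
      have "V\<^sup>2 - Z \<noteq> 0" using mpos m_def by auto
      then show ?thesis unfolding W2 using mpos by (simp add: field_simps)
    qed
    define v where "v = V / W"
    have vn: "cmod v = cmod V" by (simp add: v_def norm_divide W1)
    have vp: "(Re v)\<^sup>2 + (Im v)\<^sup>2 = (cmod V)\<^sup>2" using vn cmod_power2[of v] by simp
    have Re: "\<bar>Re v\<bar> \<le> sqrt C" using abs_Re_le_cmod[of v] vn VsC by simp
    have "subsol_energy (V + of_real s * W) (Z + of_real s * (\<i> * of_real (2 * Im v) * W\<^sup>2)) \<le> (C + subsol_energy V Z) / 2"
      if s: "\<bar>s\<bar> \<le> s0" for s
    proof -
      have "2 * s * Re v + s\<^sup>2 \<le> 2 * \<bar>s\<bar> * \<bar>Re v\<bar> + \<bar>s\<bar> * \<bar>s\<bar>"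
        using abs_ge_self[of "s * Re v"] by (simp add: abs_mult power2_eq_square)
      also have "\<dots> \<le> 2 * s0 * sqrt C + s0 * s0"
        by (intro add_mono mult_mono) (use s Re s0p sC in auto)
      also have "\<dots> \<le> L / 2"
      proof -
        have "s0 * (8 * s0) \<le> s0 * sqrt C" using s0le s0p by (intro mult_left_mono) auto
        moreover have "2 * s0 * sqrt C = L / 4" using s0C by simp
        ultimately show ?thesis using s0C L0 by (simp add: algebra_simps)
      qed
      also have "\<dots> \<le> m" by fact
      finally have le: "2 * s * Re v + s\<^sup>2 \<le> m" .
      \<comment> \<open>By \<open>le\<close> the argument of the modulus stays on the negative real
        axis, so the modulus decreases by exactly the amount by which the squared velocity
        grows.\<close>
      have "subsol_energy (V + of_real s * W) (Z + of_real s * (\<i> * of_real (2 * Im v) * W\<^sup>2)) =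
        (Re v + s)\<^sup>2 + (Im v)\<^sup>2 + cmod (- of_real m + of_real (2 * s * Re v + s\<^sup>2))"
        using subsol_energy_frame[OF W1, of V s Z, folded v_def] q by simp
      also have "- of_real m + of_real (2 * s * Re v + s\<^sup>2) = (of_real (- (m - (2 * s * Re v + s\<^sup>2))) :: complex)"
        by simp
      also have "cmod \<dots> = m - (2 * s * Re v + s\<^sup>2)" unfolding norm_of_real using le by simp
      finally have "subsol_energy (V + of_real s * W) (Z + of_real s * (\<i> * of_real (2 * Im v) * W\<^sup>2)) = e"
        using vp em by (simp add: power2_eq_square algebra_simps)
      then show ?thesis using eC by (simp add: e_def)
    qed
    then show thesis using that W1 by blast
  next
    case False
    then have Ce: "C - e \<ge> L / 2" using em by (simp add: L_def)
    define W where "W = (if V = 0 then 1 else \<i> * V / of_real (cmod V))"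
    have W1: "cmod W = 1" by (auto simp: W_def norm_mult norm_divide)
    define v where "v = V / W"
    have vn: "cmod v = cmod V" by (simp add: v_def norm_divide W1)
    have Re: "Re v = 0" by (auto simp: v_def W_def)
    have vp: "(Im v)\<^sup>2 = (cmod V)\<^sup>2" using vn cmod_power2[of v] Re by simp
    have "subsol_energy (V + of_real s * W) (Z + of_real s * (\<i> * of_real (2 * Im v) * W\<^sup>2)) \<le> (C + subsol_energy V Z) / 2"
      if s: "\<bar>s\<bar> \<le> s0" for s
    proof -
      have "s\<^sup>2 \<le> s0\<^sup>2" using s by (metis abs_ge_zero power2_abs power_mono)
      also have "s0\<^sup>2 \<le> L / 64"
      proof -
        have "s0 * (8 * s0) \<le> s0 * sqrt C" using s0le s0p by (intro mult_left_mono) auto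
        then show ?thesis using s0C by (simp add: power2_eq_square)
      qed
      \<comment> \<open>The energy rises by at most \<open>2 * s\<^sup>2\<close>, which may use up
        half of the gap \<open>C - e\<close>.\<close>
      finally have s2: "4 * s\<^sup>2 \<le> C - e" using Ce L0 by simp
      have "subsol_energy (V + of_real s * W) (Z + of_real s * (\<i> * of_real (2 * Im v) * W\<^sup>2)) =
        s\<^sup>2 + (Im v)\<^sup>2 + cmod ((V\<^sup>2 - Z) / W\<^sup>2 + of_real (s\<^sup>2))"
        using subsol_energy_frame[OF W1, of V s Z, folded v_def] Re by simp
      also have "\<dots> \<le> s\<^sup>2 + (Im v)\<^sup>2 + (cmod ((V\<^sup>2 - Z) / W\<^sup>2) + s\<^sup>2)"
        using norm_triangle_ineq[of "(V\<^sup>2 - Z) / W\<^sup>2" "of_real (s\<^sup>2)"] unfolding norm_of_real by simp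
      also have "cmod ((V\<^sup>2 - Z) / W\<^sup>2) = m" by (simp add: norm_divide norm_power W1 m_def)
      finally show ?thesis using s2 vp em by (simp add: e_def)
    qed
    then show thesis using that W1 by blast
  qed
qed

section \<open>Localized plane waves\<close>

lemma has_real_derivative_pos_part_power:
  "((\<lambda>x::real. max 0 x ^ Suc (Suc n)) has_real_derivative real (Suc (Suc n)) * max 0 x ^ Suc n) (at x)"
proof -
  consider "x > 0" | "x < 0" | "x = 0" by linarith
  then show ?thesis
  proof cases
    case 1
    have "((\<lambda>x. x ^ Suc (Suc n)) has_real_derivative real (Suc (Suc n)) * x ^ Suc n) (at x)"
      using DERIV_pow[of "Suc (Suc n)" x] by simp
    then have "((\<lambda>x. max 0 x ^ Suc (Suc n)) has_real_derivative real (Suc (Suc n)) * x ^ Suc n) (at x)"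
      by (rule has_field_derivative_transform_within_open[of _ _ _ "{0<..}"]) (use 1 in \<open>auto simp: max_def\<close>)
    then show ?thesis using 1 by (simp add: max_def)
  next
    case 2
    have "((\<lambda>x::real. 0::real) has_real_derivative 0) (at x)" by simp
    then have "((\<lambda>x. max 0 x ^ Suc (Suc n)) has_real_derivative 0) (at x)"
      by (rule has_field_derivative_transform_within_open[of _ _ _ "{..<0}"]) (use 2 in \<open>auto simp: max_def\<close>)
    then show ?thesis using 2 by (simp add: max_def)
  next
    case 3
    have "((\<lambda>h::real. max 0 h ^ Suc n) \<longlongrightarrow> max 0 0 ^ Suc n) (at 0)" by (intro tendsto_intros)
    then have l: "((\<lambda>h::real. max 0 h ^ Suc n) \<longlongrightarrow> 0) (at 0)" by simp
    have "((\<lambda>h::real. max 0 h ^ Suc (Suc n) / h) \<longlongrightarrow> 0) (at 0)"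
      by (rule Lim_null_comparison[OF always_eventually l]) (auto simp: max_def field_simps)
    then show ?thesis using 3 by (simp add: has_field_derivative_iff)
  qed
qed

text \<open>The function \<open>(1 - t\<^sup>2)\<^sub>+\<^sup>4\<close> and its first three derivatives.\<close>

definition bump :: "nat \<Rightarrow> real \<Rightarrow> real" where
  "bump k t = (let q = max 0 (1 - t\<^sup>2) in
     if k = 0 then q ^ 4 else if k = 1 then - 8 * t * q ^ 3
     else if k = 2 then 48 * t\<^sup>2 * q\<^sup>2 - 8 * q ^ 3 else 144 * t * q\<^sup>2 - 192 * t ^ 3 * q)"

text \<open>The potential of \<open>lin_euler_potential\<close> is differentiated at most three
  times in each variable. The fourth power leaves one factor \<open>q\<close> in the third
  derivative, which is why that derivative is still continuous.\<close>

lemma bump_deriv: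
  assumes "k < 3"
  shows "(bump k has_real_derivative bump (Suc k) t) (at t)"
proof -
  have q: "((\<lambda>t. max 0 (1 - t\<^sup>2) ^ Suc (Suc n)) has_real_derivative
     real (Suc (Suc n)) * max 0 (1 - t\<^sup>2) ^ Suc n * (- 2 * t)) (at t)" for n and t :: real
    by (rule DERIV_chain2[OF has_real_derivative_pos_part_power]) (auto intro!: derivative_eq_intros)
  have q4: "((\<lambda>t. max 0 (1 - t\<^sup>2) ^ 4) has_real_derivative 4 * max 0 (1 - t\<^sup>2) ^ 3 * (- 2 * t)) (at t)" for t :: real
    using q[of 2 t] by (simp add: eval_nat_numeral)
  have q3: "((\<lambda>t. max 0 (1 - t\<^sup>2) ^ 3) has_real_derivative 3 * (max 0 (1 - t\<^sup>2))\<^sup>2 * (- 2 * t)) (at t)" for t :: real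
    using q[of 1 t] by (simp add: eval_nat_numeral)
  have q2: "((\<lambda>t. (max 0 (1 - t\<^sup>2))\<^sup>2) has_real_derivative 2 * max 0 (1 - t\<^sup>2) * (- 2 * t)) (at t)" for t :: real
    using q[of 0 t] by (simp add: eval_nat_numeral)
  consider "k = 0" | "k = 1" | "k = 2" using assms by linarith
  then show ?thesis
  proof cases
    case 1
    then show ?thesis unfolding bump_def Let_def using q4[of t] by (simp add: algebra_simps)
  next
    case 2
    have "((\<lambda>t. - 8 * t * max 0 (1 - t\<^sup>2) ^ 3) has_real_derivative
       - 8 * t * (3 * (max 0 (1 - t\<^sup>2))\<^sup>2 * (- 2 * t)) + - 8 * max 0 (1 - t\<^sup>2) ^ 3) (at t)"
      by (rule derivative_eq_intros q3 refl)+ simp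
    then show ?thesis unfolding bump_def Let_def using 2 by (simp add: algebra_simps power2_eq_square)
  next
    case 3
    have "((\<lambda>t. 48 * t\<^sup>2 * (max 0 (1 - t\<^sup>2))\<^sup>2 - 8 * max 0 (1 - t\<^sup>2) ^ 3) has_real_derivative
       48 * (2 * t) * (max 0 (1 - t\<^sup>2))\<^sup>2 + 48 * t\<^sup>2 * (2 * max 0 (1 - t\<^sup>2) * (- 2 * t))
        - 8 * (3 * (max 0 (1 - t\<^sup>2))\<^sup>2 * (- 2 * t))) (at t)"
      by (rule derivative_eq_intros q3 q2 refl)+ simp
    moreover have "48 * (2 * t) * (max 0 (1 - t\<^sup>2))\<^sup>2 + 48 * t\<^sup>2 * (2 * max 0 (1 - t\<^sup>2) * (- 2 * t))
        - 8 * (3 * (max 0 (1 - t\<^sup>2))\<^sup>2 * (- 2 * t)) = bump (Suc k) t"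
      using 3 by (simp add: bump_def Let_def power2_eq_square power3_eq_cube algebra_simps)
    ultimately show ?thesis unfolding bump_def[of k] Let_def using 3 by simp
  qed
qed

lemma bump_continuous: "continuous_on UNIV (bump k)"
proof -
  have "bump k = (if k = 0 then (\<lambda>t. max 0 (1 - t\<^sup>2) ^ 4) else if k = 1 then (\<lambda>t. - 8 * t * max 0 (1 - t\<^sup>2) ^ 3)
     else if k = 2 then (\<lambda>t. 48 * t\<^sup>2 * (max 0 (1 - t\<^sup>2))\<^sup>2 - 8 * max 0 (1 - t\<^sup>2) ^ 3)
     else (\<lambda>t. 144 * t * (max 0 (1 - t\<^sup>2))\<^sup>2 - 192 * t ^ 3 * max 0 (1 - t\<^sup>2)))"
    by (auto simp: bump_def Let_def fun_eq_iff)
  then show ?thesis by (simp) (intro conjI impI continuous_intros)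
qed

lemma bump_eq_0: "\<bar>t\<bar> \<ge> 1 \<Longrightarrow> bump k t = 0"
proof -
  assume "\<bar>t\<bar> \<ge> 1"
  then have "max 0 (1 - t\<^sup>2) = 0" using one_le_power[of "\<bar>t\<bar>" 2] by simp
  then show ?thesis by (simp add: bump_def Let_def)
qed

lemma bump_nonneg: "0 \<le> bump 0 t" and bump_le_1: "bump 0 t \<le> 1"
  by (auto simp: bump_def Let_def power_le_one)

lemma bump_ge: "\<bar>t\<bar> \<le> 1/2 \<Longrightarrow> bump 0 t \<ge> 1/4"
proof -
  assume "\<bar>t\<bar> \<le> 1/2"
  then have "t\<^sup>2 \<le> (1/2)\<^sup>2" by (metis abs_ge_zero power2_abs power_mono)
  then have "1 - t\<^sup>2 \<ge> 3/4" by (simp add: power2_eq_square)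
  then have "max 0 (1 - t\<^sup>2) \<ge> 3/4" by linarith
  then have "max 0 (1 - t\<^sup>2) ^ 4 \<ge> (3/4) ^ 4" by (rule power_mono) simp
  then show ?thesis by (simp add: bump_def Let_def eval_nat_numeral)
qed

definition cutoff :: "real \<Rightarrow> real \<Rightarrow> nat \<Rightarrow> real \<Rightarrow> real" where
  "cutoff a h k t = bump k ((t - a) / h) / h ^ k"

lemma cutoff_deriv:
  assumes "k < 3" "h > 0"
  shows "(cutoff a h k has_real_derivative cutoff a h (Suc k) t) (at t)"
proof -
  have "((\<lambda>t. bump k ((t - a) / h)) has_real_derivative bump (Suc k) ((t - a) / h) * (1 / h)) (at t)"
    by (rule DERIV_chain2[OF bump_deriv[OF assms(1)]]) (use assms(2) in \<open>auto intro!: derivative_eq_intros\<close>)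
  from DERIV_cdivide[OF this, of "h ^ k"] show ?thesis
    unfolding cutoff_def[abs_def] using assms(2) by (simp add: field_simps)
qed

lemma cutoff_continuous: "continuous_on UNIV (cutoff a h k)"
  unfolding cutoff_def[abs_def] divide_inverse
  by (intro continuous_intros continuous_on_compose2[OF bump_continuous]) auto

lemma cutoff_eq_0: "h > 0 \<Longrightarrow> \<bar>t - a\<bar> \<ge> h \<Longrightarrow> cutoff a h k t = 0"
  by (simp add: cutoff_def bump_eq_0)

lemma cutoff_bounded:
  assumes "h > 0"
  obtains M where "M \<ge> 1" "\<And>k t. k \<le> 3 \<Longrightarrow> \<bar>cutoff a h k t\<bar> \<le> M"
proof -
  have "\<exists>M. \<forall>t. \<bar>cutoff a h k t\<bar> \<le> M" for k
  proof -
    have "compact (cutoff a h k ` {a - h..a + h})"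
      by (intro compact_continuous_image continuous_on_subset[OF cutoff_continuous]) auto
    then have "bounded (cutoff a h k ` {a - h..a + h})" by (rule compact_imp_bounded)
    then obtain M where M: "\<forall>t\<in>{a - h..a + h}. \<bar>cutoff a h k t\<bar> \<le> M"
      unfolding bounded_iff by auto
    have "\<bar>cutoff a h k t\<bar> \<le> max M 0" for t
    proof (cases "t \<in> {a - h..a + h}")
      case False
      then have "\<bar>t - a\<bar> \<ge> h" by auto
      then show ?thesis using cutoff_eq_0[OF assms] by simp
    qed (use M in force)
    then show ?thesis by blast
  qed
  then obtain M where M: "\<And>k t. \<bar>cutoff a h k t\<bar> \<le> M k" by metis
  show thesis
  proof (rule that[of "1 + \<bar>M 0\<bar> + \<bar>M 1\<bar> + \<bar>M 2\<bar> + \<bar>M 3\<bar>"])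
    fix k t assume "k \<le> (3::nat)"
    then consider "k = 0" | "k = 1" | "k = 2" | "k = 3" by linarith
    then show "\<bar>cutoff a h k t\<bar> \<le> 1 + \<bar>M 0\<bar> + \<bar>M 1\<bar> + \<bar>M 2\<bar> + \<bar>M 3\<bar>"
      using M[of k t] by cases auto
  qed simp
qed

text \<open>The \<open>k\<close>-th derivative of \<open>cutoff \<cdot> exp (i n \<kappa> t)\<close> divided by \<open>n\<^sup>k\<close>, for \<open>k \<le> 3\<close>.\<close>

definition osc :: "real \<Rightarrow> real \<Rightarrow> real \<Rightarrow> real \<Rightarrow> nat \<Rightarrow> real \<Rightarrow> complex" where
  "osc n \<kappa> a h k t = cis (n * \<kappa> * t) *
    (if k = 0 then of_real (cutoff a h 0 t)
     else if k = 1 then of_real (cutoff a h 1 t / n) + \<i> * of_real (\<kappa> * cutoff a h 0 t)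
     else if k = 2 then of_real (cutoff a h 2 t / n\<^sup>2) + 2 * \<i> * of_real (\<kappa> * cutoff a h 1 t / n) - of_real (\<kappa>\<^sup>2 * cutoff a h 0 t)
     else of_real (cutoff a h 3 t / n ^ 3) + 3 * \<i> * of_real (\<kappa> * cutoff a h 2 t / n\<^sup>2)
       - 3 * of_real (\<kappa>\<^sup>2 * cutoff a h 1 t / n) - \<i> * of_real (\<kappa> ^ 3 * cutoff a h 0 t))"

lemma osc_deriv:
  assumes "k < 3" "h > 0" "n > 0"
  shows "(osc n \<kappa> a h k has_vector_derivative of_real n * osc n \<kappa> a h (Suc k) t) (at t)"
proof -
  have c: "((\<lambda>t. complex_of_real (cutoff a h j t)) has_vector_derivative complex_of_real (cutoff a h (Suc j) t)) (at t)" if "j < 3" for j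
    by (intro has_vector_derivative_of_real) (use cutoff_deriv[OF that assms(2)] in \<open>simp add: has_real_derivative_iff_has_vector_derivative\<close>)
  have e: "((\<lambda>t. cis (n * \<kappa> * t)) has_vector_derivative (\<i> * of_real (n * \<kappa>)) * cis (n * \<kappa> * t)) (at t)"
  proof -
    have "((\<lambda>z. exp (\<i> * of_real (n * \<kappa>) * z)) has_field_derivative
        \<i> * of_real (n * \<kappa>) * exp (\<i> * of_real (n * \<kappa>) * of_real t)) (at (of_real t))"
      by (auto intro!: derivative_eq_intros)
    from has_vector_derivative_real_field[OF this] show ?thesis
      by (simp add: cis_conv_exp algebra_simps)
  qed
  note c0 = c[of 0, simplified] and c1 = c[of 1, simplified, folded numeral_2_eq_2] and c2 = c[of 2, simplified, folded numeral_3_eq_3]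
  consider "k = 0" | "k = 1" | "k = 2" using assms by linarith
  then show ?thesis
  proof cases
    case 1
    have "((\<lambda>t. cis (n * \<kappa> * t) * complex_of_real (cutoff a h 0 t)) has_vector_derivative
       cis (n * \<kappa> * t) * complex_of_real (cutoff a h 1 t) +
       (\<i> * of_real (n * \<kappa>)) * cis (n * \<kappa> * t) * complex_of_real (cutoff a h 0 t)) (at t)"
      using c0 by (intro has_vector_derivative_mult e) auto
    moreover have "cis (n * \<kappa> * t) * complex_of_real (cutoff a h 1 t) +
       (\<i> * of_real (n * \<kappa>)) * cis (n * \<kappa> * t) * complex_of_real (cutoff a h 0 t) = of_real n * osc n \<kappa> a h (Suc k) t"
      using 1 assms(3) by (simp add: osc_def field_simps)
    moreover have "osc n \<kappa> a h k = (\<lambda>t. cis (n * \<kappa> * t) * complex_of_real (cutoff a h 0 t))"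
      using 1 by (simp add: osc_def fun_eq_iff)
    ultimately show ?thesis by simp
  next
    case 2
    have "((\<lambda>t. cis (n * \<kappa> * t) * (complex_of_real (cutoff a h 1 t) * of_real (1 / n) + \<i> * of_real \<kappa> * complex_of_real (cutoff a h 0 t)))
       has_vector_derivative
       cis (n * \<kappa> * t) * (complex_of_real (cutoff a h 2 t) * of_real (1 / n) + \<i> * of_real \<kappa> * complex_of_real (cutoff a h 1 t)) +
       (\<i> * of_real (n * \<kappa>)) * cis (n * \<kappa> * t) * (complex_of_real (cutoff a h 1 t) * of_real (1 / n) + \<i> * of_real \<kappa> * complex_of_real (cutoff a h 0 t))) (at t)"
      using c0 c1 by (intro has_vector_derivative_mult e has_vector_derivative_add has_vector_derivative_mult_left has_vector_derivative_mult_right) auto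
    then show ?thesis unfolding osc_def[abs_def] using 2 assms(3)
      by (simp add: field_simps power2_eq_square)
  next
    case 3
    have "((\<lambda>t. cis (n * \<kappa> * t) * (complex_of_real (cutoff a h 2 t) * of_real (1 / n\<^sup>2) + 2 * \<i> * of_real (\<kappa> / n) * complex_of_real (cutoff a h 1 t)
        - of_real (\<kappa>\<^sup>2) * complex_of_real (cutoff a h 0 t)))
       has_vector_derivative
       cis (n * \<kappa> * t) * (complex_of_real (cutoff a h 3 t) * of_real (1 / n\<^sup>2) + 2 * \<i> * of_real (\<kappa> / n) * complex_of_real (cutoff a h 2 t)
        - of_real (\<kappa>\<^sup>2) * complex_of_real (cutoff a h 1 t)) +
       (\<i> * of_real (n * \<kappa>)) * cis (n * \<kappa> * t) * (complex_of_real (cutoff a h 2 t) * of_real (1 / n\<^sup>2) + 2 * \<i> * of_real (\<kappa> / n) * complex_of_real (cutoff a h 1 t)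
        - of_real (\<kappa>\<^sup>2) * complex_of_real (cutoff a h 0 t))) (at t)"
      using c0 c1 c2 by (intro has_vector_derivative_mult e has_vector_derivative_diff has_vector_derivative_add has_vector_derivative_mult_left has_vector_derivative_mult_right) auto
    then show ?thesis unfolding osc_def[abs_def] using 3 assms(3)
      by (simp add: field_simps power2_eq_square power3_eq_cube)
  qed
qed

lemma osc_continuous:
  shows "continuous_on UNIV (osc n \<kappa> a h k)"
  unfolding osc_def[abs_def] divide_inverse
  by (cases "k = 0"; cases "k = 1"; cases "k = 2") (auto intro!: continuous_intros cutoff_continuous)

lemma osc_eq_0: "h > 0 \<Longrightarrow> \<bar>t - a\<bar> \<ge> h \<Longrightarrow> osc n \<kappa> a h k t = 0"
  by (simp add: osc_def cutoff_eq_0)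

text \<open>By the Leibniz rule, every derivative that falls on the cutoff instead of the
  exponential costs a factor \<open>1 / n\<close>. Only the term with all derivatives on the
  exponential is of order one.\<close>

lemma osc_asymp:
  assumes "h > 0"
  obtains K where "K > 0"
    "\<And>n k t. n \<ge> 1 \<Longrightarrow> k \<le> 3 \<Longrightarrow>
       cmod (osc n \<kappa> a h k t - (\<i> * of_real \<kappa>) ^ k * of_real (cutoff a h 0 t) * cis (n * \<kappa> * t)) \<le> K / n"
proof -
  obtain M where M: "M \<ge> 1" "\<And>k t. k \<le> 3 \<Longrightarrow> \<bar>cutoff a h k t\<bar> \<le> M" using cutoff_bounded[OF assms] by metis
  \<comment> \<open>The coefficients are the binomial ones of the case \<open>k = 3\<close>; they
    dominate those of smaller \<open>k\<close>.\<close>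
  define K where "K = M * (1 + 3 * \<bar>\<kappa>\<bar> + 3 * \<kappa>\<^sup>2)"
  have cM: "\<bar>cutoff a h k t / n ^ Suc j\<bar> \<le> M / n" if "n \<ge> 1" "k \<le> 3" for n k t j
  proof -
    have "n \<le> n ^ Suc j" using that by simp
    then have "\<bar>cutoff a h k t\<bar> / n ^ Suc j \<le> M / n"
      using M(2)[OF that(2), of t] that(1) M(1) by (intro frac_le) auto
    then show ?thesis using that by simp
  qed
  have "cmod (osc n \<kappa> a h k t - (\<i> * of_real \<kappa>) ^ k * of_real (cutoff a h 0 t) * cis (n * \<kappa> * t)) \<le> K / n"
    if n: "n \<ge> 1" and k: "k \<le> 3" for n k t
  proof -
    have M0: "M / n \<ge> 0" using M n by simp
    have b1: "\<bar>cutoff a h j t / n\<bar> \<le> M / n" if "j \<le> 3" for j using cM[OF n that, of t 0] by simp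
    have b2: "\<bar>cutoff a h j t / n\<^sup>2\<bar> \<le> M / n" if "j \<le> 3" for j using cM[OF n that, of t 1] by (simp add: numeral_2_eq_2)
    have b3: "\<bar>cutoff a h j t / n ^ 3\<bar> \<le> M / n" if "j \<le> 3" for j using cM[OF n that, of t 2] by (simp add: numeral_3_eq_3)
    have Ke: "K / n = M / n + 3 * (\<bar>\<kappa>\<bar> * (M / n)) + 3 * (\<kappa>\<^sup>2 * (M / n))"
      using n by (simp add: K_def field_simps)
    have nn: "\<bar>\<kappa>\<bar> * (M / n) \<ge> 0" "\<kappa>\<^sup>2 * (M / n) \<ge> 0"
      by (simp_all only: mult_nonneg_nonneg abs_ge_zero zero_le_power2 M0)
    have tri: "cmod (x + y - w) \<le> cmod x + cmod y + cmod w" for x y w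
      by (smt (verit) norm_triangle_ineq norm_triangle_ineq4)
    consider "k = 0" | "k = 1" | "k = 2" | "k = 3" using k by linarith
    then show ?thesis
    proof cases
      case 1
      then show ?thesis using nn M0 by (simp add: osc_def Ke)
    next
      case 2
      have "osc n \<kappa> a h k t - (\<i> * of_real \<kappa>) ^ k * of_real (cutoff a h 0 t) * cis (n * \<kappa> * t) =
        cis (n * \<kappa> * t) * of_real (cutoff a h 1 t / n)" using 2 by (simp add: osc_def algebra_simps)
      also have "cmod \<dots> = \<bar>cutoff a h 1 t / n\<bar>" by (simp only: norm_mult norm_cis norm_of_real mult_1)
      finally show ?thesis using b1[of 1] nn Ke by simp
    next
      case 3
      have "osc n \<kappa> a h k t - (\<i> * of_real \<kappa>) ^ k * of_real (cutoff a h 0 t) * cis (n * \<kappa> * t) =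
        cis (n * \<kappa> * t) * (of_real (cutoff a h 2 t / n\<^sup>2) + 2 * \<i> * of_real (\<kappa> * (cutoff a h 1 t / n)) - 0)"
        using 3 by (simp add: osc_def algebra_simps power2_eq_square)
      also have "cmod \<dots> \<le> \<bar>cutoff a h 2 t / n\<^sup>2\<bar> + 2 * (\<bar>\<kappa>\<bar> * \<bar>cutoff a h 1 t / n\<bar>) + 0"
        by (simp only: norm_mult[of "cis _"] norm_cis mult_1, rule order_trans[OF tri],
              simp only: norm_mult norm_of_real abs_mult norm_ii norm_zero norm_numeral mult_1_right)
      also have "\<dots> \<le> M / n + 2 * (\<bar>\<kappa>\<bar> * (M / n)) + 0" by (intro add_mono mult_left_mono b1 b2) auto
      also have "\<dots> \<le> K / n"
      proof -
        have "p + 2 * x + 0 \<le> p + 3 * x + 3 * y" if "0 \<le> x" "0 \<le> y" for p x y :: real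
          using that by linarith
        then show ?thesis unfolding Ke using nn by blast
      qed
      finally show ?thesis .
    next
      case 4
      have "osc n \<kappa> a h k t - (\<i> * of_real \<kappa>) ^ k * of_real (cutoff a h 0 t) * cis (n * \<kappa> * t) =
        cis (n * \<kappa> * t) * (of_real (cutoff a h 3 t / n ^ 3) + 3 * \<i> * of_real (\<kappa> * (cutoff a h 2 t / n\<^sup>2))
          - 3 * of_real (\<kappa>\<^sup>2 * (cutoff a h 1 t / n)))"
        using 4 by (simp add: osc_def algebra_simps power3_eq_cube)
      also have "cmod \<dots> \<le> \<bar>cutoff a h 3 t / n ^ 3\<bar> + 3 * (\<bar>\<kappa>\<bar> * \<bar>cutoff a h 2 t / n\<^sup>2\<bar>) + 3 * (\<kappa>\<^sup>2 * \<bar>cutoff a h 1 t / n\<bar>)"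
        by (simp only: norm_mult[of "cis _"] norm_cis mult_1, rule order_trans[OF tri],
              simp only: norm_mult norm_of_real abs_mult norm_ii norm_numeral mult_1_right abs_power2)
      also have "\<dots> \<le> M / n + 3 * (\<bar>\<kappa>\<bar> * (M / n)) + 3 * (\<kappa>\<^sup>2 * (M / n))" by (intro add_mono mult_left_mono b1 b2 b3) auto
      finally show ?thesis using Ke by simp
    qed
  qed
  moreover have "K > 0" unfolding K_def using M(1) by (intro mult_pos_pos add_pos_nonneg) auto
  ultimately show thesis using that by blast
qed

section \<open>Weakly divergence-free fields and the potential of the linear system\<close>

abbreviation E1 :: spacetime where "E1 \<equiv> (axis 1 1, 0)"
abbreviation E2 :: spacetime where "E2 \<equiv> (axis 2 1, 0)"
abbreviation E3 :: spacetime where "E3 \<equiv> (0, 1)"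

text \<open>The weak formulation contains first derivatives only, so this larger class serves as
  scalar test functions. It also receives the components of vector-valued test functions.\<close>

definition C1c :: "(spacetime \<Rightarrow> real) \<Rightarrow> bool" where
  "C1c \<psi> \<longleftrightarrow> Ck 1 \<psi> \<and> bounded {z. \<psi> z \<noteq> 0}"

abbreviation D :: "(spacetime \<Rightarrow> real) \<Rightarrow> spacetime \<Rightarrow> spacetime \<Rightarrow> real" where
  "D \<psi> z \<equiv> frechet_derivative \<psi> (at z)"

text \<open>The integral runs over all of space-time rather than over \<open>future\<close>: the
  fields that are added to the fan vanish at negative times, so the initial data enter through the
  fan alone.\<close>

definition weakly_div_free :: "(spacetime \<Rightarrow> spacetime) \<Rightarrow> bool" where
  "weakly_div_free m \<longleftrightarrow> (\<forall>\<psi>. C1c \<psi> \<longrightarrow> (LINT z|lborel. D \<psi> z (m z)) = 0)"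

lemma spacetime_decomp:
  fixes w :: spacetime
  shows "w = (fst w $ 1) *\<^sub>R E1 + (fst w $ 2) *\<^sub>R E2 + snd w *\<^sub>R E3"
  by (auto simp: prod_eq_iff vec_eq_iff forall_2 axis_def)

lemma C1cD:
  assumes "C1c \<psi>"
  shows "\<psi> differentiable (at z)" "continuous_on UNIV (\<lambda>z. D \<psi> z h)" "linear (D \<psi> z)"
    "continuous_on UNIV \<psi>" "((\<lambda>s. \<psi> (z + s *\<^sub>R h)) has_real_derivative D \<psi> z h) (at 0)"
proof -
  have "(\<forall>z. \<psi> differentiable (at z)) \<and> (\<forall>h. continuous_on UNIV (\<lambda>z. D \<psi> z h))"
    using assms unfolding C1c_def One_nat_def Ck.simps by blast
  then show d: "\<psi> differentiable (at z)" and "continuous_on UNIV (\<lambda>z. D \<psi> z h)" for z by blast+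
  show "linear (D \<psi> z)" using linear_frechet_derivative[OF d] .
  show "continuous_on UNIV \<psi>"
    using d by (intro differentiable_imp_continuous_on) (simp add: differentiable_on_def)
  have 1: "((\<lambda>s. z + s *\<^sub>R h) has_derivative (\<lambda>s. s *\<^sub>R h)) (at 0)"
    by (auto intro!: derivative_eq_intros)
  have 2: "(\<psi> has_derivative D \<psi> z) (at (z + 0 *\<^sub>R h))" using d[of z] unfolding frechet_derivative_works by simp
  have "((\<lambda>s. \<psi> (z + s *\<^sub>R h)) has_derivative (\<lambda>s. D \<psi> z (s *\<^sub>R h))) (at 0)"
    by (rule has_derivative_compose[OF 1 2])
  then show "((\<lambda>s. \<psi> (z + s *\<^sub>R h)) has_real_derivative D \<psi> z h) (at 0)"
    by (simp add: has_field_derivative_def linear_scale[OF \<open>linear (D \<psi> z)\<close>] mult.commute[of _ "D \<psi> z h"])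
qed

lemma C1c_decomp:
  assumes "C1c \<psi>"
  shows "D \<psi> z w = fst w $ 1 * D \<psi> z E1 + fst w $ 2 * D \<psi> z E2 + snd w * D \<psi> z E3"
proof -
  note l = C1cD(3)[OF assms, of z]
  have "D \<psi> z ((fst w $ 1) *\<^sub>R E1 + (fst w $ 2) *\<^sub>R E2 + snd w *\<^sub>R E3) =
      fst w $ 1 * D \<psi> z E1 + fst w $ 2 * D \<psi> z E2 + snd w * D \<psi> z E3"
    by (simp only: linear_add[OF l] linear_scale[OF l] real_scaleR_def)
  then show ?thesis unfolding spacetime_decomp[of w, symmetric] .
qed

lemma C1c_support:
  assumes "C1c \<psi>"
  obtains R where "R > 0" "\<And>z. norm z > R \<Longrightarrow> \<psi> z = 0" "\<And>z h. norm z > R \<Longrightarrow> D \<psi> z h = 0"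
proof -
  obtain R where R: "R > 0" "\<And>z. \<psi> z \<noteq> 0 \<Longrightarrow> norm z \<le> R"
    using assms unfolding C1c_def bounded_pos by blast
  have "D \<psi> z h = 0" if "norm z > R" for z h
  proof -
    have "open {z::spacetime. norm z > R}" by (intro open_Collect_less continuous_intros)
    moreover have "((\<lambda>z. 0) has_derivative (\<lambda>h. 0)) (at z)" by simp
    ultimately have "(\<psi> has_derivative (\<lambda>h. 0)) (at z)"
      using has_derivative_transform_within_open[of "\<lambda>z. 0" "\<lambda>h. 0" z UNIV "{z. norm z > R}" \<psi>] that R(2) by force
    then have "D \<psi> z = (\<lambda>h. 0)" using frechet_derivative_at by metis
    then show ?thesis by simp
  qed
  then show thesis using that R by force
qed

lemma C1c_bounded:
  assumes "C1c \<psi>"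
  obtains K where "K > 0" "\<And>z h. \<bar>D \<psi> z h\<bar> \<le> K * norm h"
proof -
  obtain R where R: "\<And>z h. norm z > R \<Longrightarrow> D \<psi> z h = 0" using C1c_support[OF assms] by metis
  obtain K1 where K1: "K1 \<ge> 0" "\<And>z. norm (D \<psi> z E1) \<le> K1"
    by (rule continuous_bounded_support_bounded[OF C1cD(2)[OF assms, of E1], of R]) (use R in auto)
  obtain K2 where K2: "K2 \<ge> 0" "\<And>z. norm (D \<psi> z E2) \<le> K2"
    by (rule continuous_bounded_support_bounded[OF C1cD(2)[OF assms, of E2], of R]) (use R in auto)
  obtain K3 where K3: "K3 \<ge> 0" "\<And>z. norm (D \<psi> z E3) \<le> K3"
    by (rule continuous_bounded_support_bounded[OF C1cD(2)[OF assms, of E3], of R]) (use R in auto)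
  have "\<bar>D \<psi> z h\<bar> \<le> (K1 + K2 + K3 + 1) * norm h" for z h
  proof -
    have n: "\<bar>fst h $ 1\<bar> \<le> norm h" "\<bar>fst h $ 2\<bar> \<le> norm h" "\<bar>snd h\<bar> \<le> norm h"
    proof -
      have f: "norm (fst h) \<le> norm h" "norm (snd h) \<le> norm h"
        by (cases h; simp add: norm_Pair real_sqrt_sum_squares_ge1 real_sqrt_sum_squares_ge2)+
      show "\<bar>fst h $ 1\<bar> \<le> norm h" "\<bar>fst h $ 2\<bar> \<le> norm h" "\<bar>snd h\<bar> \<le> norm h"
        using order_trans[OF component_le_norm_cart f(1)] f(2) by (auto simp only: real_norm_def)
    qed
    have "\<bar>D \<psi> z h\<bar> \<le> \<bar>fst h $ 1\<bar> * \<bar>D \<psi> z E1\<bar> + \<bar>fst h $ 2\<bar> * \<bar>D \<psi> z E2\<bar> + \<bar>snd h\<bar> * \<bar>D \<psi> z E3\<bar>"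
      unfolding C1c_decomp[OF assms, of z h] abs_mult[symmetric] by linarith
    also have "\<dots> \<le> norm h * K1 + norm h * K2 + norm h * K3"
      by (intro add_mono mult_mono n) (use K1 K2 K3 in auto)
    also have "\<dots> \<le> (K1 + K2 + K3 + 1) * norm h" by (simp add: algebra_simps)
    finally show ?thesis .
  qed
  then show thesis using that[of "K1 + K2 + K3 + 1"] K1 K2 K3 by force
qed

lemma borel_measurable_D:
  assumes "C1c \<psi>" "m \<in> borel_measurable borel"
  shows "(\<lambda>z. D \<psi> z (m z)) \<in> borel_measurable borel"
proof -
  have "(\<lambda>z. D \<psi> z h) \<in> borel_measurable borel" for h
    using C1cD(2)[OF assms(1)] borel_measurable_continuous_onI by blast
  moreover have "(\<lambda>z. fst (m z) $ 1) \<in> borel_measurable borel" "(\<lambda>z. fst (m z) $ 2) \<in> borel_measurable borel"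
    "(\<lambda>z. snd (m z)) \<in> borel_measurable borel"
    by (rule measurable_compose[OF assms(2)], intro borel_measurable_continuous_onI continuous_intros)+
  ultimately have "(\<lambda>z. fst (m z) $ 1 * D \<psi> z E1 + fst (m z) $ 2 * D \<psi> z E2 + snd (m z) * D \<psi> z E3) \<in> borel_measurable borel"
    by (intro borel_measurable_add borel_measurable_times)
  then show ?thesis by (subst C1c_decomp[OF assms(1)])
qed

lemma integrable_D:
  assumes "C1c \<psi>" "m \<in> borel_measurable borel" "\<And>z. norm (m z) \<le> B"
  shows "integrable lborel (\<lambda>z. D \<psi> z (m z))"
proof -
  obtain R where R: "\<And>z h. norm z > R \<Longrightarrow> D \<psi> z h = 0" using C1c_support[OF assms(1)] by metis
  obtain K where K: "K > 0" "\<And>z h. \<bar>D \<psi> z h\<bar> \<le> K * norm h" using C1c_bounded[OF assms(1)] by metis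
  show ?thesis
  proof (rule integrable_bounded_support[where R = R and K = "K * B"])
    show "norm (D \<psi> z (m z)) \<le> K * B" for z
      using order_trans[OF K(2)[of z "m z"] mult_left_mono[OF assms(3)[of z], of K]] K(1) by simp
  qed (use R borel_measurable_D[OF assms(1,2)] in auto)
qed

text \<open>Integration by parts in one coordinate at a time. Each component is differentiated in
  its own direction only, which fits fields whose remaining partial derivatives would exceed the
  order of the cutoff.\<close>

lemma weakly_div_free_C1:
  fixes m1 m2 m3 g1 g2 g3 :: "spacetime \<Rightarrow> real"
  assumes m: "continuous_on UNIV m1" "continuous_on UNIV m2" "continuous_on UNIV m3"
    and g: "continuous_on UNIV g1" "continuous_on UNIV g2" "continuous_on UNIV g3"
    and d: "\<And>z. ((\<lambda>s. m1 (z + s *\<^sub>R E1)) has_real_derivative g1 z) (at 0)"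
      "\<And>z. ((\<lambda>s. m2 (z + s *\<^sub>R E2)) has_real_derivative g2 z) (at 0)"
      "\<And>z. ((\<lambda>s. m3 (z + s *\<^sub>R E3)) has_real_derivative g3 z) (at 0)"
    and div: "\<And>z. g1 z + g2 z + g3 z = 0"
  shows "weakly_div_free (\<lambda>z. (vector [m1 z, m2 z], m3 z))"
  unfolding weakly_div_free_def
proof (intro allI impI)
  fix \<psi> assume \<psi>: "C1c \<psi>"
  obtain R where R: "\<And>z. norm z > R \<Longrightarrow> \<psi> z = 0" "\<And>z h. norm z > R \<Longrightarrow> D \<psi> z h = 0"
    using C1c_support[OF \<psi>] by metis
  have part: "(LINT z|lborel. g z * \<psi> z + m z * D \<psi> z e) = 0 \<and> integrable lborel (\<lambda>z. g z * \<psi> z + m z * D \<psi> z e)"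
    if m: "continuous_on UNIV m" and g: "continuous_on UNIV g"
      and d: "\<And>z. ((\<lambda>s. m (z + s *\<^sub>R e)) has_real_derivative g z) (at 0)" for m g :: "spacetime \<Rightarrow> real" and e
  proof -
    have c: "continuous_on UNIV (\<lambda>z. g z * \<psi> z + m z * D \<psi> z e)"
      by (intro continuous_intros m g C1cD[OF \<psi>])
    have s: "g z * \<psi> z + m z * D \<psi> z e = 0" if "norm z > R" for z using R that by simp
    obtain K where K: "\<And>z. norm (g z * \<psi> z + m z * D \<psi> z e) \<le> K"
      using continuous_bounded_support_bounded[OF c s] by metis
    have "(LINT z|lborel. indicator UNIV z * (g z * \<psi> z + m z * D \<psi> z e)) = 0"
    proof (rule integral_directional_derivative_eq_0[where f = "\<lambda>z. m z * \<psi> z" and R = R and e = e])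
      show "continuous_on UNIV (\<lambda>z. m z * \<psi> z)" by (intro continuous_intros m C1cD[OF \<psi>])
      show "((\<lambda>s. m (z + s *\<^sub>R e) * \<psi> (z + s *\<^sub>R e)) has_real_derivative g z * \<psi> z + m z * D \<psi> z e) (at 0)" for z
        using DERIV_mult[OF d[of z] C1cD(5)[OF \<psi>, of z e]] by (simp add: algebra_simps)
      show "(\<lambda>z. g z * \<psi> z + m z * D \<psi> z e) \<in> borel_measurable borel"
        using c borel_measurable_continuous_onI by blast
    qed (use R K in auto)
    then show ?thesis using integrable_continuous_bounded_support[OF c s] by simp
  qed
  note p = part[OF m(1) g(1) d(1)] part[OF m(2) g(2) d(2)] part[OF m(3) g(3) d(3)]
  have "D \<psi> z (vector [m1 z, m2 z], m3 z) = (g1 z * \<psi> z + m1 z * D \<psi> z E1) + (g2 z * \<psi> z + m2 z * D \<psi> z E2)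
     + (g3 z * \<psi> z + m3 z * D \<psi> z E3)" for z
  proof -
    have "(g1 z + g2 z + g3 z) * \<psi> z = 0" by (simp add: div)
    then show ?thesis unfolding C1c_decomp[OF \<psi>, of z "(vector [m1 z, m2 z], m3 z)"]
      by (simp add: vector_2 algebra_simps)
  qed
  then show "(LINT z|lborel. D \<psi> z (vector [m1 z, m2 z], m3 z)) = 0" using p by simp
qed

text \<open>The linear system \<open>div V = 0\<close>, \<open>2 \<partial>\<^sub>t V + div (2 U) = 0\<close> says that three space-time vector fields
  are divergence free.\<close>

definition fld1 :: "complex \<Rightarrow> complex \<Rightarrow> spacetime" where
  "fld1 V Z = (vector [Re V, Im V], 0)"
definition fld2 :: "complex \<Rightarrow> complex \<Rightarrow> spacetime" where
  "fld2 V Z = (vector [Re Z, Im Z], 2 * Re V)"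
definition fld3 :: "complex \<Rightarrow> complex \<Rightarrow> spacetime" where
  "fld3 V Z = (vector [Im Z, - Re Z], 2 * Im V)"

definition lin_euler :: "(spacetime \<Rightarrow> complex) \<Rightarrow> (spacetime \<Rightarrow> complex) \<Rightarrow> bool" where
  "lin_euler V Z \<longleftrightarrow> weakly_div_free (\<lambda>z. fld1 (V z) (Z z)) \<and> weakly_div_free (\<lambda>z. fld2 (V z) (Z z)) \<and>
     weakly_div_free (\<lambda>z. fld3 (V z) (Z z))"

text \<open>Every real potential \<open>\<phi>\<close> yields the solution \<open>V = i D' \<Delta> \<phi>\<close>, \<open>Z = - 2 i D'\<^sup>2 \<partial>\<^sub>t \<phi>\<close>, where
  \<open>D' = \<partial>\<^sub>1 + i \<partial>\<^sub>2\<close>. Here \<open>\<phi> = n\<^sup>-\<^sup>3 Re (i A(x\<^sub>1) B(x\<^sub>2) C(t))\<close>, and \<open>G i j k\<close> is its derivative of order \<open>(i, j, k)\<close>;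
  a product structure makes the partial derivatives commute for free.\<close>

lemma lin_euler_potential:
  fixes A B C :: "nat \<Rightarrow> real \<Rightarrow> complex"
  assumes dA: "\<And>k t. k < 3 \<Longrightarrow> (A k has_vector_derivative of_real n * A (Suc k) t) (at t)"
    and dB: "\<And>k t. k < 3 \<Longrightarrow> (B k has_vector_derivative of_real n * B (Suc k) t) (at t)"
    and dC: "\<And>k t. k < 3 \<Longrightarrow> (C k has_vector_derivative of_real n * C (Suc k) t) (at t)"
    and cA: "\<And>k. k \<le> 3 \<Longrightarrow> continuous_on UNIV (A k)"
    and cB: "\<And>k. k \<le> 3 \<Longrightarrow> continuous_on UNIV (B k)"
    and cC: "\<And>k. k \<le> 3 \<Longrightarrow> continuous_on UNIV (C k)"
  defines "G \<equiv> \<lambda>i j k z. Re (\<i> * A i (fst z $ 1) * B j (fst z $ 2) * C k (snd z))"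
  defines "V \<equiv> \<lambda>z. Complex (- (G 2 1 0 z + G 0 3 0 z)) (G 3 0 0 z + G 1 2 0 z)"
  defines "Z \<equiv> \<lambda>z. Complex (4 * G 1 1 1 z) (- 2 * (G 2 0 1 z - G 0 2 1 z))"
  shows "lin_euler V Z"
    and "continuous_on UNIV V" "continuous_on UNIV Z"
proof -
  have cG: "continuous_on UNIV (G i j k)" if "i \<le> 3" "j \<le> 3" "k \<le> 3" for i j k
    unfolding G_def
    by (intro continuous_intros continuous_on_compose2[OF cA[OF that(1)]] continuous_on_compose2[OF cB[OF that(2)]]
        continuous_on_compose2[OF cC[OF that(3)]]) auto
  have shift: "((\<lambda>s. F (c + s)) has_vector_derivative F') (at 0)" if "(F has_vector_derivative F') (at c)"
    for F :: "real \<Rightarrow> complex" and F' c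
  proof -
    have "((\<lambda>s. c + s) has_vector_derivative 1) (at 0)" by (auto intro!: derivative_eq_intros)
    moreover have "(F has_vector_derivative F') (at (c + 0))" using that by simp
    ultimately have "(F \<circ> (\<lambda>s. c + s) has_vector_derivative 1 *\<^sub>R F') (at 0)" by (intro vector_diff_chain_at)
    then show ?thesis by (simp add: o_def)
  qed
  have reD: "((\<lambda>s. Re (F s)) has_real_derivative Re F') (at 0)" if "(F has_vector_derivative F') (at 0)"
    for F :: "real \<Rightarrow> complex" and F'
    using has_vector_derivative_real_field bounded_linear.has_vector_derivative[OF bounded_linear_Re that]
    by (simp add: has_real_derivative_iff_has_vector_derivative)
  have G1: "((\<lambda>s. G i j k (z + s *\<^sub>R E1)) has_real_derivative n * G (Suc i) j k z) (at 0)" if "i < 3" for i j k z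
  proof -
    have "((\<lambda>s. \<i> * A i (fst z $ 1 + s) * (B j (fst z $ 2) * C k (snd z))) has_vector_derivative
       \<i> * (of_real n * A (Suc i) (fst z $ 1)) * (B j (fst z $ 2) * C k (snd z))) (at 0)"
      by (intro has_vector_derivative_mult_left has_vector_derivative_mult_right shift dA that)
    from reD[OF this] show ?thesis unfolding G_def by (simp add: axis_def algebra_simps)
  qed
  have G2: "((\<lambda>s. G i j k (z + s *\<^sub>R E2)) has_real_derivative n * G i (Suc j) k z) (at 0)" if "j < 3" for i j k z
  proof -
    have "((\<lambda>s. \<i> * A i (fst z $ 1) * B j (fst z $ 2 + s) * C k (snd z)) has_vector_derivative
       \<i> * A i (fst z $ 1) * (of_real n * B (Suc j) (fst z $ 2)) * C k (snd z)) (at 0)"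
      by (intro has_vector_derivative_mult_left has_vector_derivative_mult_right shift dB that)
    from reD[OF this] show ?thesis unfolding G_def by (simp add: axis_def algebra_simps)
  qed
  have G3: "((\<lambda>s. G i j k (z + s *\<^sub>R E3)) has_real_derivative n * G i j (Suc k) z) (at 0)" if "k < 3" for i j k z
  proof -
    have "((\<lambda>s. \<i> * A i (fst z $ 1) * B j (fst z $ 2) * C k (snd z + s)) has_vector_derivative
       \<i> * A i (fst z $ 1) * B j (fst z $ 2) * (of_real n * C (Suc k) (snd z))) (at 0)"
      by (intro has_vector_derivative_mult_left has_vector_derivative_mult_right shift dC that)
    from reD[OF this] show ?thesis unfolding G_def by (simp add: algebra_simps)
  qed
  note S = numeral_2_eq_2 numeral_3_eq_3
  \<comment> \<open>Although the divergence is of fourth order in the potential, only mixed terms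
    such as \<open>G 3 1 0\<close> appear in it: the order in each single variable never exceeds
    three.\<close>
  have w1: "weakly_div_free (\<lambda>z. (vector [- (G 2 1 0 z + G 0 3 0 z), G 3 0 0 z + G 1 2 0 z], 0))"
  proof (rule weakly_div_free_C1[where ?g1.0 = "\<lambda>z. - (n * G 3 1 0 z + n * G 1 3 0 z)"
        and ?g2.0 = "\<lambda>z. n * G 3 1 0 z + n * G 1 3 0 z" and ?g3.0 = "\<lambda>z. 0"])
    show "((\<lambda>s. - (G 2 1 0 (z + s *\<^sub>R E1) + G 0 3 0 (z + s *\<^sub>R E1))) has_real_derivative
        - (n * G 3 1 0 z + n * G 1 3 0 z)) (at 0)" for z
      using DERIV_minus[OF DERIV_add[OF G1[of 2 1 0 z] G1[of 0 3 0 z]]] by (simp add: S)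
    show "((\<lambda>s. G 3 0 0 (z + s *\<^sub>R E2) + G 1 2 0 (z + s *\<^sub>R E2)) has_real_derivative
        n * G 3 1 0 z + n * G 1 3 0 z) (at 0)" for z
      using DERIV_add[OF G2[of 0 3 0 z] G2[of 2 1 0 z]] by (simp add: S)
  qed (auto intro!: continuous_intros cG)
  have w2: "weakly_div_free (\<lambda>z. (vector [4 * G 1 1 1 z, - 2 * (G 2 0 1 z - G 0 2 1 z)], 2 * (- (G 2 1 0 z + G 0 3 0 z))))"
  proof (rule weakly_div_free_C1[where ?g1.0 = "\<lambda>z. 4 * (n * G 2 1 1 z)"
        and ?g2.0 = "\<lambda>z. - 2 * (n * G 2 1 1 z - n * G 0 3 1 z)" and ?g3.0 = "\<lambda>z. 2 * - (n * G 2 1 1 z + n * G 0 3 1 z)"])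
    show "((\<lambda>s. 4 * G 1 1 1 (z + s *\<^sub>R E1)) has_real_derivative 4 * (n * G 2 1 1 z)) (at 0)" for z
      using DERIV_cmult[OF G1[of 1 1 1 z]] by (simp add: S)
    show "((\<lambda>s. - 2 * (G 2 0 1 (z + s *\<^sub>R E2) - G 0 2 1 (z + s *\<^sub>R E2))) has_real_derivative
        - 2 * (n * G 2 1 1 z - n * G 0 3 1 z)) (at 0)" for z
      using DERIV_cmult[OF DERIV_diff[OF G2[of 0 2 1 z] G2[of 2 0 1 z]], of "-2"] by (simp add: S)
    show "((\<lambda>s. 2 * - (G 2 1 0 (z + s *\<^sub>R E3) + G 0 3 0 (z + s *\<^sub>R E3))) has_real_derivative
        2 * - (n * G 2 1 1 z + n * G 0 3 1 z)) (at 0)" for z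
      using DERIV_cmult[OF DERIV_minus[OF DERIV_add[OF G3[of 0 2 1 z] G3[of 0 0 3 z]]], of 2] by (simp add: S)
  qed (auto intro!: continuous_intros cG)
  have w3: "weakly_div_free (\<lambda>z. (vector [- 2 * (G 2 0 1 z - G 0 2 1 z), - (4 * G 1 1 1 z)], 2 * (G 3 0 0 z + G 1 2 0 z)))"
  proof (rule weakly_div_free_C1[where ?g1.0 = "\<lambda>z. - 2 * (n * G 3 0 1 z - n * G 1 2 1 z)"
        and ?g2.0 = "\<lambda>z. - (4 * (n * G 1 2 1 z))" and ?g3.0 = "\<lambda>z. 2 * (n * G 3 0 1 z + n * G 1 2 1 z)"])
    show "((\<lambda>s. - (4 * G 1 1 1 (z + s *\<^sub>R E2))) has_real_derivative - (4 * (n * G 1 2 1 z))) (at 0)" for z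
      using DERIV_minus[OF DERIV_cmult[OF G2[of 1 1 1 z], of 4]] by (simp add: S)
    show "((\<lambda>s. - 2 * (G 2 0 1 (z + s *\<^sub>R E1) - G 0 2 1 (z + s *\<^sub>R E1))) has_real_derivative
        - 2 * (n * G 3 0 1 z - n * G 1 2 1 z)) (at 0)" for z
      using DERIV_cmult[OF DERIV_diff[OF G1[of 2 0 1 z] G1[of 0 2 1 z]], of "-2"] by (simp add: S)
    show "((\<lambda>s. 2 * (G 3 0 0 (z + s *\<^sub>R E3) + G 1 2 0 (z + s *\<^sub>R E3))) has_real_derivative
        2 * (n * G 3 0 1 z + n * G 1 2 1 z)) (at 0)" for z
      using DERIV_cmult[OF DERIV_add[OF G3[of 0 3 0 z] G3[of 0 1 2 z]], of 2] by (simp add: S)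
  qed (auto intro!: continuous_intros cG)
  show "lin_euler V Z"
    unfolding lin_euler_def fld1_def fld2_def fld3_def V_def Z_def using w1 w2 w3 by simp
  show "continuous_on UNIV V" "continuous_on UNIV Z"
    unfolding V_def Z_def Complex_eq by (auto intro!: continuous_intros cG)
qed

lemma inner_spacetime: "(x::spacetime) \<bullet> y = fst x $ 1 * fst y $ 1 + fst x $ 2 * fst y $ 2 + snd x * snd y"
  by (simp add: inner_prod_def inner_vec_def sum_2)

lemma in_ball_spacetime:
  fixes a z :: spacetime
  assumes "\<bar>fst z $ 1 - fst a $ 1\<bar> < \<rho> / 2" "\<bar>fst z $ 2 - fst a $ 2\<bar> < \<rho> / 2" "\<bar>snd z - snd a\<bar> < \<rho> / 2"
  shows "z \<in> ball a \<rho>"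
proof -
  have sq: "x * x \<le> \<rho> / 2 * (\<rho> / 2)" if "\<bar>x\<bar> < \<rho> / 2" for x
    using that abs_mult_less[of x "\<rho>/2" x "\<rho>/2"] by (simp add: abs_mult_self_eq abs_mult)
  have r: "\<rho> > 0" using assms(1) by linarith
  have "(norm (z - a))\<^sup>2 = (fst z $ 1 - fst a $ 1) * (fst z $ 1 - fst a $ 1) + (fst z $ 2 - fst a $ 2) * (fst z $ 2 - fst a $ 2) + (snd z - snd a) * (snd z - snd a)"
    by (simp add: power2_norm_eq_inner inner_spacetime)
  also have "\<dots> \<le> 3 * (\<rho> / 2 * (\<rho> / 2))" using sq[OF assms(1)] sq[OF assms(2)] sq[OF assms(3)] by linarith
  also have "\<dots> < \<rho>\<^sup>2" using r by (simp add: power2_eq_square)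
  finally have "norm (z - a) < \<rho>" using r by (simp add: power2_less_imp_less)
  then show ?thesis by (simp add: dist_norm norm_minus_commute)
qed

lemma norm_diff_triple_product:
  fixes a b c a' b' c' :: complex
  assumes "cmod b \<le> B" "cmod c \<le> B" "cmod a' \<le> B" "cmod b' \<le> B"
    and "cmod (a - a') \<le> d" "cmod (b - b') \<le> d" "cmod (c - c') \<le> d"
  shows "cmod (a * b * c - a' * b' * c') \<le> 3 * B\<^sup>2 * d"
proof -
  have B: "B \<ge> 0" using assms(1) norm_ge_zero order_trans by blast
  have d: "d \<ge> 0" using assms(5) norm_ge_zero order_trans by blast
  have "a * b * c - a' * b' * c' = (a - a') * b * c + a' * (b - b') * c + a' * b' * (c - c')"
    by (simp add: algebra_simps)
  also have "cmod \<dots> \<le> cmod (a - a') * cmod b * cmod c + cmod a' * cmod (b - b') * cmod c + cmod a' * cmod b' * cmod (c - c')"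
    by (intro order_trans[OF norm_triangle_ineq] add_mono) (auto simp: norm_mult)
  also have "\<dots> \<le> d * B * B + B * d * B + B * B * d"
    by (intro add_mono mult_mono) (use assms B d in auto)
  finally show ?thesis by (simp add: power2_eq_square algebra_simps)
qed

text \<open>The wave vector is \<open>\<xi> = (Im W, - Re W, r / 2)\<close>. Since
  \<open>Im W\<close> and \<open>Re W\<close> have squares summing to one, the symbols of the two
  potential operators at \<open>\<xi>\<close> are exactly \<open>W\<close> and
  \<open>\<i> * r * W\<^sup>2\<close>. The derivatives of the cutoff contribute the errors of size
  \<open>K / n\<close>.\<close>

lemma localized_wave:
  fixes a :: spacetime and W :: complex and r \<rho> :: real
  assumes W: "cmod W = 1" and \<rho>: "\<rho> > 0"
  obtains \<eta> :: "spacetime \<Rightarrow> real" and \<xi> :: spacetime and V Z :: "nat \<Rightarrow> spacetime \<Rightarrow> complex" and K :: real where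
    "continuous_on UNIV \<eta>" "\<And>z. 0 \<le> \<eta> z \<and> \<eta> z \<le> 1" "\<And>z. z \<notin> ball a \<rho> \<Longrightarrow> \<eta> z = 0"
    "\<And>z. z \<in> cbox (a - (\<rho> / 4) *\<^sub>R One) (a + (\<rho> / 4) *\<^sub>R One) \<Longrightarrow> \<eta> z \<ge> 1 / 64"
    "\<xi> \<noteq> 0"
    "\<And>n. n \<ge> 1 \<Longrightarrow> continuous_on UNIV (V n)" "\<And>n. n \<ge> 1 \<Longrightarrow> continuous_on UNIV (Z n)"
    "\<And>n z. n \<ge> 1 \<Longrightarrow> z \<notin> ball a \<rho> \<Longrightarrow> V n z = 0 \<and> Z n z = 0"
    "\<And>n. n \<ge> 1 \<Longrightarrow> lin_euler (V n) (Z n)"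
    "\<And>n z. n \<ge> 1 \<Longrightarrow> cmod (V n z - of_real (\<eta> z * cos (real n * (\<xi> \<bullet> z))) * W) \<le> K / real n"
    "\<And>n z. n \<ge> 1 \<Longrightarrow> cmod (Z n z - of_real (\<eta> z * cos (real n * (\<xi> \<bullet> z))) * (\<i> * of_real r * W\<^sup>2)) \<le> K / real n"
    "K \<ge> 0"
proof -
  \<comment> \<open>A cube of half-side \<open>\<rho> / 2\<close> lies in the ball because sqrt 3 /
    2 < 1. On the cube of half that size each of the three cutoffs is at least 1/4, hence the bound
    1/64.\<close>
  define h where "h = \<rho> / 2"
  have h: "h > 0" using \<rho> by (simp add: h_def)
  define p q \<tau> where "p = Im W" and "q = - Re W" and "\<tau> = r / 2"
  have pq: "p\<^sup>2 + q\<^sup>2 = 1" using W by (simp add: p_def q_def cmod_def real_sqrt_eq_1_iff)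
  have WE: "W = Complex (- q) p" by (simp add: p_def q_def complex_eq_iff)
  define a1 a2 a3 where "a1 = fst a $ 1" and "a2 = fst a $ 2" and "a3 = snd a"
  define A B C where "A n = osc (real n) p a1 h" and "B n = osc (real n) q a2 h" and "C n = osc (real n) \<tau> a3 h" for n :: nat
  define \<eta> where "\<eta> z = cutoff a1 h 0 (fst z $ 1) * cutoff a2 h 0 (fst z $ 2) * cutoff a3 h 0 (snd z)" for z :: spacetime
  define \<xi> :: spacetime where "\<xi> = (vector [p, q], \<tau>)"
  define G where "G n i j k z = Re (\<i> * A n i (fst z $ 1) * B n j (fst z $ 2) * C n k (snd z))" for n i j k and z :: spacetime
  define V where "V n z = Complex (- (G n 2 1 0 z + G n 0 3 0 z)) (G n 3 0 0 z + G n 1 2 0 z)" for n z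
  define Z where "Z n z = Complex (4 * G n 1 1 1 z) (- 2 * (G n 2 0 1 z - G n 0 2 1 z))" for n z
  have cut0: "0 \<le> cutoff b h 0 t" "cutoff b h 0 t \<le> 1" for b t by (simp_all add: cutoff_def bump_nonneg bump_le_1)
  have \<eta>1: "0 \<le> \<eta> z \<and> \<eta> z \<le> 1" for z
    unfolding \<eta>_def using cut0 by (intro conjI mult_nonneg_nonneg mult_le_one) auto
  have \<xi>z: "\<xi> \<bullet> z = p * fst z $ 1 + q * fst z $ 2 + \<tau> * snd z" for z
    by (simp add: \<xi>_def inner_spacetime vector_2)
  obtain K1 where K1: "K1 > 0" "\<And>n k t. n \<ge> 1 \<Longrightarrow> k \<le> 3 \<Longrightarrow>
       cmod (osc n p a1 h k t - (\<i> * of_real p) ^ k * of_real (cutoff a1 h 0 t) * cis (n * p * t)) \<le> K1 / n"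
    using osc_asymp[OF h] by metis
  obtain K2 where K2: "K2 > 0" "\<And>n k t. n \<ge> 1 \<Longrightarrow> k \<le> 3 \<Longrightarrow>
       cmod (osc n q a2 h k t - (\<i> * of_real q) ^ k * of_real (cutoff a2 h 0 t) * cis (n * q * t)) \<le> K2 / n"
    using osc_asymp[OF h] by metis
  obtain K3 where K3: "K3 > 0" "\<And>n k t. n \<ge> 1 \<Longrightarrow> k \<le> 3 \<Longrightarrow>
       cmod (osc n \<tau> a3 h k t - (\<i> * of_real \<tau>) ^ k * of_real (cutoff a3 h 0 t) * cis (n * \<tau> * t)) \<le> K3 / n"
    using osc_asymp[OF h] by metis
  define K0 where "K0 = K1 + K2 + K3"
  define M where "M = 2 + \<bar>\<tau>\<bar>"
  define Bd where "Bd = M ^ 3 + K0"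
  have M1: "M \<ge> 1" by (simp add: M_def)
  have pM: "\<bar>p\<bar> \<le> M" "\<bar>q\<bar> \<le> M" "\<bar>\<tau>\<bar> \<le> M"
  proof -
    have "\<bar>p\<bar> \<le> cmod W" "\<bar>q\<bar> \<le> cmod W" using abs_Im_le_cmod[of W] abs_Re_le_cmod[of W] by (auto simp: p_def q_def)
    then show "\<bar>p\<bar> \<le> M" "\<bar>q\<bar> \<le> M" "\<bar>\<tau>\<bar> \<le> M" using W by (auto simp: M_def)
  qed
  have lead_le: "cmod ((\<i> * of_real \<kappa>) ^ k * of_real (cutoff b h 0 t) * cis \<theta>) \<le> M ^ 3" if "\<bar>\<kappa>\<bar> \<le> M" "k \<le> 3" for \<kappa> b k t \<theta>
  proof -
    have "cmod ((\<i> * of_real \<kappa>) ^ k * of_real (cutoff b h 0 t) * cis \<theta>) = \<bar>\<kappa>\<bar> ^ k * cutoff b h 0 t"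
      using cut0[of b t] by (simp add: norm_mult norm_power)
    also have "\<dots> \<le> M ^ k * 1" using cut0[of b t] that M1 by (intro mult_mono power_mono) auto
    also have "\<dots> \<le> M ^ 3" using M1 that by (simp add: power_increasing)
    finally show ?thesis .
  qed
  define L where "L n i j k z = p ^ i * q ^ j * \<tau> ^ k * (\<eta> z * cos (real n * (\<xi> \<bullet> z)))" for n i j k and z :: spacetime
  define \<delta> where "\<delta> n = 3 * Bd\<^sup>2 * (K0 / real n)" for n
  have GL: "\<bar>G n i j k z - L n i j k z\<bar> \<le> \<delta> n" if n: "n \<ge> 1" and ijk: "i + j + k = 3" for n i j k z
  proof -
    let ?x = "fst z $ 1" and ?y = "fst z $ 2" and ?t = "snd z"
    define l1 where "l1 = (\<i> * of_real p) ^ i * of_real (cutoff a1 h 0 ?x) * cis (real n * p * ?x)"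
    define l2 where "l2 = (\<i> * of_real q) ^ j * of_real (cutoff a2 h 0 ?y) * cis (real n * q * ?y)"
    define l3 where "l3 = (\<i> * of_real \<tau>) ^ k * of_real (cutoff a3 h 0 ?t) * cis (real n * \<tau> * ?t)"
    have n': "real n \<ge> 1" using n by simp
    have le3: "i \<le> 3" "j \<le> 3" "k \<le> 3" using ijk by auto
    have K0n: "K1 / n \<le> K0 / n" "K2 / n \<le> K0 / n" "K3 / n \<le> K0 / n" "K0 / n \<le> K0"
    proof -
      show "K1 / n \<le> K0 / n" "K2 / n \<le> K0 / n" "K3 / n \<le> K0 / n"
        by (rule divide_right_mono; use K1(1) K2(1) K3(1) n' in \<open>simp add: K0_def\<close>)+
      show "K0 / n \<le> K0"
        using frac_le[of K0 K0 1 "real n"] K1(1) K2(1) K3(1) n' by (simp add: K0_def)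
    qed
    have d1: "cmod (A n i ?x - l1) \<le> K0 / n" using K1(2)[OF n' le3(1), of ?x] K0n unfolding A_def l1_def by linarith
    have d2: "cmod (B n j ?y - l2) \<le> K0 / n" using K2(2)[OF n' le3(2), of ?y] K0n unfolding B_def l2_def by linarith
    have d3: "cmod (C n k ?t - l3) \<le> K0 / n" using K3(2)[OF n' le3(3), of ?t] K0n unfolding C_def l3_def by linarith
    have K0p: "K0 \<ge> 0" using K1(1) K2(1) K3(1) by (simp add: K0_def)
    have ll: "cmod l1 \<le> M ^ 3" "cmod l2 \<le> M ^ 3" "cmod l3 \<le> M ^ 3"
      unfolding l1_def l2_def l3_def by (intro lead_le pM le3)+
    have tr: "cmod x \<le> Bd" if "cmod (x - l) \<le> K0 / n" "cmod l \<le> M ^ 3" for x l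
      using norm_triangle_ineq[of "x - l" l] that K0n by (simp add: Bd_def)
    have "cmod (A n i ?x * B n j ?y * C n k ?t - l1 * l2 * l3) \<le> 3 * Bd\<^sup>2 * (K0 / n)"
      by (rule norm_diff_triple_product[OF tr[OF d2 ll(2)] tr[OF d3 ll(3)] _ _ d1 d2 d3])
         (use ll K0p in \<open>auto simp: Bd_def\<close>)
    moreover have "G n i j k z - L n i j k z = Re (\<i> * (A n i ?x * B n j ?y * C n k ?t - l1 * l2 * l3))"
    proof -
      have "\<i> * (l1 * l2 * l3) = (\<i> * \<i> ^ (i + j + k)) * of_real (p ^ i * q ^ j * \<tau> ^ k * \<eta> z) *
         (cis (real n * p * ?x) * cis (real n * q * ?y) * cis (real n * \<tau> * ?t))"
        by (simp add: l1_def l2_def l3_def \<eta>_def power_mult_distrib power_add algebra_simps)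
      \<comment> \<open>The factor \<open>\<i>\<close> in the potential is there for this: three
        derivatives turn it into 1, and the real part of the leading term is a cosine with a real
        coefficient.\<close>
      also have "\<i> * \<i> ^ (i + j + k) = 1" unfolding ijk by (simp add: power3_eq_cube)
      also have "cis (real n * p * ?x) * cis (real n * q * ?y) * cis (real n * \<tau> * ?t) = cis (real n * (\<xi> \<bullet> z))"
        by (simp add: cis_mult \<xi>z algebra_simps)
      finally have "\<i> * (l1 * l2 * l3) = of_real (p ^ i * q ^ j * \<tau> ^ k * \<eta> z) * cis (real n * (\<xi> \<bullet> z))" by simp
      then have "Re (\<i> * (l1 * l2 * l3)) = L n i j k z" unfolding L_def by (simp del: of_real_mult of_real_power)
      then show ?thesis unfolding G_def right_diff_distrib minus_complex.simps by (simp only: mult.assoc)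
    qed
    ultimately show ?thesis unfolding \<delta>_def
      using abs_Re_le_cmod[of "\<i> * (A n i ?x * B n j ?y * C n k ?t - l1 * l2 * l3)"] by (simp only: norm_mult norm_ii mult_1)
  qed
  have cab: "cmod z \<le> \<bar>Re z\<bar> + \<bar>Im z\<bar>" for z by (rule cmod_le)
  show thesis
  proof (rule that[of \<eta> \<xi> V Z "8 * (3 * Bd\<^sup>2 * K0)"])
    show "continuous_on UNIV \<eta>"
      unfolding \<eta>_def[abs_def] by (intro continuous_intros continuous_on_compose2[OF cutoff_continuous]) auto
    show "0 \<le> \<eta> z \<and> \<eta> z \<le> 1" for z by (rule \<eta>1)
    have out: "h \<le> \<bar>fst z $ 1 - a1\<bar> \<or> h \<le> \<bar>fst z $ 2 - a2\<bar> \<or> h \<le> \<bar>snd z - a3\<bar>" if "z \<notin> ball a \<rho>" for z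
      using that in_ball_spacetime[of z a \<rho>] unfolding h_def a1_def a2_def a3_def by linarith
    show "\<eta> z = 0" if "z \<notin> ball a \<rho>" for z
      using out[OF that] cutoff_eq_0[OF h, of "fst z $ 1" a1 0] cutoff_eq_0[OF h, of "fst z $ 2" a2 0] cutoff_eq_0[OF h, of "snd z" a3 0]
      by (auto simp: \<eta>_def)
    show "\<eta> z \<ge> 1 / 64" if "z \<in> cbox (a - (\<rho> / 4) *\<^sub>R One) (a + (\<rho> / 4) *\<^sub>R One)" for z
    proof -
      have b: "E1 \<in> Basis" "E2 \<in> Basis" "E3 \<in> Basis" by (auto simp: Basis_prod_def axis_in_Basis_iff)
      have "\<bar>z \<bullet> e - a \<bullet> e\<bar> \<le> \<rho> / 4" if "e \<in> Basis" for e
      proof -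
        have "a \<bullet> e - \<rho> / 4 \<le> z \<bullet> e \<and> z \<bullet> e \<le> a \<bullet> e + \<rho> / 4"
          using \<open>z \<in> cbox _ _\<close> that by (auto simp: mem_box inner_diff_left inner_add_left dest!: bspec[of Basis _ e])
        then show ?thesis unfolding abs_le_iff by linarith
      qed
      from this[OF b(1)] this[OF b(2)] this[OF b(3)]
      have "\<bar>fst z $ 1 - a1\<bar> \<le> \<rho> / 4" "\<bar>fst z $ 2 - a2\<bar> \<le> \<rho> / 4" "\<bar>snd z - a3\<bar> \<le> \<rho> / 4"
        by (auto simp: inner_spacetime a1_def a2_def a3_def axis_def)
      moreover have "cutoff b h 0 t \<ge> 1 / 4" if "\<bar>t - b\<bar> \<le> \<rho> / 4" for t b
      proof -
        have "\<bar>(t - b) / h\<bar> \<le> 1 / 2" 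
        proof -
          have "\<bar>(t - b) / h\<bar> = \<bar>t - b\<bar> / h" using h by simp
          also have "\<dots> \<le> (\<rho> / 4) / h" using that h by (intro divide_right_mono) auto
          also have "\<dots> = 1 / 2" using h by (simp add: h_def)
          finally show ?thesis .
        qed
        then show ?thesis using bump_ge by (simp add: cutoff_def)
      qed
      ultimately have "(1/4) * (1/4) * (1/4) \<le> \<eta> z" unfolding \<eta>_def
        by (intro mult_mono) (auto simp: cut0)
      then show ?thesis by simp
    qed
    show "\<xi> \<noteq> 0"
    proof
      assume "\<xi> = 0"
      then have "\<xi> \<bullet> \<xi> = 0" by simp
      then have "p * p + q * q + \<tau> * \<tau> = 0" by (simp add: inner_spacetime \<xi>_def vector_2)
      then show False using pq by (smt (verit) power2_eq_square zero_le_square)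
    qed
    fix n :: nat assume n: "n \<ge> 1"
    have n0: "real n > 0" using n by simp
    have dA: "(A n k has_vector_derivative of_real n * A n (Suc k) t) (at t)" if "k < 3" for k t
      using osc_deriv[OF that h n0] by (simp add: A_def)
    have dB: "(B n k has_vector_derivative of_real n * B n (Suc k) t) (at t)" if "k < 3" for k t
      using osc_deriv[OF that h n0] by (simp add: B_def)
    have dC: "(C n k has_vector_derivative of_real n * C n (Suc k) t) (at t)" if "k < 3" for k t
      using osc_deriv[OF that h n0] by (simp add: C_def)
    have cA: "continuous_on UNIV (A n k)" "continuous_on UNIV (B n k)" "continuous_on UNIV (C n k)" for k
      by (simp_all add: A_def B_def C_def osc_continuous)
    have Ve: "V n = (\<lambda>z. Complex (- (G n 2 1 0 z + G n 0 3 0 z)) (G n 3 0 0 z + G n 1 2 0 z))" by (simp add: V_def fun_eq_iff)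
    have Ze: "Z n = (\<lambda>z. Complex (4 * G n 1 1 1 z) (- 2 * (G n 2 0 1 z - G n 0 2 1 z)))" by (simp add: Z_def fun_eq_iff)
    note pot = lin_euler_potential[where A = "A n" and B = "B n" and C = "C n" and n = "real n"]
    show "lin_euler (V n) (Z n)"
      unfolding Ve Ze G_def by (rule pot(1)) (use dA dB dC cA in blast)+
    show "continuous_on UNIV (V n)"
      unfolding Ve Ze G_def by (rule pot(2)) (use dA dB dC cA in blast)+
    show "continuous_on UNIV (Z n)"
      unfolding Ve Ze G_def by (rule pot(3)) (use dA dB dC cA in blast)+
    show "V n z = 0 \<and> Z n z = 0" if "z \<notin> ball a \<rho>" for z
    proof -
      have "G n i j k z = 0" for i j k
        using out[OF that] osc_eq_0[OF h, of "fst z $ 1" a1] osc_eq_0[OF h, of "fst z $ 2" a2] osc_eq_0[OF h, of "snd z" a3]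
        by (auto simp: G_def A_def B_def C_def)
      then show ?thesis by (simp add: V_def Z_def complex_eq_iff)
    qed
    fix z
    let ?c = "\<eta> z * cos (real n * (\<xi> \<bullet> z))"
    note gl = GL[OF n, of _ _ _ z]
    \<comment> \<open>A component of \<open>V\<close> carries at most two errors
      \<open>\<delta> n\<close> and a component of \<open>Z\<close> four. \<open>cmod_le\<close>
      adds two components, so 8 covers both fields.\<close>
    have K: "8 * (3 * Bd\<^sup>2 * K0) / real n = 8 * \<delta> n" by (simp add: \<delta>_def)
    show "cmod (V n z - of_real ?c * W) \<le> 8 * (3 * Bd\<^sup>2 * K0) / real n"
    proof -
      have e: "L n 2 1 0 z + L n 0 3 0 z = ?c * q" "L n 3 0 0 z + L n 1 2 0 z = ?c * p"
      proof -
        have "L n 2 1 0 z + L n 0 3 0 z = ?c * q * (p\<^sup>2 + q\<^sup>2)" "L n 3 0 0 z + L n 1 2 0 z = ?c * p * (p\<^sup>2 + q\<^sup>2)"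
          by (simp_all add: L_def algebra_simps power2_eq_square power3_eq_cube)
        then show "L n 2 1 0 z + L n 0 3 0 z = ?c * q" "L n 3 0 0 z + L n 1 2 0 z = ?c * p" using pq by simp_all
      qed
      have "\<bar>Re (V n z - of_real ?c * W)\<bar> \<le> 2 * \<delta> n"
        using gl[of 2 1 0] gl[of 0 3 0] e(1) unfolding V_def WE
        by (simp del: of_real_mult)
      moreover have "\<bar>Im (V n z - of_real ?c * W)\<bar> \<le> 2 * \<delta> n"
        using gl[of 3 0 0] gl[of 1 2 0] e(2) unfolding V_def WE
        by (simp del: of_real_mult)
      ultimately show ?thesis unfolding K using cab[of "V n z - of_real ?c * W"] by linarith
    qed
    show "cmod (Z n z - of_real ?c * (\<i> * of_real r * W\<^sup>2)) \<le> 8 * (3 * Bd\<^sup>2 * K0) / real n"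
    proof -
      have e: "Re (of_real ?c * (\<i> * of_real r * W\<^sup>2)) = 4 * L n 1 1 1 z"
        "Im (of_real ?c * (\<i> * of_real r * W\<^sup>2)) = - 2 * (L n 2 0 1 z - L n 0 2 1 z)"
        unfolding WE by (simp_all add: L_def \<tau>_def power2_eq_square algebra_simps)
      have "\<bar>Re (Z n z - of_real ?c * (\<i> * of_real r * W\<^sup>2))\<bar> \<le> 4 * \<delta> n"
        unfolding minus_complex.simps e using gl[of 1 1 1] unfolding Z_def by simp
      moreover have "\<bar>Im (Z n z - of_real ?c * (\<i> * of_real r * W\<^sup>2))\<bar> \<le> 4 * \<delta> n"
        unfolding minus_complex.simps e using gl[of 2 0 1] gl[of 0 2 1] unfolding Z_def by simp
      ultimately show ?thesis unfolding K using cab[of "Z n z - of_real ?c * (\<i> * of_real r * W\<^sup>2)"] by linarith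
    qed
  next
    show "0 \<le> 8 * (3 * Bd\<^sup>2 * K0)" using K1(1) K2(1) K3(1) by (simp add: K0_def)
  qed
qed

lemma content_ball_le_cbox:
  fixes a :: "'a::euclidean_space"
  assumes "\<rho> > 0"
  shows "measure lborel (ball a \<rho>) \<le> 4 ^ DIM('a) * measure lborel (cbox (a - (\<rho> / 4) *\<^sub>R One) (a + (\<rho> / 4) *\<^sub>R One))"
proof -
  have c: "measure lborel (cbox (a - c *\<^sub>R One) (a + c *\<^sub>R One)) = (2 * c) ^ DIM('a)" if "c > 0" for c
    using that by (subst content_cbox) (auto simp: inner_diff_left inner_add_left)
  have "measure lborel (ball a \<rho>) \<le> measure lborel (cbox (a - \<rho> *\<^sub>R One) (a + \<rho> *\<^sub>R One))"
  proof (rule measure_mono_fmeasurable)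
    show "ball a \<rho> \<subseteq> cbox (a - \<rho> *\<^sub>R One) (a + \<rho> *\<^sub>R One)"
    proof
      fix x assume x: "x \<in> ball a \<rho>"
      have "a \<bullet> b - \<rho> \<le> x \<bullet> b \<and> x \<bullet> b \<le> a \<bullet> b + \<rho>" if "b \<in> Basis" for b
      proof -
        have "\<bar>(x - a) \<bullet> b\<bar> \<le> norm (x - a)" by (rule Basis_le_norm[OF that])
        also have "\<dots> \<le> \<rho>" using x by (simp add: dist_norm norm_minus_commute)
        finally show ?thesis unfolding abs_le_iff inner_diff_left by linarith
      qed
      then show "x \<in> cbox (a - \<rho> *\<^sub>R One) (a + \<rho> *\<^sub>R One)"
        by (simp add: mem_box inner_diff_left inner_add_left)
    qed
    show "ball a \<rho> \<in> sets lborel" by simp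
    show "cbox (a - \<rho> *\<^sub>R One) (a + \<rho> *\<^sub>R One) \<in> fmeasurable lborel"
      by (rule fmeasurable_cbox)
  qed
  also have "\<dots> = (4 * (2 * (\<rho> / 4))) ^ DIM('a)" by (simp only: c[OF assms]) simp
  also have "\<dots> = 4 ^ DIM('a) * (2 * (\<rho> / 4)) ^ DIM('a)" by (rule power_mult_distrib)
  also have "(2 * (\<rho> / 4)) ^ DIM('a) = measure lborel (cbox (a - (\<rho> / 4) *\<^sub>R One) (a + (\<rho> / 4) *\<^sub>R One))"
    by (rule c[symmetric]) (use assms in simp)
  finally show ?thesis .
qed

text \<open>Any constant below \<open>1/2 \<cdot> (1/64)\<^sup>2 \<cdot> 4\<^sup>-\<^sup>3\<close>: the mean of \<open>cos\<^sup>2\<close>, the lower bound for the squared cutoff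
  on a cube, and the volume of that cube relative to the ball.\<close>

definition wave_gain :: real where "wave_gain = 1 / 10 ^ 6"

text \<open>One localized wave at a sufficiently high frequency. The Riemann-Lebesgue lemma makes it
  nearly orthogonal to the finitely many fields in \<open>G\<close>, while the mean value 1/2 of the
  squared cosine keeps its squared norm proportional to the volume of the ball.\<close>

lemma perturbation:
  fixes a :: spacetime and W :: complex and r \<rho> \<epsilon> :: real and G :: "(spacetime \<Rightarrow> complex) set"
  assumes W: "cmod W = 1" and \<rho>: "\<rho> > 0" and \<epsilon>: "\<epsilon> > 0"
    and G: "finite G" "\<And>g. g \<in> G \<Longrightarrow> continuous_on UNIV g"
  obtains V Z :: "spacetime \<Rightarrow> complex" where
    "continuous_on UNIV V" "continuous_on UNIV Z" "\<And>z. z \<notin> ball a \<rho> \<Longrightarrow> V z = 0 \<and> Z z = 0" "lin_euler V Z"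
    "\<And>z. \<exists>\<sigma>. \<bar>\<sigma>\<bar> \<le> 1 \<and> cmod (V z - of_real \<sigma> * W) \<le> \<epsilon> \<and> cmod (Z z - of_real \<sigma> * (\<i> * of_real r * W\<^sup>2)) \<le> \<epsilon>"
    "\<And>g. g \<in> G \<Longrightarrow> \<bar>LINT z|lborel. V z \<bullet> g z\<bar> \<le> \<epsilon>"
    "(LINT z|lborel. (cmod (V z))\<^sup>2) \<ge> wave_gain * measure lborel (ball a \<rho>)"
proof -
  obtain \<eta> :: "spacetime \<Rightarrow> real" and \<xi> :: spacetime and V Z :: "nat \<Rightarrow> spacetime \<Rightarrow> complex" and K :: real where
    \<eta>: "continuous_on UNIV \<eta>" "\<And>z. 0 \<le> \<eta> z \<and> \<eta> z \<le> 1" "\<And>z. z \<notin> ball a \<rho> \<Longrightarrow> \<eta> z = 0"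
    "\<And>z. z \<in> cbox (a - (\<rho> / 4) *\<^sub>R One) (a + (\<rho> / 4) *\<^sub>R One) \<Longrightarrow> \<eta> z \<ge> 1 / 64"
    and \<xi>: "\<xi> \<noteq> 0"
    and cV: "\<And>n. n \<ge> 1 \<Longrightarrow> continuous_on UNIV (V n)" and cZ: "\<And>n. n \<ge> 1 \<Longrightarrow> continuous_on UNIV (Z n)"
    and V0: "\<And>n z. n \<ge> 1 \<Longrightarrow> z \<notin> ball a \<rho> \<Longrightarrow> V n z = 0 \<and> Z n z = 0"
    and lin: "\<And>n. n \<ge> 1 \<Longrightarrow> lin_euler (V n) (Z n)"
    and eV: "\<And>n z. n \<ge> 1 \<Longrightarrow> cmod (V n z - of_real (\<eta> z * cos (real n * (\<xi> \<bullet> z))) * W) \<le> K / real n"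
    and eZ: "\<And>n z. n \<ge> 1 \<Longrightarrow> cmod (Z n z - of_real (\<eta> z * cos (real n * (\<xi> \<bullet> z))) * (\<i> * of_real r * W\<^sup>2)) \<le> K / real n"
    and K: "K \<ge> 0"
    by (rule localized_wave[OF W \<rho>, of a r]) (rule that; assumption)
  define R where "R = norm a + \<rho>"
  have out: "z \<notin> ball a \<rho>" if "norm z > R" for z
    using that norm_triangle_ineq4[of a "a - z"] unfolding R_def by (simp add: dist_norm)
  have \<eta>R: "\<eta> z = 0" if "norm z > R" for z using \<eta>(3) out that by blast
  define err where "err n z = V n z - of_real (\<eta> z * cos (real n * (\<xi> \<bullet> z))) * W" for n z
  have cerr: "continuous_on UNIV (err n)" if "n \<ge> 1" for n
    unfolding err_def[abs_def] by (intro continuous_intros cV[OF that] \<eta>(1))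
  have err0: "err n z = 0" if "n \<ge> 1" "z \<notin> ball a \<rho>" for n z using V0[OF that] \<eta>(3)[OF that(2)] by (simp add: err_def)
  have err_le: "cmod (err n z) \<le> K / real n" if "n \<ge> 1" for n z using eV[OF that] by (simp add: err_def)
  have Kn: "(\<lambda>n. K / real n) \<longlonglongrightarrow> 0" by (rule lim_const_over_n)
  have ev1: "\<forall>\<^sub>F n in sequentially. n \<ge> (1::nat)" by (rule eventually_ge_at_top)
  have evK: "\<forall>\<^sub>F n in sequentially. K / real n < \<epsilon>" using Kn \<epsilon> by (rule order_tendstoD)
  let ?v = "measure lborel (ball a \<rho>)"
  have evg: "\<forall>\<^sub>F n in sequentially. \<bar>LINT z|lborel. V n z \<bullet> g z\<bar> < \<epsilon>" if g: "g \<in> G" for g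
  proof -
    have cg: "continuous_on UNIV g" using G g by blast
    have cWg: "continuous_on UNIV (\<lambda>z. \<eta> z * (W \<bullet> g z))" by (intro continuous_intros \<eta> cg)
    have RL: "(\<lambda>n. LINT z|lborel. \<eta> z * (W \<bullet> g z) * cos (real n * (\<xi> \<bullet> z))) \<longlonglongrightarrow> 0"
      by (rule Riemann_Lebesgue_continuous[OF cWg _ \<xi>, of R]) (simp add: \<eta>R)
    define I where "I = (LINT z|lborel. indicator (cball a \<rho>) z * norm (g z))"
    have Ii: "integrable lborel (\<lambda>z. indicator (cball a \<rho>) z * norm (g z))"
      using borel_integrable_compact[of "cball a \<rho>" "\<lambda>z. norm (g z)"] continuous_on_subset[OF cg]
      by (auto intro!: continuous_intros)
    have bound: "\<bar>LINT z|lborel. V n z \<bullet> g z\<bar> \<le> \<bar>LINT z|lborel. \<eta> z * (W \<bullet> g z) * cos (real n * (\<xi> \<bullet> z))\<bar> + K / real n * I"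
      if n: "n \<ge> 1" for n
    proof -
      have i1: "integrable lborel (\<lambda>z. \<eta> z * (W \<bullet> g z) * cos (real n * (\<xi> \<bullet> z)))"
        by (rule integrable_continuous_bounded_support[of _ R]) (auto intro!: continuous_intros cWg simp: \<eta>R)
      have i2: "integrable lborel (\<lambda>z. err n z \<bullet> g z)"
        by (rule integrable_continuous_bounded_support[of _ R])
           (auto intro!: continuous_intros cerr n cg simp: err0[OF n out])
      have "(LINT z|lborel. V n z \<bullet> g z) = (LINT z|lborel. \<eta> z * (W \<bullet> g z) * cos (real n * (\<xi> \<bullet> z)) + err n z \<bullet> g z)"
      proof (rule Bochner_Integration.integral_cong)
        fix z
        have "V n z = (\<eta> z * cos (real n * (\<xi> \<bullet> z))) *\<^sub>R W + err n z" by (simp add: err_def scaleR_conv_of_real)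
        then show "V n z \<bullet> g z = \<eta> z * (W \<bullet> g z) * cos (real n * (\<xi> \<bullet> z)) + err n z \<bullet> g z"
          by (simp add: inner_add_left)
      qed simp
      also have "\<dots> = (LINT z|lborel. \<eta> z * (W \<bullet> g z) * cos (real n * (\<xi> \<bullet> z))) + (LINT z|lborel. err n z \<bullet> g z)"
        using i1 i2 by simp
      finally have e: "(LINT z|lborel. V n z \<bullet> g z) = \<dots>" .
      have "\<bar>LINT z|lborel. err n z \<bullet> g z\<bar> \<le> (LINT z|lborel. K / real n * (indicator (cball a \<rho>) z * norm (g z)))"
      proof (rule order_trans[OF integral_abs_bound integral_mono])
        show "integrable lborel (\<lambda>z. \<bar>err n z \<bullet> g z\<bar>)" using i2 by simp
        show "integrable lborel (\<lambda>z. K / real n * (indicator (cball a \<rho>) z * norm (g z)))" using Ii by simp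
        show "\<bar>err n z \<bullet> g z\<bar> \<le> K / real n * (indicator (cball a \<rho>) z * norm (g z))" for z
        proof (cases "z \<in> ball a \<rho>")
          case True
          then have "z \<in> cball a \<rho>" by simp
          then show ?thesis
            using order_trans[OF Cauchy_Schwarz_ineq2[of "err n z" "g z"] mult_right_mono[OF err_le[OF n, of z], of "norm (g z)"]] by simp
        next
          case False
          then show ?thesis using err0[OF n False] K by simp
        qed
      qed
      also have "\<dots> = K / real n * I" by (simp add: I_def)
      finally show ?thesis unfolding e by linarith
    qed
    have "(\<lambda>n. \<bar>LINT z|lborel. \<eta> z * (W \<bullet> g z) * cos (real n * (\<xi> \<bullet> z))\<bar> + K / real n * I) \<longlonglongrightarrow> 0 + 0 * I"
      by (intro tendsto_add tendsto_mult tendsto_const Kn tendsto_rabs_zero RL)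
    then have "\<forall>\<^sub>F n in sequentially. \<bar>LINT z|lborel. \<eta> z * (W \<bullet> g z) * cos (real n * (\<xi> \<bullet> z))\<bar> + K / real n * I < \<epsilon>"
      using \<epsilon> by (intro order_tendstoD(2)) auto
    then show ?thesis using ev1 by eventually_elim (use bound in \<open>meson order_le_less_trans\<close>)
  qed
  have evG: "\<forall>\<^sub>F n in sequentially. \<forall>g\<in>G. \<bar>LINT z|lborel. V n z \<bullet> g z\<bar> < \<epsilon>"
    using G(1) evg by (rule eventually_ball_finite[OF _ ballI])
  have evE: "\<forall>\<^sub>F n in sequentially. wave_gain * ?v < (LINT z|lborel. (cmod (V n z))\<^sup>2)"
  proof -
    define J where "J = (LINT z|lborel. (\<eta> z)\<^sup>2)"
    have i\<eta>: "integrable lborel (\<lambda>z. (\<eta> z)\<^sup>2)"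
      by (rule integrable_continuous_bounded_support[of _ R]) (auto intro!: continuous_intros \<eta> simp: \<eta>R)
    have RL: "(\<lambda>n. LINT z|lborel. (\<eta> z)\<^sup>2 * cos (real n * ((2 *\<^sub>R \<xi>) \<bullet> z))) \<longlonglongrightarrow> 0"
      by (rule Riemann_Lebesgue_continuous[of _ R]) (auto intro!: continuous_intros \<eta> simp: \<eta>R \<xi>)
    have bound: "J / 2 + (LINT z|lborel. (\<eta> z)\<^sup>2 * cos (real n * ((2 *\<^sub>R \<xi>) \<bullet> z))) / 2 - K / real n * (2 * ?v)
        \<le> (LINT z|lborel. (cmod (V n z))\<^sup>2)" if n: "n \<ge> 1" for n
    proof -
      have i1: "integrable lborel (\<lambda>z. (\<eta> z)\<^sup>2 * cos (real n * ((2 *\<^sub>R \<xi>) \<bullet> z)))"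
        by (rule integrable_continuous_bounded_support[of _ R]) (auto intro!: continuous_intros \<eta> simp: \<eta>R)
      have i2: "integrable lborel (\<lambda>z::spacetime. indicator (ball a \<rho>) z :: real)"
        by (intro integrable_real_indicator) (auto simp: emeasure_lborel_ball_finite[unfolded infinity_ennreal_def])
      have i3: "integrable lborel (\<lambda>z. (cmod (V n z))\<^sup>2)"
        by (rule integrable_continuous_bounded_support[of _ R]) (auto intro!: continuous_intros cV n simp: V0[OF n out])
      have "(LINT z|lborel. ((\<eta> z)\<^sup>2 / 2 + (\<eta> z)\<^sup>2 * cos (real n * ((2 *\<^sub>R \<xi>) \<bullet> z)) / 2) - K / real n * (2 * indicator (ball a \<rho>) z))
         \<le> (LINT z|lborel. (cmod (V n z))\<^sup>2)"
      proof (rule integral_mono)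
        fix z
        let ?c = "\<eta> z * cos (real n * (\<xi> \<bullet> z))"
        have c1: "\<bar>?c\<bar> \<le> 1" using \<eta>(2)[of z] by (simp add: abs_mult mult_le_one)
        \<comment> \<open>Half-angle form of the squared cosine: the constant part yields
          \<open>J / 2\<close>, and the part of doubled frequency vanishes in the limit by
          \<open>RL\<close>.\<close>
        have cd: "cos (real n * ((2 *\<^sub>R \<xi>) \<bullet> z)) = 2 * (cos (real n * (\<xi> \<bullet> z)))\<^sup>2 - 1"
          using cos_double_cos[of "real n * (\<xi> \<bullet> z)"] by (simp add: algebra_simps)
        have sq: "(\<eta> z)\<^sup>2 / 2 + (\<eta> z)\<^sup>2 * cos (real n * ((2 *\<^sub>R \<xi>) \<bullet> z)) / 2 = ?c\<^sup>2"
          unfolding cd by (simp add: power_mult_distrib field_simps)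
        show "(\<eta> z)\<^sup>2 / 2 + (\<eta> z)\<^sup>2 * cos (real n * ((2 *\<^sub>R \<xi>) \<bullet> z)) / 2 - K / real n * (2 * indicator (ball a \<rho>) z) \<le> (cmod (V n z))\<^sup>2"
        proof (cases "z \<in> ball a \<rho>")
          case True
          have "cmod (of_real ?c * W) \<le> cmod (V n z) + cmod (err n z)"
            using norm_triangle_ineq4[of "V n z" "err n z"] by (simp add: err_def)
          then have le: "\<bar>?c\<bar> - K / real n \<le> cmod (V n z)" using err_le[OF n, of z] by (simp only: norm_mult norm_of_real W mult_1_right)
          have Kn0: "K / real n \<ge> 0" using K by simp
          have "?c\<^sup>2 - 2 * (K / real n) \<le> (cmod (V n z))\<^sup>2"
          proof (cases "\<bar>?c\<bar> \<ge> K / real n")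
            case True
            have "(\<bar>?c\<bar> - K / real n)\<^sup>2 \<le> (cmod (V n z))\<^sup>2" using le True by (intro power_mono) auto
            moreover have "(\<bar>?c\<bar> - K / real n)\<^sup>2 = ?c\<^sup>2 - 2 * (\<bar>?c\<bar> * (K / real n)) + (K / real n)\<^sup>2"
              by (simp add: power2_diff)
            moreover have "\<bar>?c\<bar> * (K / real n) \<le> 1 * (K / real n)" using c1 Kn0 by (intro mult_right_mono)
            ultimately show ?thesis using zero_le_power2[of "K / real n"] by linarith
          next
            case False
            have "?c\<^sup>2 = \<bar>?c\<bar> * \<bar>?c\<bar>" by (simp add: power2_eq_square)
            also have "\<dots> \<le> 1 * (K / real n)" using False c1 by (intro mult_mono) auto
            finally show ?thesis using Kn0 zero_le_power2[of "cmod (V n z)"] by linarith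
          qed
          then show ?thesis unfolding sq using True by (simp add: mult.commute)
        next
          case False
          then show ?thesis unfolding sq using \<eta>(3) by simp
        qed
      qed (use i1 i2 i3 i\<eta> in auto)
      also have "(LINT z|lborel. ((\<eta> z)\<^sup>2 / 2 + (\<eta> z)\<^sup>2 * cos (real n * ((2 *\<^sub>R \<xi>) \<bullet> z)) / 2) - K / real n * (2 * indicator (ball a \<rho>) z))
         = J / 2 + (LINT z|lborel. (\<eta> z)\<^sup>2 * cos (real n * ((2 *\<^sub>R \<xi>) \<bullet> z))) / 2 - K / real n * (2 * ?v)"
        using i1 i2 i\<eta> by (simp add: J_def)
      finally show ?thesis .
    qed
    have lim: "(\<lambda>n. J / 2 + (LINT z|lborel. (\<eta> z)\<^sup>2 * cos (real n * ((2 *\<^sub>R \<xi>) \<bullet> z))) / 2 - K / real n * (2 * ?v)) \<longlonglongrightarrow> J / 2 + 0 / 2 - 0 * (2 * ?v)"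
      by (intro tendsto_intros RL Kn) auto
    have Jge: "J \<ge> ?v / 64 / 64\<^sup>2"
    proof -
      let ?B = "cbox (a - (\<rho> / 4) *\<^sub>R One) (a + (\<rho> / 4) *\<^sub>R One)"
      have iB: "integrable lborel (\<lambda>z::spacetime. indicator ?B z * (1 / 64\<^sup>2 :: real))"
        by (intro integrable_mult_left integrable_real_indicator) (auto simp: emeasure_lborel_cbox_finite[unfolded infinity_ennreal_def])
      have "(LINT z|lborel. indicator ?B z * (1 / 64\<^sup>2 :: real)) \<le> J"
        unfolding J_def
      proof (rule integral_mono[OF iB i\<eta>])
        fix z
        show "indicator ?B z * (1 / 64\<^sup>2) \<le> (\<eta> z)\<^sup>2"
        proof (cases "z \<in> ?B")
          case True
          then have "(1 / 64)\<^sup>2 \<le> (\<eta> z)\<^sup>2" using \<eta>(4)[OF True] by (intro power_mono) auto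
          then show ?thesis using True by (simp add: power_divide)
        qed simp
      qed
      also have "(LINT z|lborel. indicator ?B z * (1 / 64\<^sup>2 :: real)) = measure lborel ?B / 64\<^sup>2" by simp
      finally have "measure lborel ?B / 64\<^sup>2 \<le> J" .
      moreover have "DIM(spacetime) = 3" by simp
      then have "?v / 64 \<le> measure lborel ?B" using content_ball_le_cbox[OF \<rho>, of a] by simp
      ultimately show ?thesis by simp
    qed
    have v: "?v > 0" by (rule content_ball_pos[OF \<rho>])
    have "wave_gain * ?v < J / 2 + 0 / 2 - 0 * (2 * ?v)" using Jge v by (simp add: wave_gain_def del: content_ball_gt_0_iff)
    from order_tendstoD(1)[OF lim this] ev1 show ?thesis
      by eventually_elim (use bound in \<open>meson order_less_le_trans\<close>)
  qed
  obtain n where n: "n \<ge> 1" "K / real n < \<epsilon>" "\<forall>g\<in>G. \<bar>LINT z|lborel. V n z \<bullet> g z\<bar> < \<epsilon>"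
    "wave_gain * ?v < (LINT z|lborel. (cmod (V n z))\<^sup>2)"
    using eventually_happens[OF eventually_conj[OF ev1 eventually_conj[OF evK eventually_conj[OF evG evE]]]] by auto
  show thesis
  proof (rule that[of "V n" "Z n"])
    fix z
    have "\<bar>\<eta> z * cos (real n * (\<xi> \<bullet> z))\<bar> \<le> 1" using \<eta>(2)[of z] by (simp add: abs_mult mult_le_one)
    then show "\<exists>\<sigma>. \<bar>\<sigma>\<bar> \<le> 1 \<and> cmod (V n z - of_real \<sigma> * W) \<le> \<epsilon> \<and> cmod (Z n z - of_real \<sigma> * (\<i> * of_real r * W\<^sup>2)) \<le> \<epsilon>"
      using eV[OF n(1), of z] eZ[OF n(1), of z] n(2) by (meson less_imp_le order_trans)
  qed (use n cV cZ V0 lin in \<open>auto simp: less_imp_le\<close>)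
qed

section \<open>Convex integration\<close>

text \<open>Vitali's theorem covers almost all of \<open>S\<close> by countably many disjoint small
  balls. As \<open>S\<close> has finite measure, finitely many of them already miss less than
  \<open>\<theta>\<close>.\<close>

lemma disjoint_balls_exhaust:
  fixes S :: "'a::euclidean_space set"
  assumes S: "open S" "bounded S" and \<delta>: "\<delta> > 0" and \<theta>: "\<theta> > 0"
  obtains F :: "('a \<times> real) set" where "finite F"
    "\<And>a \<rho>. (a, \<rho>) \<in> F \<Longrightarrow> 0 < \<rho> \<and> \<rho> < \<delta> \<and> ball a \<rho> \<subseteq> S"
    "\<And>i j. i \<in> F \<Longrightarrow> j \<in> F \<Longrightarrow> i \<noteq> j \<Longrightarrow> ball (fst i) (snd i) \<inter> ball (fst j) (snd j) = {}"
    "measure lborel (S - (\<Union>i\<in>F. ball (fst i) (snd i))) < \<theta>"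
proof -
  define I where "I = {(a, \<rho>). 0 < \<rho> \<and> \<rho> < \<delta> \<and> ball a \<rho> \<subseteq> S}"
  have cov: "\<exists>i. i \<in> I \<and> x \<in> ball (fst i) (snd i) \<and> snd i < d" if "x \<in> S" "d > 0" for x d
  proof -
    obtain e where e: "e > 0" "ball x e \<subseteq> S" using S(1) \<open>x \<in> S\<close> openE by blast
    define \<rho> where "\<rho> = min e (min \<delta> d) / 2"
    have "0 < \<rho>" "\<rho> < \<delta>" "\<rho> < d" "\<rho> \<le> e" using e \<delta> \<open>d > 0\<close> by (auto simp: \<rho>_def)
    moreover have "ball x \<rho> \<subseteq> S" using e(2) subset_ball[OF \<open>\<rho> \<le> e\<close>, of x] by blast
    ultimately show ?thesis by (intro exI[of _ "(x, \<rho>)"]) (auto simp: I_def)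
  qed
  obtain C where C: "countable C" "C \<subseteq> I"
    "pairwise (\<lambda>i j. disjnt (ball (fst i) (snd i)) (ball (fst j) (snd j))) C"
    "negligible (S - (\<Union>i\<in>C. ball (fst i) (snd i)))"
    by (rule Vitali_covering_theorem_balls[of S I fst snd, OF cov]) (assumption | rule that)+
  let ?b = "\<lambda>i::'a \<times> real. ball (fst i) (snd i)"
  have Sb: "S \<in> lmeasurable" using S by (simp add: bounded_set_imp_lmeasurable lmeasurable_open)
  have sub: "?b i \<subseteq> S" if "i \<in> C" for i
  proof -
    have "i \<in> I" using C(2) that by blast
    then show ?thesis unfolding I_def by (cases i) simp
  qed
  obtain D' where D': "D' \<subseteq> ?b ` C" "finite D'" "measure lebesgue (\<Union> (?b ` C)) - \<theta> < measure lebesgue (\<Union> D')"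
  proof (rule measure_countable_Union_approachable[of "?b ` C" \<theta> "measure lebesgue S"])
    show "measure lebesgue (\<Union> D') \<le> measure lebesgue S" if "D' \<subseteq> ?b ` C" "finite D'" for D'
    proof (intro measure_mono_fmeasurable Sb)
      have *: "\<exists>i\<in>C. X = ?b i" if "X \<in> D'" for X using that \<open>D' \<subseteq> ?b ` C\<close> by blast
      show "\<Union> D' \<subseteq> S"
      proof (rule Union_least)
        fix X assume "X \<in> D'"
        then obtain i where "i \<in> C" "X = ?b i" using * by blast
        then show "X \<subseteq> S" using sub by simp
      qed
      have "open (\<Union> D')"
      proof (rule open_Union, rule ballI)
        fix X assume "X \<in> D'"
        then obtain i where "X = ?b i" using * by blast
        then show "open X" by simp
      qed
      then show "\<Union> D' \<in> sets lebesgue" by simp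
    qed
  qed (use C \<theta> in auto)
  obtain F where F: "F \<subseteq> C" "finite F" "D' = ?b ` F" using finite_subset_image[OF D'(2,1)] by blast
  have FI: "F \<subseteq> I" using F C by blast
  show thesis
  proof (rule that[of F])
    show "finite F" by fact
    show "0 < \<rho> \<and> \<rho> < \<delta> \<and> ball a \<rho> \<subseteq> S" if "(a, \<rho>) \<in> F" for a \<rho> using that FI by (auto simp: I_def)
    show "?b i \<inter> ?b j = {}" if "i \<in> F" "j \<in> F" "i \<noteq> j" for i j
      using C(3) F(1) that unfolding pairwise_def disjnt_def by blast
    let ?U = "\<Union> (?b ` C)" and ?UF = "\<Union> (?b ` F)"
    have US: "?U \<subseteq> S" by (rule UN_least) (rule sub)
    have mU: "?U \<in> lmeasurable" using US S by (intro lmeasurable_open bounded_subset[OF S(2)]) auto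
    have mUF: "?UF \<in> lmeasurable" using US F(1) S by (intro lmeasurable_open bounded_subset[OF S(2)]) auto
    have "measure lebesgue S = measure lebesgue (?U \<union> (S - ?U))" using US by (simp add: Un_absorb1)
    also have "\<dots> = measure lebesgue ?U"
      using C(4) by (intro measure_Un_null_set) (use mU in \<open>auto simp: negligible_iff_null_sets\<close>)
    finally have "measure lebesgue S - measure lebesgue ?UF < \<theta>" using D'(3) F(3) by simp
    moreover have "measure lebesgue (S - ?UF) = measure lebesgue S - measure lebesgue ?UF"
      using US F(1) by (intro measurable_measure_Diff Sb) (use mUF in auto)
    moreover have "measure lebesgue (S - ?UF) = measure lborel (S - ?UF)"
      by (intro measure_completion sets.Diff) (use S(1) in \<open>auto intro!: borel_open open_UN\<close>)
    ultimately show "measure lborel (S - ?UF) < \<theta>" by simp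
  qed
qed

text \<open>The square of \<open>V\<close> changes by at most
  \<open>\<eta> * (2 * sqrt C + 1)\<close>. This enters twice, through \<open>|V|^2\<close> and
  through \<open>V\<^sup>2 - Z\<close>, and the change of \<open>Z\<close> adds one more
  \<open>\<eta>\<close>.\<close>

lemma subsol_energy_perturb:
  assumes "subsol_energy V' Z' \<le> C" and "cmod (V - V') \<le> \<eta>" "cmod (Z - Z') \<le> \<eta>" "\<eta> \<le> 1"
  shows "subsol_energy V Z \<le> subsol_energy V' Z' + \<eta> * (4 * sqrt C + 3)"
proof -
  have C: "C \<ge> 0" using assms(1) by (smt (verit) norm_ge_zero subsol_energy_def zero_le_power2)
  have "(cmod V')\<^sup>2 \<le> C" using assms(1) norm_ge_zero[of "V'\<^sup>2 - Z'"] by (simp add: subsol_energy_def del: norm_ge_zero)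
  then have V': "cmod V' \<le> sqrt C" by (rule real_le_rsqrt)
  have \<eta>: "\<eta> \<ge> 0" using assms(2) norm_ge_zero order_trans by blast
  have V: "cmod V \<le> sqrt C + 1" using norm_triangle_ineq[of "V - V'" V'] V' assms by simp
  have s: "cmod (V + V') \<le> 2 * sqrt C + 1" using norm_triangle_ineq[of V V'] V V' by simp
  have p: "cmod (V\<^sup>2 - V'\<^sup>2) \<le> \<eta> * (2 * sqrt C + 1)"
  proof -
    have "V\<^sup>2 - V'\<^sup>2 = (V - V') * (V + V')" by (simp add: power2_eq_square algebra_simps)
    then show ?thesis using mult_mono[OF assms(2) s \<eta>] by (simp add: norm_mult)
  qed
  have q: "(cmod V)\<^sup>2 \<le> (cmod V')\<^sup>2 + \<eta> * (2 * sqrt C + 1)"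
    using p norm_triangle_ineq[of "V\<^sup>2 - V'\<^sup>2" "V'\<^sup>2"] by (simp add: norm_power)
  have "cmod (V\<^sup>2 - Z) \<le> cmod (V'\<^sup>2 - Z') + cmod (V\<^sup>2 - V'\<^sup>2) + cmod (Z - Z')"
  proof -
    have "V\<^sup>2 - Z = (V'\<^sup>2 - Z') + (V\<^sup>2 - V'\<^sup>2) - (Z - Z')" by simp
    then show ?thesis by (metis norm_triangle_ineq norm_triangle_ineq4 add_right_mono order_trans)
  qed
  then have "subsol_energy V Z \<le> subsol_energy V' Z' + \<eta> * (2 * sqrt C + 1) + \<eta> * (2 * sqrt C + 1) + \<eta>"
    using p q assms(3) unfolding subsol_energy_def by linarith
  also have "\<dots> = subsol_energy V' Z' + \<eta> * (4 * sqrt C + 3)" by (simp add: algebra_simps)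
  finally show ?thesis .
qed

section \<open>Linear structure of the system and a single step of the iteration\<close>

lemma continuous_on_fld:
  assumes "continuous_on S V" "continuous_on S Z"
  shows "continuous_on S (\<lambda>z. fld1 (V z) (Z z))" "continuous_on S (\<lambda>z. fld2 (V z) (Z z))"
    "continuous_on S (\<lambda>z. fld3 (V z) (Z z))"
proof -
  have v: "continuous_on S (\<lambda>z. vector [f z, g z] :: real^2)" if "continuous_on S f" "continuous_on S g" for f g :: "'a \<Rightarrow> real"
  proof -
    have "(\<lambda>z. vector [f z, g z] :: real^2) = (\<lambda>z. f z *\<^sub>R axis 1 1 + g z *\<^sub>R axis 2 1)"
      by (auto simp: fun_eq_iff vec_eq_iff forall_2 vector_2 axis_def)
    then show ?thesis using that by (simp only:) (intro continuous_intros)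
  qed
  show "continuous_on S (\<lambda>z. fld1 (V z) (Z z))" "continuous_on S (\<lambda>z. fld2 (V z) (Z z))"
    "continuous_on S (\<lambda>z. fld3 (V z) (Z z))"
    unfolding fld1_def fld2_def fld3_def using assms by (intro continuous_intros v; simp)+
qed

lemma fld_lin:
  "fld1 (V + V') (Z + Z') = fld1 V Z + fld1 V' Z'" "fld2 (V + V') (Z + Z') = fld2 V Z + fld2 V' Z'"
  "fld3 (V + V') (Z + Z') = fld3 V Z + fld3 V' Z'"
  "fld1 (of_real c * V) (of_real c * Z) = c *\<^sub>R fld1 V Z" "fld2 (of_real c * V) (of_real c * Z) = c *\<^sub>R fld2 V Z"
  "fld3 (of_real c * V) (of_real c * Z) = c *\<^sub>R fld3 V Z"
  by (auto simp: fld1_def fld2_def fld3_def vec_eq_iff forall_2 vector_2)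

lemma norm_fld_le:
  "norm (fld1 V Z) \<le> 2 * (cmod V + cmod Z)" "norm (fld2 V Z) \<le> 2 * (cmod V + cmod Z)"
  "norm (fld3 V Z) \<le> 2 * (cmod V + cmod Z)"
proof -
  have *: "norm (vector [Re a, Im a] :: real^2, t) \<le> cmod a + \<bar>t\<bar>" for a t
  proof -
    have "norm (vector [Re a, Im a] :: real^2) = cmod a"
      by (simp add: norm_vec_def L2_set_def sum_2 vector_2 cmod_def)
    then show ?thesis using norm_Pair_le[of "vector [Re a, Im a] :: real^2" t] by simp
  qed
  have 3: "fld3 V Z = (vector [Re (- \<i> * Z), Im (- \<i> * Z)], 2 * Im V)" by (simp add: fld3_def)
  show "norm (fld1 V Z) \<le> 2 * (cmod V + cmod Z)"
    unfolding fld1_def by (rule order_trans[OF *]) (use norm_ge_zero[of V] norm_ge_zero[of Z] in \<open>simp del: norm_ge_zero\<close>)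
  show "norm (fld2 V Z) \<le> 2 * (cmod V + cmod Z)"
    unfolding fld2_def by (rule order_trans[OF *])
      (use norm_ge_zero[of Z] abs_Re_le_cmod[of V] in \<open>simp add: abs_mult del: norm_ge_zero\<close>)
  show "norm (fld3 V Z) \<le> 2 * (cmod V + cmod Z)"
    unfolding 3 by (rule order_trans[OF *])
      (use norm_ge_zero[of Z] abs_Im_le_cmod[of V] in \<open>simp add: abs_mult norm_mult del: norm_ge_zero\<close>)
qed

definition bounded_borel :: "(spacetime \<Rightarrow> complex) \<Rightarrow> bool" where
  "bounded_borel f \<longleftrightarrow> f \<in> borel_measurable borel \<and> (\<exists>K. \<forall>z. cmod (f z) \<le> K)"

lemma borel_measurable_fld:
  assumes "V \<in> borel_measurable borel" "Z \<in> borel_measurable borel"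
  shows "(\<lambda>z. fld1 (V z) (Z z)) \<in> borel_measurable borel" "(\<lambda>z. fld2 (V z) (Z z)) \<in> borel_measurable borel"
    "(\<lambda>z. fld3 (V z) (Z z)) \<in> borel_measurable borel"
proof -
  have VZ: "(\<lambda>z. (V z, Z z)) \<in> borel_measurable borel" using assms by (rule borel_measurable_Pair)
  have c: "continuous_on UNIV (\<lambda>p::complex \<times> complex. fld1 (fst p) (snd p))"
    "continuous_on UNIV (\<lambda>p::complex \<times> complex. fld2 (fst p) (snd p))"
    "continuous_on UNIV (\<lambda>p::complex \<times> complex. fld3 (fst p) (snd p))"
    by (intro continuous_on_fld continuous_intros)+
  show "(\<lambda>z. fld1 (V z) (Z z)) \<in> borel_measurable borel" "(\<lambda>z. fld2 (V z) (Z z)) \<in> borel_measurable borel"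
    "(\<lambda>z. fld3 (V z) (Z z)) \<in> borel_measurable borel"
    using borel_measurable_continuous_on[OF c(1) VZ] borel_measurable_continuous_on[OF c(2) VZ]
      borel_measurable_continuous_on[OF c(3) VZ] by simp_all
qed

lemma weakly_div_free_add:
  assumes "weakly_div_free m" "weakly_div_free m'"
    and "m \<in> borel_measurable borel" "\<And>z. norm (m z) \<le> B" "m' \<in> borel_measurable borel" "\<And>z. norm (m' z) \<le> B'"
  shows "weakly_div_free (\<lambda>z. m z + m' z)"
  unfolding weakly_div_free_def
proof (intro allI impI)
  fix \<psi> assume \<psi>: "C1c \<psi>"
  show "(LINT z|lborel. D \<psi> z (m z + m' z)) = 0"
    using assms \<psi> integrable_D[OF \<psi> assms(3,4)] integrable_D[OF \<psi> assms(5,6)]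
    by (simp add: linear_add[OF C1cD(3)[OF \<psi>]] weakly_div_free_def)
qed

lemma weakly_div_free_scaleR:
  assumes "weakly_div_free m"
  shows "weakly_div_free (\<lambda>z. c *\<^sub>R m z)"
  using assms by (simp add: weakly_div_free_def linear_scale[OF C1cD(3)])

lemma lin_euler_add:
  assumes "lin_euler V Z" "lin_euler V' Z'" "bounded_borel V" "bounded_borel Z" "bounded_borel V'" "bounded_borel Z'"
  shows "lin_euler (\<lambda>z. V z + V' z) (\<lambda>z. Z z + Z' z)"
proof -
  obtain K1 K2 K3 K4 where K: "\<And>z. cmod (V z) \<le> K1" "\<And>z. cmod (Z z) \<le> K2" "\<And>z. cmod (V' z) \<le> K3" "\<And>z. cmod (Z' z) \<le> K4"
    using assms unfolding bounded_borel_def by blast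
  have b: "2 * (cmod (V z) + cmod (Z z)) \<le> 2 * (K1 + K2)" "2 * (cmod (V' z) + cmod (Z' z)) \<le> 2 * (K3 + K4)" for z
    using K(1)[of z] K(2)[of z] K(3)[of z] K(4)[of z] by auto
  note n = order_trans[OF norm_fld_le(1) b(1)] order_trans[OF norm_fld_le(1) b(2)]
    order_trans[OF norm_fld_le(2) b(1)] order_trans[OF norm_fld_le(2) b(2)]
    order_trans[OF norm_fld_le(3) b(1)] order_trans[OF norm_fld_le(3) b(2)]
  have m: "V \<in> borel_measurable borel" "Z \<in> borel_measurable borel" "V' \<in> borel_measurable borel" "Z' \<in> borel_measurable borel"
    using assms by (auto simp: bounded_borel_def)
  show ?thesis unfolding lin_euler_def fld_lin
    using assms(1,2) unfolding lin_euler_def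
    by (intro conjI weakly_div_free_add[OF _ _ borel_measurable_fld(1)[OF m(1,2)] n(1) borel_measurable_fld(1)[OF m(3,4)] n(2)]
        weakly_div_free_add[OF _ _ borel_measurable_fld(2)[OF m(1,2)] n(3) borel_measurable_fld(2)[OF m(3,4)] n(4)]
        weakly_div_free_add[OF _ _ borel_measurable_fld(3)[OF m(1,2)] n(5) borel_measurable_fld(3)[OF m(3,4)] n(6)]) auto
qed

lemma lin_euler_cmult:
  assumes "lin_euler V Z"
  shows "lin_euler (\<lambda>z. of_real c * V z) (\<lambda>z. of_real c * Z z)"
  using assms weakly_div_free_scaleR unfolding lin_euler_def fld_lin by blast

lemma lin_euler_0: "lin_euler (\<lambda>z. 0) (\<lambda>z. 0)"
proof -
  have "fld1 0 0 = 0" "fld2 0 0 = 0" "fld3 0 0 = 0"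
    by (auto simp: fld1_def fld2_def fld3_def vec_eq_iff forall_2 vector_2 zero_prod_def)
  then show ?thesis by (simp add: lin_euler_def weakly_div_free_def linear_0[OF C1cD(3)])
qed

lemma bounded_borel_continuous:
  assumes "continuous_on UNIV f" "\<And>z. norm z > R \<Longrightarrow> f z = 0"
  shows "bounded_borel f"
  using continuous_bounded_support_bounded[OF assms] borel_measurable_continuous_onI[OF assms(1)]
  unfolding bounded_borel_def by metis

lemma lin_euler_sum:
  assumes "finite I" "\<And>i. i \<in> I \<Longrightarrow> lin_euler (V i) (Z i)" "\<And>i. i \<in> I \<Longrightarrow> bounded_borel (V i)" "\<And>i. i \<in> I \<Longrightarrow> bounded_borel (Z i)"
  shows "lin_euler (\<lambda>z. \<Sum>i\<in>I. V i z) (\<lambda>z. \<Sum>i\<in>I. Z i z) \<and> bounded_borel (\<lambda>z. \<Sum>i\<in>I. V i z) \<and> bounded_borel (\<lambda>z. \<Sum>i\<in>I. Z i z)"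
  using assms
proof (induction I rule: finite_induct)
  case empty
  then show ?case using lin_euler_0 by (auto simp: bounded_borel_def)
next
  case (insert i I)
  have add: "bounded_borel (\<lambda>z. f z + g z)" if "bounded_borel f" "bounded_borel g" for f g
    using that unfolding bounded_borel_def using borel_measurable_add[of f borel g] by (meson norm_triangle_mono)
  show ?case using insert by (auto intro!: lin_euler_add add)
qed

text \<open>Continuity together with the strict inequality yields a uniform gap on the compact
  closure of \<open>S\<close>; each step spends part of this gap and leaves a new subsolution of the
  same kind.\<close>

definition subsolution :: "spacetime set \<Rightarrow> real \<Rightarrow> complex \<Rightarrow> complex \<Rightarrow> (spacetime \<Rightarrow> complex) \<Rightarrow> (spacetime \<Rightarrow> complex) \<Rightarrow> bool" where
  "subsolution S C V0 Z0 V Z \<longleftrightarrow> continuous_on UNIV V \<and> continuous_on UNIV Z \<and> (\<forall>z. z \<notin> S \<longrightarrow> V z = V0 \<and> Z z = Z0) \<and>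
     lin_euler (\<lambda>z. V z - V0) (\<lambda>z. Z z - Z0) \<and> (\<forall>z. subsol_energy (V z) (Z z) < C)"

text \<open>On small balls \<open>V\<close> and \<open>Z\<close> are almost constant, so a wave
  along the segment of \<open>subsol_energy_segment\<close> at the centre can be added there. Its
  amplitude is \<open>L / (8 * sqrt C)\<close> with \<open>L = C - |V|^2\<close>, and the gain on a
  ball is \<open>wave_gain * L\<^sup>2 / (64 * C)\<close> times its volume. Summed over the balls
  this is a Riemann sum for the integral in the last conclusion.\<close>

lemma subsolution_step:
  fixes G :: "(spacetime \<Rightarrow> complex) set"
  assumes S: "open S" "bounded S" and sub: "subsolution S C V0 Z0 V Z"
    and G: "finite G" "\<And>g. g \<in> G \<Longrightarrow> continuous_on UNIV g" and \<epsilon>: "\<epsilon> > 0"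
  obtains V' Z' where "subsolution S C V0 Z0 V' Z'"
    "\<And>g. g \<in> G \<Longrightarrow> \<bar>LINT z|lborel. (V' z - V z) \<bullet> g z\<bar> \<le> \<epsilon>"
    "(LINT z|lborel. (cmod (V' z - V z))\<^sup>2) \<ge>
       wave_gain / (64 * C) * (LINT z|lborel. indicator S z * (C - (cmod (V z))\<^sup>2)\<^sup>2) - \<epsilon>"
proof -
  note subD = sub[unfolded subsolution_def]
  have cV: "continuous_on UNIV V" and cZ: "continuous_on UNIV Z" using subD by auto
  have e: "subsol_energy (V z) (Z z) < C" for z using subD by blast
  have V2: "(cmod (V z))\<^sup>2 < C" for z
    using e[of z] norm_ge_zero[of "(V z)\<^sup>2 - Z z"] unfolding subsol_energy_def by linarith
  have C: "C > 0" using order_le_less_trans[OF zero_le_power2 V2] .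
  define L where "L z = C - (cmod (V z))\<^sup>2" for z
  have L: "0 < L z" "L z \<le> C" for z using V2[of z] by (auto simp: L_def)
  have L2C: "(L z)\<^sup>2 \<le> C\<^sup>2" for z using L[of z] by (intro power_mono) auto
  have cL: "continuous_on UNIV L" unfolding L_def[abs_def] by (intro continuous_intros cV)
  define K where "K = closure S"
  have K: "compact K" using S by (simp add: K_def)
  have SK: "S \<subseteq> K" by (simp add: K_def closure_subset)
  obtain \<mu> where \<mu>: "\<mu> > 0" "\<And>z. z \<in> K \<Longrightarrow> subsol_energy (V z) (Z z) \<le> C - \<mu>"
  proof (cases "K = {}")
    case True
    then show ?thesis using that[of 1] by simp
  next
    case False
    have "continuous_on K (\<lambda>z. subsol_energy (V z) (Z z))"
      unfolding subsol_energy_def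
      by (intro continuous_intros continuous_on_subset[OF cV] continuous_on_subset[OF cZ]) auto
    then obtain x where "x \<in> K" "\<forall>z\<in>K. subsol_energy (V z) (Z z) \<le> subsol_energy (V x) (Z x)"
      using continuous_attains_sup[OF K False] by blast
    then show ?thesis using that[of "C - subsol_energy (V x) (Z x)"] e[of x] by simp
  qed
  \<comment> \<open>The segment leaves a gap \<open>\<mu> / 2\<close>. A deviation
    \<open>\<eta>\<close> from it, half from the variation of the old field on the ball and half
    from the error of the wave, costs at most \<open>\<mu> / 4\<close>.\<close>
  define \<eta> where "\<eta> = min 1 (\<mu> / (4 * (4 * sqrt C + 3)))"
  have sC: "4 * sqrt C + 3 > 0" using C by (simp add: add_pos_pos)
  have \<eta>: "\<eta> > 0" "\<eta> \<le> 1" "\<eta> * (4 * sqrt C + 3) \<le> \<mu> / 4"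
  proof -
    show "\<eta> > 0" "\<eta> \<le> 1" using \<mu> sC by (auto simp: \<eta>_def)
    have "\<eta> \<le> \<mu> / (4 * (4 * sqrt C + 3))" by (simp add: \<eta>_def)
    then have "\<eta> * (4 * sqrt C + 3) \<le> \<mu> / (4 * (4 * sqrt C + 3)) * (4 * sqrt C + 3)"
      using sC by (intro mult_right_mono) auto
    also have "\<dots> = \<mu> / 4" using sC by (simp add: field_simps)
    finally show "\<eta> * (4 * sqrt C + 3) \<le> \<mu> / 4" .
  qed
  define c1 where "c1 = wave_gain / (64 * C)"
  have c1: "c1 > 0" using C by (simp add: c1_def wave_gain_def)
  define m where "m = measure lborel S"
  have m: "m \<ge> 0" by (simp add: m_def)
  \<comment> \<open>Two errors separate the integral from its Riemann sum: the oscillation of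
    \<open>L\<^sup>2\<close> on the balls, at most \<open>\<theta> * m\<close>, and the uncovered
    rest of \<open>S\<close>, at most \<open>C\<^sup>2 * \<theta>\<close>. The summand 1 keeps the
    denominator positive.\<close>
  define \<theta> where "\<theta> = \<epsilon> / (c1 * (m + C\<^sup>2 + 1))"
  have \<theta>: "\<theta> > 0" "c1 * (\<theta> * m + C\<^sup>2 * \<theta>) \<le> \<epsilon>"
  proof -
    have p: "m + C\<^sup>2 + 1 > 0" using m by (simp add: add_nonneg_pos)
    show "\<theta> > 0" using \<epsilon> c1 p by (simp add: \<theta>_def)
    have "c1 * (\<theta> * m + C\<^sup>2 * \<theta>) = c1 * \<theta> * (m + C\<^sup>2)" by (simp add: algebra_simps)
    also have "\<dots> \<le> c1 * \<theta> * (m + C\<^sup>2 + 1)" using c1 \<open>\<theta> > 0\<close> by (intro mult_left_mono) auto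
    also have "\<dots> = \<epsilon>" using c1 p by (simp add: \<theta>_def)
    finally show "c1 * (\<theta> * m + C\<^sup>2 * \<theta>) \<le> \<epsilon>" .
  qed
  have ucp: "\<exists>d>0. \<forall>x\<in>K. \<forall>y\<in>K. dist y x < d \<longrightarrow> dist (f y) (f x) < b" if "continuous_on UNIV f" "b > 0"
    for f :: "spacetime \<Rightarrow> 'b::metric_space" and b
  proof -
    have "uniformly_continuous_on K f"
      by (rule compact_uniformly_continuous[OF continuous_on_subset[OF that(1)] K]) simp
    then show ?thesis using that(2) unfolding uniformly_continuous_on_def by blast
  qed
  obtain d1 where d1: "d1 > 0" "\<And>x y. x \<in> K \<Longrightarrow> y \<in> K \<Longrightarrow> dist y x < d1 \<Longrightarrow> dist (V y) (V x) < \<eta> / 2"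
    using ucp[OF cV, of "\<eta> / 2"] \<eta> by (metis half_gt_zero)
  obtain d2 where d2: "d2 > 0" "\<And>x y. x \<in> K \<Longrightarrow> y \<in> K \<Longrightarrow> dist y x < d2 \<Longrightarrow> dist (Z y) (Z x) < \<eta> / 2"
    using ucp[OF cZ, of "\<eta> / 2"] \<eta> by (metis half_gt_zero)
  have cL2: "continuous_on UNIV (\<lambda>z. (L z)\<^sup>2)" by (intro continuous_intros cL)
  obtain d3 where d3: "d3 > 0" "\<And>x y. x \<in> K \<Longrightarrow> y \<in> K \<Longrightarrow> dist y x < d3 \<Longrightarrow> dist ((L y)\<^sup>2) ((L x)\<^sup>2) < \<theta>"
    using ucp[OF cL2 \<theta>(1)] by metis
  define \<delta> where "\<delta> = min d1 (min d2 d3)"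
  have \<delta>: "\<delta> > 0" "\<delta> \<le> d1" "\<delta> \<le> d2" "\<delta> \<le> d3" using d1 d2 d3 by (auto simp: \<delta>_def)
  obtain F :: "(spacetime \<times> real) set" where F: "finite F"
    "\<And>a \<rho>. (a, \<rho>) \<in> F \<Longrightarrow> 0 < \<rho> \<and> \<rho> < \<delta> \<and> ball a \<rho> \<subseteq> S"
    "\<And>i j. i \<in> F \<Longrightarrow> j \<in> F \<Longrightarrow> i \<noteq> j \<Longrightarrow> ball (fst i) (snd i) \<inter> ball (fst j) (snd j) = {}"
    "measure lborel (S - (\<Union>i\<in>F. ball (fst i) (snd i))) < \<theta>"
    using disjoint_balls_exhaust[OF S \<delta>(1) \<theta>(1)] by blast
  define s where "s i = L (fst i) / (8 * sqrt C)" for i :: "spacetime \<times> real"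
  have s: "s i \<ge> 0" "(s i)\<^sup>2 = (L (fst i))\<^sup>2 / (64 * C)" for i
    using L(1)[of "fst i"] C by (auto simp: s_def power_divide power_mult_distrib)
  \<comment> \<open>Every ball may contribute \<open>\<epsilon> / k\<close> to the inner product
    with a field in \<open>G\<close>; adding 1 covers an empty \<open>F\<close> as well.\<close>
  define k where "k = real (card F) + 1"
  have k: "k \<ge> 1" by (simp add: k_def)
  \<comment> \<open>All properties of the unscaled wave \<open>(v, w)\<close> on ball
    \<open>i\<close>, with the error bounds already multiplied by its amplitude \<open>s i\<close>,
    so that a single choice over \<open>F\<close> delivers them together.\<close>
  define Q where "Q i v w r u \<longleftrightarrow> cmod u = 1 \<and>
      (\<forall>t. \<bar>t\<bar> \<le> s i \<longrightarrow> subsol_energy (V (fst i) + of_real t * u) (Z (fst i) + of_real t * (\<i> * of_real r * u\<^sup>2)) \<le> C - \<mu> / 2) \<and>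
      continuous_on UNIV v \<and> continuous_on UNIV w \<and> (\<forall>z. z \<notin> ball (fst i) (snd i) \<longrightarrow> v z = 0 \<and> w z = 0) \<and> lin_euler v w \<and>
      (\<forall>z. \<exists>\<sigma>. \<bar>\<sigma>\<bar> \<le> 1 \<and> s i * cmod (v z - of_real \<sigma> * u) \<le> \<eta> / 2 \<and> s i * cmod (w z - of_real \<sigma> * (\<i> * of_real r * u\<^sup>2)) \<le> \<eta> / 2) \<and>
      (\<forall>g\<in>G. s i * \<bar>LINT z|lborel. v z \<bullet> g z\<bar> \<le> \<epsilon> / k) \<and>
      (LINT z|lborel. (cmod (v z))\<^sup>2) \<ge> wave_gain * measure lborel (ball (fst i) (snd i))"
    for i :: "spacetime \<times> real" and v w :: "spacetime \<Rightarrow> complex" and r :: real and u :: complex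
  have per: "\<exists>v w r u. Q i v w r u" if i: "i \<in> F" for i
  proof -
    obtain a \<rho> where i': "i = (a, \<rho>)" by (cases i)
    have \<rho>: "\<rho> > 0" "ball a \<rho> \<subseteq> S" using F(2) i i' by auto
    have "a \<in> ball a \<rho>" using \<rho>(1) by simp
    then have aK: "a \<in> K" using SK \<rho>(2) by blast
    obtain u r where u: "cmod u = 1" "\<And>t. \<bar>t\<bar> \<le> (C - (cmod (V a))\<^sup>2) / (8 * sqrt C) \<Longrightarrow>
      subsol_energy (V a + of_real t * u) (Z a + of_real t * (\<i> * of_real r * u\<^sup>2)) \<le> (C + subsol_energy (V a) (Z a)) / 2"
      using subsol_energy_segment[OF e[of a]] by blast
    have u2: "subsol_energy (V a + of_real t * u) (Z a + of_real t * (\<i> * of_real r * u\<^sup>2)) \<le> C - \<mu> / 2" if "\<bar>t\<bar> \<le> s i" for t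
    proof -
      have "subsol_energy (V a + of_real t * u) (Z a + of_real t * (\<i> * of_real r * u\<^sup>2)) \<le> (C + subsol_energy (V a) (Z a)) / 2"
        by (rule u(2)) (use that in \<open>simp add: s_def i' L_def\<close>)
      then show ?thesis using \<mu>(2)[OF aK] by (simp add: field_simps)
    qed
    define \<epsilon>' where "\<epsilon>' = min (\<eta> / 2) (\<epsilon> / k) / (s i + 1)"
    have s1: "s i + 1 > 0" using s(1)[of i] by linarith
    have mp: "min (\<eta> / 2) (\<epsilon> / k) > 0" using \<eta> \<epsilon> k by simp
    have \<epsilon>': "\<epsilon>' > 0" using mp s1 by (simp add: \<epsilon>'_def)
    have se: "s i * \<epsilon>' \<le> \<eta> / 2" "s i * \<epsilon>' \<le> \<epsilon> / k"
    proof -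
      have "s i * \<epsilon>' \<le> (s i + 1) * \<epsilon>'" using \<epsilon>' by (intro mult_right_mono) auto
      also have "\<dots> = min (\<eta> / 2) (\<epsilon> / k)" using s1 by (simp add: \<epsilon>'_def)
      finally show "s i * \<epsilon>' \<le> \<eta> / 2" "s i * \<epsilon>' \<le> \<epsilon> / k" by auto
    qed
    have sm: "s i * x \<le> y" if "x \<le> \<epsilon>'" "s i * \<epsilon>' \<le> y" for x y
      using mult_left_mono[OF that(1) s(1)[of i]] that(2) by linarith
    obtain v w :: "spacetime \<Rightarrow> complex" where vw:
      "continuous_on UNIV v" "continuous_on UNIV w" "\<And>z. z \<notin> ball a \<rho> \<Longrightarrow> v z = 0 \<and> w z = 0" "lin_euler v w"
      "\<And>z. \<exists>\<sigma>. \<bar>\<sigma>\<bar> \<le> 1 \<and> cmod (v z - of_real \<sigma> * u) \<le> \<epsilon>' \<and> cmod (w z - of_real \<sigma> * (\<i> * of_real r * u\<^sup>2)) \<le> \<epsilon>'"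
      "\<And>g. g \<in> G \<Longrightarrow> \<bar>LINT z|lborel. v z \<bullet> g z\<bar> \<le> \<epsilon>'"
      "(LINT z|lborel. (cmod (v z))\<^sup>2) \<ge> wave_gain * measure lborel (ball a \<rho>)"
      by (rule perturbation[OF u(1) \<rho>(1) \<epsilon>' G, where a = a and r = r]) (assumption | (rule that; assumption))+
    have "\<exists>\<sigma>. \<bar>\<sigma>\<bar> \<le> 1 \<and> s i * cmod (v z - of_real \<sigma> * u) \<le> \<eta> / 2 \<and> s i * cmod (w z - of_real \<sigma> * (\<i> * of_real r * u\<^sup>2)) \<le> \<eta> / 2" for z
      using vw(5)[of z] sm[OF _ se(1)] by blast
    moreover have "\<forall>g\<in>G. s i * \<bar>LINT z|lborel. v z \<bullet> g z\<bar> \<le> \<epsilon> / k"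
      using vw(6) sm[OF _ se(2)] by blast
    ultimately have "Q i v w r u" using vw u u2 unfolding Q_def i' fst_conv snd_conv by blast
    then show ?thesis by blast
  qed
  obtain v where "\<forall>i\<in>F. \<exists>w r u. Q i (v i) w r u"
    using bchoice[of F "\<lambda>i v. \<exists>w r u. Q i v w r u"] per by blast
  then obtain w where "\<forall>i\<in>F. \<exists>r u. Q i (v i) (w i) r u"
    using bchoice[of F "\<lambda>i w. \<exists>r u. Q i (v i) w r u"] by blast
  then obtain r where "\<forall>i\<in>F. \<exists>u. Q i (v i) (w i) (r i) u"
    using bchoice[of F "\<lambda>i r. \<exists>u. Q i (v i) (w i) r u"] by blast
  then obtain u where "\<forall>i\<in>F. Q i (v i) (w i) (r i) (u i)"
    using bchoice[of F "\<lambda>i u. Q i (v i) (w i) (r i) u"] by blast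
  then have vwru: "Q i (v i) (w i) (r i) (u i)" if "i \<in> F" for i using that by blast
  have cv: "continuous_on UNIV (v i)" and cw: "continuous_on UNIV (w i)" and lin: "lin_euler (v i) (w i)" if "i \<in> F" for i
    using vwru[OF that] unfolding Q_def by blast+
  have out: "v i z = 0" "w i z = 0" if "i \<in> F" "z \<notin> ball (fst i) (snd i)" for i z
    using vwru[OF that(1)] that(2) unfolding Q_def by blast+
  have bS: "ball (fst i) (snd i) \<subseteq> S" "fst i \<in> S" "snd i < \<delta>" if "i \<in> F" for i
    using F(2)[of "fst i" "snd i"] that by auto
  obtain R where R: "\<And>z. z \<in> S \<Longrightarrow> norm z \<le> R" using S(2) unfolding bounded_iff by blast
  have outR: "z \<notin> S" if "norm z > R" for z using R[of z] that by auto
  have oR: "v i z = 0" "w i z = 0" if "i \<in> F" "norm z > R" for i z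
  proof -
    have "z \<notin> ball (fst i) (snd i)" using bS(1)[OF that(1)] outR[OF that(2)] by blast
    then show "v i z = 0" "w i z = 0" using out[OF that(1)] by blast+
  qed
  define dV where "dV z = (\<Sum>i\<in>F. of_real (s i) * v i z)" for z
  define dZ where "dZ z = (\<Sum>i\<in>F. of_real (s i) * w i z)" for z
  have cdV: "continuous_on UNIV dV" unfolding dV_def[abs_def] by (intro continuous_intros cv)
  have cdZ: "continuous_on UNIV dZ" unfolding dZ_def[abs_def] by (intro continuous_intros cw)
  have d_in: "dV z = of_real (s i) * v i z" "dZ z = of_real (s i) * w i z" if "i \<in> F" "z \<in> ball (fst i) (snd i)" for i z
  proof -
    have "v j z = 0 \<and> w j z = 0" if "j \<in> F - {i}" for j
      using F(3)[of i j] \<open>i \<in> F\<close> \<open>z \<in> _\<close> that out[of j z] by blast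
    then show "dV z = of_real (s i) * v i z" "dZ z = of_real (s i) * w i z"
      unfolding dV_def dZ_def sum.remove[OF F(1) \<open>i \<in> F\<close>] by (simp_all add: sum.neutral)
  qed
  have d_out: "dV z = 0" "dZ z = 0" if "\<And>i. i \<in> F \<Longrightarrow> z \<notin> ball (fst i) (snd i)" for z
    using that out unfolding dV_def dZ_def by (simp_all add: sum.neutral)
  have dS: "dV z = 0" "dZ z = 0" if "z \<notin> S" for z
    using d_out[of z] bS(1) that by blast+
  have lind: "lin_euler dV dZ \<and> bounded_borel dV \<and> bounded_borel dZ"
    unfolding dV_def[abs_def] dZ_def[abs_def]
  proof (rule lin_euler_sum[OF F(1)])
    fix i assume i: "i \<in> F"
    show "lin_euler (\<lambda>z. of_real (s i) * v i z) (\<lambda>z. of_real (s i) * w i z)" by (rule lin_euler_cmult[OF lin[OF i]])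
    show "bounded_borel (\<lambda>z. of_real (s i) * v i z)" "bounded_borel (\<lambda>z. of_real (s i) * w i z)"
      by (rule bounded_borel_continuous[of _ R]; use oR[OF i] in \<open>auto intro!: continuous_intros cv cw i\<close>)+
  qed
  have bb: "bounded_borel (\<lambda>z. V z - V0)" "bounded_borel (\<lambda>z. Z z - Z0)"
    by (rule bounded_borel_continuous[of _ R]; use subD outR in \<open>auto intro!: continuous_intros cV cZ\<close>)+
  show thesis
  proof (rule that[of "\<lambda>z. V z + dV z" "\<lambda>z. Z z + dZ z"])
    show "subsolution S C V0 Z0 (\<lambda>z. V z + dV z) (\<lambda>z. Z z + dZ z)"
      unfolding subsolution_def
    proof (intro conjI allI impI)
      show "continuous_on UNIV (\<lambda>z. V z + dV z)" "continuous_on UNIV (\<lambda>z. Z z + dZ z)"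
        by (intro continuous_intros cV cZ cdV cdZ)+
      show "V z + dV z = V0" "Z z + dZ z = Z0" if "z \<notin> S" for z
      proof -
        have "V z = V0 \<and> Z z = Z0" using subD that by blast
        then show "V z + dV z = V0" "Z z + dZ z = Z0" using dS[OF that] by simp_all
      qed
      have "lin_euler (\<lambda>z. (V z - V0) + dV z) (\<lambda>z. (Z z - Z0) + dZ z)"
        using lind bb subD by (intro lin_euler_add) blast+
      then show "lin_euler (\<lambda>z. V z + dV z - V0) (\<lambda>z. Z z + dZ z - Z0)" by (simp add: algebra_simps)
      fix z
      show "subsol_energy (V z + dV z) (Z z + dZ z) < C"
      proof (cases "\<exists>i\<in>F. z \<in> ball (fst i) (snd i)")
        case False
        then show ?thesis using d_out[of z] e[of z] by auto
      next
        case True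
        then obtain i where i: "i \<in> F" "z \<in> ball (fst i) (snd i)" by blast
        let ?a = "fst i"
        have zK: "z \<in> K" "?a \<in> K" using bS[OF i(1)] i(2) SK by auto
        have dz: "dist z ?a < \<delta>" using i(2) bS(3)[OF i(1)] by (simp add: dist_commute)
        obtain \<sigma> where \<sigma>: "\<bar>\<sigma>\<bar> \<le> 1" "s i * cmod (v i z - of_real \<sigma> * u i) \<le> \<eta> / 2" "s i * cmod (w i z - of_real \<sigma> * (\<i> * of_real (r i) * (u i)\<^sup>2)) \<le> \<eta> / 2"
          using vwru[OF i(1)] unfolding Q_def by blast
        define t where "t = s i * \<sigma>"
        have t: "\<bar>t\<bar> \<le> s i" using \<sigma>(1) s(1)[of i] by (simp add: t_def abs_mult mult_left_le)
        let ?V = "V ?a + of_real t * u i" and ?Z = "Z ?a + of_real t * (\<i> * of_real (r i) * (u i)\<^sup>2)"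
        have en: "subsol_energy ?V ?Z \<le> C - \<mu> / 2" using vwru[OF i(1)] t unfolding Q_def by blast
        have "cmod (V z + dV z - ?V) \<le> \<eta>"
        proof -
          have "V z + dV z - ?V = (V z - V ?a) + of_real (s i) * (v i z - of_real \<sigma> * u i)"
            unfolding d_in(1)[OF i] t_def by (simp add: algebra_simps)
          also have "cmod \<dots> \<le> cmod (V z - V ?a) + s i * cmod (v i z - of_real \<sigma> * u i)"
            using norm_triangle_ineq[of "V z - V ?a" "of_real (s i) * (v i z - of_real \<sigma> * u i)"] s(1)[of i] by (simp add: norm_mult)
          also have "\<dots> \<le> \<eta> / 2 + \<eta> / 2"
            using d1(2)[OF zK(2,1)] dz \<delta> \<sigma>(2) by (intro add_mono) (auto simp: dist_norm)
          finally show ?thesis by simp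
        qed
        moreover have "cmod (Z z + dZ z - ?Z) \<le> \<eta>"
        proof -
          have "Z z + dZ z - ?Z = (Z z - Z ?a) + of_real (s i) * (w i z - of_real \<sigma> * (\<i> * of_real (r i) * (u i)\<^sup>2))"
            unfolding d_in(2)[OF i] t_def by (simp add: algebra_simps)
          also have "cmod \<dots> \<le> cmod (Z z - Z ?a) + s i * cmod (w i z - of_real \<sigma> * (\<i> * of_real (r i) * (u i)\<^sup>2))"
            using norm_triangle_ineq[of "Z z - Z ?a" "of_real (s i) * (w i z - of_real \<sigma> * (\<i> * of_real (r i) * (u i)\<^sup>2))"] s(1)[of i]
            by (simp add: norm_mult)
          also have "\<dots> \<le> \<eta> / 2 + \<eta> / 2"
            using d2(2)[OF zK(2,1)] dz \<delta> \<sigma>(3) by (intro add_mono) (auto simp: dist_norm)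
          finally show ?thesis by simp
        qed
        ultimately have "subsol_energy (V z + dV z) (Z z + dZ z) \<le> subsol_energy ?V ?Z + \<eta> * (4 * sqrt C + 3)"
          using en \<mu>(1) \<eta>(2) by (intro subsol_energy_perturb) auto
        then show ?thesis using en \<eta>(3) \<mu>(1) by linarith
      qed
    qed
    show "\<bar>LINT z|lborel. (V z + dV z - V z) \<bullet> g z\<bar> \<le> \<epsilon>" if g: "g \<in> G" for g
    proof -
      have cg: "continuous_on UNIV g" using G(2)[OF g] .
      have int: "integrable lborel (\<lambda>z. v i z \<bullet> g z)" if "i \<in> F" for i
        by (rule integrable_continuous_bounded_support[of _ R]) (auto intro!: continuous_intros cv that cg simp: oR[OF that])
      have "(LINT z|lborel. (V z + dV z - V z) \<bullet> g z) = (LINT z|lborel. (\<Sum>i\<in>F. s i * (v i z \<bullet> g z)))"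
        by (intro Bochner_Integration.integral_cong) (auto simp: dV_def inner_sum_left scaleR_conv_of_real[symmetric])
      also have "\<dots> = (\<Sum>i\<in>F. s i * (LINT z|lborel. v i z \<bullet> g z))"
        using int by (subst Bochner_Integration.integral_sum) auto
      also have "\<bar>\<dots>\<bar> \<le> (\<Sum>i\<in>F. s i * \<bar>LINT z|lborel. v i z \<bullet> g z\<bar>)"
        by (rule order_trans[OF sum_abs]) (simp add: abs_mult s(1))
      also have "\<dots> \<le> (\<Sum>i\<in>F. \<epsilon> / k)" by (intro sum_mono) (use vwru g in \<open>unfold Q_def, blast\<close>)
      also have "\<dots> \<le> \<epsilon>" using \<epsilon> by (simp add: k_def field_simps)
      finally show ?thesis .
    qed
    \<comment> \<open>The waves have disjoint supports, so there are no cross terms.\<close>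
    have gain: "(LINT z|lborel. (cmod (dV z))\<^sup>2) = (\<Sum>i\<in>F. (s i)\<^sup>2 * (LINT z|lborel. (cmod (v i z))\<^sup>2))"
    proof -
      have int: "integrable lborel (\<lambda>z. (cmod (v i z))\<^sup>2)" if "i \<in> F" for i
        by (rule integrable_continuous_bounded_support[of _ R]) (auto intro!: continuous_intros cv that simp: oR[OF that])
      have "(cmod (dV z))\<^sup>2 = (\<Sum>i\<in>F. (s i)\<^sup>2 * (cmod (v i z))\<^sup>2)" for z
      proof (cases "\<exists>i\<in>F. z \<in> ball (fst i) (snd i)")
        case False
        then show ?thesis using d_out[of z] out by (auto simp: sum.neutral)
      next
        case True
        then obtain i where i: "i \<in> F" "z \<in> ball (fst i) (snd i)" by blast
        have "v j z = 0" if "j \<in> F - {i}" for j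
          using F(3)[of i j] i that out(1)[of j z] by blast
        then show ?thesis unfolding d_in(1)[OF i] sum.remove[OF F(1) i(1)]
          by (simp add: sum.neutral norm_mult power_mult_distrib)
      qed
      then show ?thesis using int by (simp add: Bochner_Integration.integral_sum)
    qed
    let ?b = "\<lambda>i::spacetime \<times> real. ball (fst i) (snd i)"
    let ?U = "\<Union>(?b ` F)"
    have US: "?U \<subseteq> S" using bS(1) by blast
    have UB: "?U \<in> sets borel" by (intro borel_open open_UN) auto
    have iset: "integrable lborel (\<lambda>z. indicator A z * (L z)\<^sup>2)" if "A \<in> sets borel" "A \<subseteq> S" for A
    proof (rule integrable_bounded_support[of _ R "C\<^sup>2"])
      show "(\<lambda>z. indicator A z * (L z)\<^sup>2) \<in> borel_measurable borel"
        using that borel_measurable_continuous_onI[OF cL2] by auto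
      show "indicator A z * (L z)\<^sup>2 = 0" if "norm z > R" for z using outR[OF that] \<open>A \<subseteq> S\<close> by (auto simp: indicator_def)
      show "norm (indicator A z * (L z)\<^sup>2) \<le> C\<^sup>2" for z using L2C[of z] by (auto simp: indicator_def)
    qed
    have fS: "emeasure lborel S < \<infinity>" using S(2) emeasure_bounded_finite by blast
    have fin: "emeasure lborel A < \<infinity>" if "A \<subseteq> S" "A \<in> sets borel" for A
      using emeasure_mono[of A S lborel] fS that S(1) by (auto intro: le_less_trans)
    have imeas: "integrable lborel (\<lambda>z. indicator A z * c)" if "A \<subseteq> S" "A \<in> sets borel" for A and c :: real
      using fin[OF that] that(2) by (intro integrable_mult_left integrable_real_indicator) auto
    have ball_int: "(LINT z|lborel. indicator (?b i) z * (L z)\<^sup>2) \<le> (L (fst i))\<^sup>2 * measure lborel (?b i) + \<theta> * measure lborel (?b i)" if i: "i \<in> F" for i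
    proof -
      have "(LINT z|lborel. indicator (?b i) z * (L z)\<^sup>2) \<le> (LINT z|lborel. indicator (?b i) z * ((L (fst i))\<^sup>2 + \<theta>))"
      proof (rule integral_mono)
        show "indicator (?b i) z * (L z)\<^sup>2 \<le> indicator (?b i) z * ((L (fst i))\<^sup>2 + \<theta>)" for z
        proof (cases "z \<in> ?b i")
          case True
          then have "dist ((L z)\<^sup>2) ((L (fst i))\<^sup>2) < \<theta>"
            using bS[OF i] SK \<delta> by (intro d3(2)) (auto simp: dist_commute)
          then show ?thesis using True by (simp add: dist_real_def)
        qed simp
      qed (use bS[OF i] iset imeas in auto)
      also have "\<dots> = ((L (fst i))\<^sup>2 + \<theta>) * measure lborel (?b i)" by simp
      finally show ?thesis by (simp add: algebra_simps)
    qed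
    have indU: "indicator ?U z = (\<Sum>i\<in>F. indicator (?b i) z :: real)" for z
      using indicator_UN_disjoint[of F ?b z] F(1,3) by (simp add: disjoint_family_on_def)
    have "(LINT z|lborel. indicator ?U z * (L z)\<^sup>2) = (\<Sum>i\<in>F. LINT z|lborel. indicator (?b i) z * (L z)\<^sup>2)"
      unfolding indU sum_distrib_right using bS(1) iset by (intro Bochner_Integration.integral_sum) auto
    also have "\<dots> \<le> (\<Sum>i\<in>F. (L (fst i))\<^sup>2 * measure lborel (?b i) + \<theta> * measure lborel (?b i))"
      by (intro sum_mono ball_int)
    also have "\<dots> = (\<Sum>i\<in>F. (L (fst i))\<^sup>2 * measure lborel (?b i)) + \<theta> * (\<Sum>i\<in>F. measure lborel (?b i))"
      by (simp add: sum.distrib sum_distrib_left)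
    also have "(\<Sum>i\<in>F. measure lborel (?b i)) = measure lborel ?U"
    proof (rule measure_finite_Union[symmetric, OF F(1)])
      show "?b ` F \<subseteq> sets lborel" by auto
      show "disjoint_family_on ?b F" unfolding disjoint_family_on_def using F(3) by blast
      show "emeasure lborel (?b i) \<noteq> \<infinity>" if "i \<in> F" for i using fin[OF bS(1)[OF that]] by auto
    qed
    also have "measure lborel ?U \<le> m"
      unfolding m_def using US S(1) fS UB by (intro measure_mono_fmeasurable) (auto simp: fmeasurable_def)
    finally have IU: "(LINT z|lborel. indicator ?U z * (L z)\<^sup>2) \<le> (\<Sum>i\<in>F. (L (fst i))\<^sup>2 * measure lborel (?b i)) + \<theta> * m"
      using \<theta>(1) by (simp add: mult_left_mono)
    have "(LINT z|lborel. indicator S z * (L z)\<^sup>2) \<le> (LINT z|lborel. indicator ?U z * (L z)\<^sup>2 + indicator (S - ?U) z * C\<^sup>2)"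
    proof (rule integral_mono)
      show "indicator S z * (L z)\<^sup>2 \<le> indicator ?U z * (L z)\<^sup>2 + indicator (S - ?U) z * C\<^sup>2" for z
        using US L2C[of z] by (auto simp: indicator_def)
    qed (use S(1) US UB in \<open>auto intro!: iset imeas Bochner_Integration.integrable_add\<close>)
    also have "\<dots> = (LINT z|lborel. indicator ?U z * (L z)\<^sup>2) + C\<^sup>2 * measure lborel (S - ?U)"
    proof -
      have "integrable lborel (\<lambda>z. indicator (S - ?U) z * C\<^sup>2)"
        by (rule imeas) (use S(1) UB in \<open>auto intro!: sets.Diff[of _ borel]\<close>)
      from Bochner_Integration.integral_add[OF iset[OF UB US] this] show ?thesis by simp
    qed
    also have "\<dots> \<le> (LINT z|lborel. indicator ?U z * (L z)\<^sup>2) + C\<^sup>2 * \<theta>"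
      using F(4) by (intro add_left_mono mult_left_mono) auto
    finally have IS: "(LINT z|lborel. indicator S z * (L z)\<^sup>2) \<le> (\<Sum>i\<in>F. (L (fst i))\<^sup>2 * measure lborel (?b i)) + (\<theta> * m + C\<^sup>2 * \<theta>)"
      using IU by linarith
    have "c1 * (LINT z|lborel. indicator S z * (L z)\<^sup>2) \<le> c1 * (\<Sum>i\<in>F. (L (fst i))\<^sup>2 * measure lborel (?b i)) + c1 * (\<theta> * m + C\<^sup>2 * \<theta>)"
      using mult_left_mono[OF IS, of c1] c1 by (simp add: distrib_left)
    also have "\<dots> \<le> c1 * (\<Sum>i\<in>F. (L (fst i))\<^sup>2 * measure lborel (?b i)) + \<epsilon>" using \<theta>(2) by simp
    also have "c1 * (\<Sum>i\<in>F. (L (fst i))\<^sup>2 * measure lborel (?b i)) = (\<Sum>i\<in>F. (s i)\<^sup>2 * (wave_gain * measure lborel (?b i)))"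
      by (simp add: sum_distrib_left s(2) c1_def mult_ac)
    also have "\<dots> \<le> (\<Sum>i\<in>F. (s i)\<^sup>2 * (LINT z|lborel. (cmod (v i z))\<^sup>2))"
      by (intro sum_mono mult_left_mono) (use vwru in \<open>auto simp: Q_def\<close>)
    finally show "(LINT z|lborel. (cmod (V z + dV z - V z))\<^sup>2) \<ge>
       wave_gain / (64 * C) * (LINT z|lborel. indicator S z * (C - (cmod (V z))\<^sup>2)\<^sup>2) - \<epsilon>"
      using gain by (simp add: c1_def L_def)
  qed
qed

section \<open>The infinite iteration and its strong limit\<close>

lemma AE_tendsto_0_of_summable_integral:
  fixes f :: "nat \<Rightarrow> 'a \<Rightarrow> real"
  assumes "\<And>j. integrable M (f j)" "\<And>j x. 0 \<le> f j x" "\<And>j. integral\<^sup>L M (f j) \<le> B j" "summable B"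
  shows "AE x in M. (\<lambda>j. f j x) \<longlonglongrightarrow> 0"
proof -
  have B0: "0 \<le> B j" for j using assms(3)[of j] integral_nonneg_AE[of "f j" M] assms(2) by (meson AE_I2 order_trans)
  have "(\<integral>\<^sup>+x. (\<Sum>j. ennreal (f j x)) \<partial>M) = (\<Sum>j. \<integral>\<^sup>+x. ennreal (f j x) \<partial>M)"
    using assms(1) by (intro nn_integral_suminf) auto
  also have "\<dots> = (\<Sum>j. ennreal (integral\<^sup>L M (f j)))"
    by (intro suminf_cong nn_integral_eq_integral assms(1)) (use assms(2) in auto)
  also have "\<dots> \<le> (\<Sum>j. ennreal (B j))"
    by (intro suminf_le ennreal_leI assms(3)) auto
  also have "\<dots> < \<infinity>"
    using B0 assms(4) by (simp add: suminf_ennreal2)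
  finally have "AE x in M. (\<Sum>j. ennreal (f j x)) \<noteq> \<infinity>"
    using assms(1) by (intro nn_integral_PInf_AE) auto
  then show ?thesis
  proof (rule AE_mp, intro AE_I2 impI)
    fix x assume "(\<Sum>j. ennreal (f j x)) \<noteq> \<infinity>"
    then have "summable (\<lambda>j. f j x)" using assms(2) by (intro summable_suminf_not_top) auto
    then show "(\<lambda>j. f j x) \<longlonglongrightarrow> 0" by (rule summable_LIMSEQ_zero)
  qed
qed

lemma weakly_div_free_limit:
  assumes "\<And>k. weakly_div_free (m k)" "\<And>k. m k \<in> borel_measurable borel" "\<And>k z. norm (m k z) \<le> B"
    "m' \<in> borel_measurable borel" "AE z in lborel. (\<lambda>k. m k z) \<longlonglongrightarrow> m' z"
  shows "weakly_div_free m'"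
  unfolding weakly_div_free_def
proof (intro allI impI)
  fix \<psi> assume \<psi>: "C1c \<psi>"
  obtain R where R: "\<And>z h. norm z > R \<Longrightarrow> D \<psi> z h = 0" using C1c_support[OF \<psi>] by metis
  obtain K where K: "K > 0" "\<And>z h. \<bar>D \<psi> z h\<bar> \<le> K * norm h" using C1c_bounded[OF \<psi>] by metis
  have "(\<lambda>k. LINT z|lborel. D \<psi> z (m k z)) \<longlonglongrightarrow> (LINT z|lborel. D \<psi> z (m' z))"
  proof (rule dominated_convergence_bounded_support[where R = R and K = "K * B"])
    show "AE z in lborel. (\<lambda>k. D \<psi> z (m k z)) \<longlonglongrightarrow> D \<psi> z (m' z)"
      using assms(5)
    proof (rule AE_mp, intro AE_I2 impI)
      fix z assume "(\<lambda>k. m k z) \<longlonglongrightarrow> m' z"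
      moreover have "bounded_linear (D \<psi> z)" using C1cD(3)[OF \<psi>] by (simp add: linear_conv_bounded_linear)
      ultimately show "(\<lambda>k. D \<psi> z (m k z)) \<longlonglongrightarrow> D \<psi> z (m' z)" by (rule bounded_linear.tendsto[rotated])
    qed
    show "norm (D \<psi> z (m k z)) \<le> K * B" for k z
      using order_trans[OF K(2)[of z "m k z"] mult_left_mono[OF assms(3)[of k z], of K]] K(1) by simp
  qed (use R borel_measurable_D[OF \<psi>] assms in auto)
  then show "(LINT z|lborel. D \<psi> z (m' z)) = 0"
    using assms(1) \<psi> by (simp add: weakly_div_free_def LIMSEQ_const_iff)
qed

lemma lin_euler_limit:
  assumes "\<And>k. lin_euler (V k) (Z k)" "\<And>k. V k \<in> borel_measurable borel" "\<And>k. Z k \<in> borel_measurable borel"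
    "\<And>k z. cmod (V k z) \<le> B" "\<And>k z. cmod (Z k z) \<le> B"
    "V' \<in> borel_measurable borel" "Z' \<in> borel_measurable borel"
    "AE z in lborel. (\<lambda>k. V k z) \<longlonglongrightarrow> V' z" "AE z in lborel. (\<lambda>k. Z k z) \<longlonglongrightarrow> Z' z"
  shows "lin_euler V' Z'"
proof -
  have b: "2 * (cmod (V k z) + cmod (Z k z)) \<le> 2 * (B + B)" for k z using assms(4)[of k z] assms(5)[of k z] by simp
  have AE2: "AE z in lborel. (\<lambda>k. F (V k z) (Z k z)) \<longlonglongrightarrow> F (V' z) (Z' z)"
    if "continuous_on UNIV (\<lambda>p. F (fst p) (snd p))" for F :: "complex \<Rightarrow> complex \<Rightarrow> spacetime"
    using assms(8,9)
  proof eventually_elim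
    case (elim z)
    have "isCont (\<lambda>p. F (fst p) (snd p)) (V' z, Z' z)" using that by (simp add: continuous_on_eq_continuous_at)
    from isCont_tendsto_compose[OF this tendsto_Pair[OF elim]] show ?case by simp
  qed
  have c: "continuous_on UNIV (\<lambda>p. fld1 (fst p) (snd p))" "continuous_on UNIV (\<lambda>p. fld2 (fst p) (snd p))"
    "continuous_on UNIV (\<lambda>p. fld3 (fst p) (snd p))"
    by (intro continuous_on_fld continuous_intros)+
  show ?thesis unfolding lin_euler_def
    by (intro conjI;
        rule weakly_div_free_limit[where B = "2 * (B + B)", rotated 2, OF order_trans[OF norm_fld_le(1) b] borel_measurable_fld(1)[OF assms(6,7)] AE2[OF c(1)]]
         weakly_div_free_limit[where B = "2 * (B + B)", rotated 2, OF order_trans[OF norm_fld_le(2) b] borel_measurable_fld(2)[OF assms(6,7)] AE2[OF c(2)]]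
         weakly_div_free_limit[where B = "2 * (B + B)", rotated 2, OF order_trans[OF norm_fld_le(3) b] borel_measurable_fld(3)[OF assms(6,7)] AE2[OF c(3)]];
        use assms(1) borel_measurable_fld[OF assms(2,3)] in \<open>auto simp: lin_euler_def\<close>)
qed

text \<open>Near-orthogonality of each increment to all earlier iterates makes the squared norms almost
  additive; being bounded they converge, so the iterates converge strongly in \<open>L\<^sup>2\<close>.\<close>

lemma subsolution_sequence:
  fixes G :: "(spacetime \<Rightarrow> complex) set"
  assumes S: "open S" "bounded S" and e0: "subsol_energy V0 Z0 < C"
    and G: "finite G" "\<And>g. g \<in> G \<Longrightarrow> continuous_on UNIV g" and \<epsilon>: "\<epsilon> > 0"
  obtains V Z :: "nat \<Rightarrow> spacetime \<Rightarrow> complex" where "\<And>k. subsolution S C V0 Z0 (V k) (Z k)" "V 0 = (\<lambda>z. V0)"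
    "\<And>k g. g \<in> G \<Longrightarrow> \<bar>LINT z|lborel. (V (Suc k) z - V k z) \<bullet> g z\<bar> \<le> \<epsilon> / 2 ^ Suc k"
    "\<And>k j. j \<le> k \<Longrightarrow> \<bar>LINT z|lborel. (V (Suc k) z - V k z) \<bullet> (V j z - V0)\<bar> \<le> \<epsilon> / 2 ^ Suc k"
    "\<And>k. (LINT z|lborel. (cmod (V (Suc k) z - V k z))\<^sup>2) \<ge>
       wave_gain / (64 * C) * (LINT z|lborel. indicator S z * (C - (cmod (V k z))\<^sup>2)\<^sup>2) - \<epsilon> / 2 ^ Suc k"
proof -
  \<comment> \<open>The state carries a growing finite set \<open>H\<close> that contains
    \<open>G\<close> and the deviations \<open>V j - V0\<close> of all iterates so far. Each step is
    made nearly orthogonal to everything in \<open>H\<close>.\<close>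
  define P :: "nat \<Rightarrow> (spacetime \<Rightarrow> complex) \<times> (spacetime \<Rightarrow> complex) \<times> (spacetime \<Rightarrow> complex) set \<Rightarrow> bool"
    where "P k x \<longleftrightarrow> (case x of (V, Z, H) \<Rightarrow> subsolution S C V0 Z0 V Z \<and> finite H \<and> (\<forall>g\<in>H. continuous_on UNIV g) \<and> G \<subseteq> H \<and>
      (\<lambda>z. V z - V0) \<in> H \<and> (k = 0 \<longrightarrow> V = (\<lambda>z. V0)))" for k x
  define Q :: "nat \<Rightarrow> (spacetime \<Rightarrow> complex) \<times> (spacetime \<Rightarrow> complex) \<times> (spacetime \<Rightarrow> complex) set \<Rightarrow>
      (spacetime \<Rightarrow> complex) \<times> (spacetime \<Rightarrow> complex) \<times> (spacetime \<Rightarrow> complex) set \<Rightarrow> bool"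
    where "Q k x x' \<longleftrightarrow> (case x of (V, Z, H) \<Rightarrow> case x' of (V', Z', H') \<Rightarrow> H \<subseteq> H' \<and>
      (\<forall>g\<in>H. \<bar>LINT z|lborel. (V' z - V z) \<bullet> g z\<bar> \<le> \<epsilon> / 2 ^ Suc k) \<and>
      (LINT z|lborel. (cmod (V' z - V z))\<^sup>2) \<ge>
       wave_gain / (64 * C) * (LINT z|lborel. indicator S z * (C - (cmod (V z))\<^sup>2)\<^sup>2) - \<epsilon> / 2 ^ Suc k)" for k x x'
  have "\<exists>f. \<forall>k. P k (f k) \<and> Q k (f k) (f (Suc k))"
  proof (rule dependent_nat_choice)
    have "P 0 (\<lambda>z. V0, \<lambda>z. Z0, insert (\<lambda>z. V0 - V0) G)"
      using G e0 lin_euler_0 by (auto simp: P_def subsolution_def)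
    then show "\<exists>x. P 0 x" by blast
  next
    fix x k assume "P k x"
    moreover obtain V Z H where x: "x = (V, Z, H)" by (cases x)
    ultimately have H: "subsolution S C V0 Z0 V Z" "finite H" "\<And>g. g \<in> H \<Longrightarrow> continuous_on UNIV g" "G \<subseteq> H"
      by (auto simp: P_def)
    have e: "\<epsilon> / 2 ^ Suc k > 0" using \<epsilon> by simp
    obtain V' Z' where V': "subsolution S C V0 Z0 V' Z'"
      "\<And>g. g \<in> H \<Longrightarrow> \<bar>LINT z|lborel. (V' z - V z) \<bullet> g z\<bar> \<le> \<epsilon> / 2 ^ Suc k"
      "(LINT z|lborel. (cmod (V' z - V z))\<^sup>2) \<ge>
       wave_gain / (64 * C) * (LINT z|lborel. indicator S z * (C - (cmod (V z))\<^sup>2)\<^sup>2) - \<epsilon> / 2 ^ Suc k"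
      by (rule subsolution_step[OF S H(1,2) _ e]) (use H(3) in \<open>blast+\<close>)
    have "continuous_on UNIV (\<lambda>z. V' z - V0)" using V'(1) by (auto simp: subsolution_def intro!: continuous_intros)
    then have "P (Suc k) (V', Z', insert (\<lambda>z. V' z - V0) H)" "Q k x (V', Z', insert (\<lambda>z. V' z - V0) H)"
      using H V' by (auto simp: P_def Q_def x)
    then show "\<exists>y. P (Suc k) y \<and> Q k x y" by blast
  qed
  then obtain f where f: "\<And>k. P k (f k)" "\<And>k. Q k (f k) (f (Suc k))" by blast
  define V Z H where "V k = fst (f k)" and "Z k = fst (snd (f k))" and "H k = snd (snd (f k))" for k
  have fk: "f k = (V k, Z k, H k)" for k by (simp add: V_def Z_def H_def)
  have p: "subsolution S C V0 Z0 (V k) (Z k)" "G \<subseteq> H k" "(\<lambda>z. V k z - V0) \<in> H k" for k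
    using f(1)[of k] unfolding fk P_def by auto
  have q: "H k \<subseteq> H (Suc k)" "g \<in> H k \<Longrightarrow> \<bar>LINT z|lborel. (V (Suc k) z - V k z) \<bullet> g z\<bar> \<le> \<epsilon> / 2 ^ Suc k"
    "(LINT z|lborel. (cmod (V (Suc k) z - V k z))\<^sup>2) \<ge>
       wave_gain / (64 * C) * (LINT z|lborel. indicator S z * (C - (cmod (V k z))\<^sup>2)\<^sup>2) - \<epsilon> / 2 ^ Suc k" for k g
    using f(2)[of k] unfolding fk Q_def by auto
  have mono: "j \<le> k \<Longrightarrow> H j \<subseteq> H k" for j k using q(1) by (rule lift_Suc_mono_le)
  show thesis
  proof (rule that[of V Z])
    show "V 0 = (\<lambda>z. V0)" using f(1)[of 0] unfolding fk P_def by auto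
    show "\<bar>LINT z|lborel. (V (Suc k) z - V k z) \<bullet> g z\<bar> \<le> \<epsilon> / 2 ^ Suc k" if "g \<in> G" for k g
      using q(2)[of g k] p(2)[of k] that by blast
    show "\<bar>LINT z|lborel. (V (Suc k) z - V k z) \<bullet> (V j z - V0)\<bar> \<le> \<epsilon> / 2 ^ Suc k" if "j \<le> k" for k j
      using q(2)[of "\<lambda>z. V j z - V0" k] p(3)[of j] mono[OF that] by blast
  qed (rule p q)+
qed

text \<open>The squared norms grow almost monotonically and are bounded, so their increments tend to
  zero. The gain of each step is dominated by these increments, which forces the integral of the
  squared defect \<open>C - |V k|^2\<close> to zero as well.\<close>

lemma subsolution_limit:
  fixes G :: "(spacetime \<Rightarrow> complex) set"
  assumes S: "open S" "bounded S" and e0: "subsol_energy V0 Z0 < C"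
    and G: "finite G" "\<And>g. g \<in> G \<Longrightarrow> continuous_on UNIV g" and \<epsilon>: "\<epsilon> > 0"
  obtains V Z :: "nat \<Rightarrow> spacetime \<Rightarrow> complex" where "\<And>k. subsolution S C V0 Z0 (V k) (Z k)"
    "\<And>k g. g \<in> G \<Longrightarrow> \<bar>LINT z|lborel. (V k z - V0) \<bullet> g z\<bar> \<le> \<epsilon>"
    "AE z in lborel. convergent (\<lambda>k. V k z)"
    "AE z in lborel. z \<in> S \<longrightarrow> (\<lambda>k. C - (cmod (V k z))\<^sup>2) \<longlonglongrightarrow> 0"
proof -
  obtain V Z :: "nat \<Rightarrow> spacetime \<Rightarrow> complex" where sub: "\<And>k. subsolution S C V0 Z0 (V k) (Z k)" and V0: "V 0 = (\<lambda>z. V0)"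
    and VG: "\<And>k g. g \<in> G \<Longrightarrow> \<bar>LINT z|lborel. (V (Suc k) z - V k z) \<bullet> g z\<bar> \<le> \<epsilon> / 2 ^ Suc k"
    and Vo: "\<And>k j. j \<le> k \<Longrightarrow> \<bar>LINT z|lborel. (V (Suc k) z - V k z) \<bullet> (V j z - V0)\<bar> \<le> \<epsilon> / 2 ^ Suc k"
    and Vg: "\<And>k. (LINT z|lborel. (cmod (V (Suc k) z - V k z))\<^sup>2) \<ge>
       wave_gain / (64 * C) * (LINT z|lborel. indicator S z * (C - (cmod (V k z))\<^sup>2)\<^sup>2) - \<epsilon> / 2 ^ Suc k"
    by (rule subsolution_sequence[OF S e0 G \<epsilon>]) (assumption | (rule that; assumption))+
  have cV: "continuous_on UNIV (V k)" for k using sub[of k] by (simp add: subsolution_def)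
  have Vout: "V k z = V0" if "z \<notin> S" for k z using sub[of k] that unfolding subsolution_def by blast
  have en: "subsol_energy (V k z) (Z k z) < C" for k z using sub[of k] unfolding subsolution_def by blast
  have V2: "(cmod (V k z))\<^sup>2 < C" for k z
    using en[of k z] norm_ge_zero[of "(V k z)\<^sup>2 - Z k z"] unfolding subsol_energy_def by linarith
  have C: "C > 0" using order_le_less_trans[OF zero_le_power2 V2] .
  have Vle: "cmod (V k z) \<le> sqrt C" for k z using V2[of k z] by (intro real_le_rsqrt) simp
  obtain R where R: "\<And>z. z \<in> S \<Longrightarrow> norm z \<le> R" using S(2) unfolding bounded_iff by blast
  have outR: "z \<notin> S" if "norm z > R" for z using R[of z] that by auto
  define v where "v k z = V k z - V0" for k z
  have cv: "continuous_on UNIV (v k)" for k unfolding v_def[abs_def] by (intro continuous_intros cV)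
  have vR: "v k z = 0" if "norm z > R" for k z using Vout[OF outR[OF that]] by (simp add: v_def)
  have int: "integrable lborel (\<lambda>z. v j z \<bullet> f z)" if "continuous_on UNIV f" for f :: "spacetime \<Rightarrow> complex" and j
    by (rule integrable_continuous_bounded_support[of _ R]) (auto intro!: continuous_intros cv that simp: vR)
  define ip where "ip f g = (LINT z|lborel. f z \<bullet> g z)" for f g :: "spacetime \<Rightarrow> complex"
  have ipd: "ip (\<lambda>z. v i z - v j z) f = ip (v i) f - ip (v j) f" if "continuous_on UNIV f" for i j f
    unfolding ip_def using int[OF that] by (simp add: inner_diff_left)
  have ipc: "ip f g = ip g f" for f g by (simp add: ip_def inner_commute)
  define a where "a k = ip (v k) (v k)" for k
  have dd: "ip (\<lambda>z. v k z - v j z) (\<lambda>z. v k z - v j z) = a k - a j - 2 * (ip (v k) (v j) - ip (v j) (v j))" for k j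
  proof -
    have c: "continuous_on UNIV (\<lambda>z. v k z - v j z)" by (intro continuous_intros cv)
    show ?thesis using ipd[OF c] ipd[OF cv] ipc by (simp add: a_def)
  qed
  have Vd: "V i z - V j z = v i z - v j z" for i j z by (simp add: v_def)
  define D where "D k j = ip (\<lambda>z. v k z - v j z) (\<lambda>z. v k z - v j z)" for k j
  have De: "D k j = (LINT z|lborel. (cmod (V k z - V j z))\<^sup>2)" for k j
    by (simp add: D_def ip_def Vd power2_norm_eq_inner)
  define eps where "eps k = \<epsilon> / 2 ^ Suc k" for k
  have ort: "\<bar>ip (v (Suc k)) (v j) - ip (v k) (v j)\<bar> \<le> eps k" if "j \<le> k" for k j
    using Vo[OF that] ipd[OF cv, of "Suc k" k j] unfolding ip_def Vd eps_def v_def by simp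
  have se: "(\<Sum>i<k. eps i) = \<epsilon> * (1 - 1 / 2 ^ k)" for k
    by (induction k) (auto simp: eps_def field_simps)
  have se_le: "(\<Sum>i<k. eps i) \<le> \<epsilon>" for k unfolding se using \<epsilon> by (simp add: mult_left_le)
  have orts: "\<bar>ip (v (j + n)) (v j) - ip (v j) (v j)\<bar> \<le> (\<Sum>i<j + n. eps i) - (\<Sum>i<j. eps i)" for n j
  proof (induction n)
    case (Suc n)
    then show ?case using ort[of j "j + n"] by simp
  qed simp
  \<comment> \<open>The squared distance of two iterates is the difference of their squared norms up
    to twice an inner product of size at most the sum of the intermediate \<open>eps\<close>. The
    added sums absorb that error, so \<open>b\<close> is monotone and its differences dominate
    squared distances.\<close>
  define b where "b k = a k + 2 * (\<Sum>i<k. eps i)" for k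
  have Db: "D k j \<le> b k - b j" if "j \<le> k" for j k
    using orts[of j "k - j"] that dd[of k j] unfolding D_def b_def by simp
  have D0: "D k j \<ge> 0" for k j unfolding De by (intro Bochner_Integration.integral_nonneg) simp
  define m where "m = measure lborel S"
  have fS: "emeasure lborel S < \<infinity>" using S(2) emeasure_bounded_finite by blast
  have iS: "integrable lborel (\<lambda>z. indicator S z * c)" for c :: real
    using S(1) fS by (intro integrable_mult_left integrable_real_indicator) auto
  have V0C: "cmod V0 \<le> sqrt C" using Vle[of 0] V0 by simp
  have a_le: "a k \<le> 4 * C * m" for k
  proof -
    have "a k \<le> (LINT z|lborel. indicator S z * (4 * C))"
      unfolding a_def ip_def
    proof (rule integral_mono[OF int[OF cv] iS])
      fix z
      show "v k z \<bullet> v k z \<le> indicator S z * (4 * C)"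
      proof (cases "z \<in> S")
        case True
        have "cmod (v k z) \<le> 2 * sqrt C"
          using norm_triangle_ineq4[of "V k z" V0] Vle[of k z] V0C by (simp add: v_def)
        then have "(cmod (v k z))\<^sup>2 \<le> (2 * sqrt C)\<^sup>2" by (intro power_mono) auto
        then show ?thesis using True C by (simp add: power2_norm_eq_inner power_mult_distrib)
      qed (simp add: v_def Vout)
    qed
    then show ?thesis by (simp add: m_def mult.commute)
  qed
  have "incseq b"
    using Db D0 by (intro incseq_SucI) (smt (verit) le_Suc_eq order_refl)
  moreover have "b k \<le> 4 * C * m + 2 * \<epsilon>" for k using a_le[of k] se_le[of k] by (simp add: b_def)
  ultimately obtain l where l: "b \<longlonglongrightarrow> l" "\<And>k. b k \<le> l" using incseq_convergent[of b] by blast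
  define J where "J k = (LINT z|lborel. indicator S z * (C - (cmod (V k z))\<^sup>2)\<^sup>2)" for k
  define c1 where "c1 = wave_gain / (64 * C)"
  have c1: "c1 > 0" using C by (simp add: c1_def wave_gain_def)
  have Jl: "c1 * J k \<le> b (Suc k) - b k + eps k" for k
    using Vg[of k] Db[of k "Suc k"] unfolding J_def c1_def eps_def De by simp
  have eps_lim: "eps \<longlonglongrightarrow> 0"
  proof -
    have "(\<lambda>k. \<epsilon> * (1 / 2) ^ Suc k) \<longlonglongrightarrow> \<epsilon> * 0"
      by (intro tendsto_intros LIMSEQ_Suc LIMSEQ_realpow_zero) auto
    then show ?thesis by (simp add: eps_def[abs_def] power_divide)
  qed
  have J0: "J k \<ge> 0" for k unfolding J_def by (intro Bochner_Integration.integral_nonneg) simp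
  have Jlim: "J \<longlonglongrightarrow> 0"
  proof -
    have "(\<lambda>k. (b (Suc k) - b k + eps k) / c1) \<longlonglongrightarrow> (l - l + 0) / c1"
      by (intro tendsto_intros LIMSEQ_Suc l(1) eps_lim) (use c1 in auto)
    then have "(\<lambda>k. (b (Suc k) - b k + eps k) / c1) \<longlonglongrightarrow> 0" by simp
    then show ?thesis
      by (rule real_tendsto_sandwich[OF _ _ tendsto_const, rotated 2])
         (use Jl J0 c1 in \<open>auto simp: field_simps mult.commute\<close>)
  qed
  \<comment> \<open>The rate \<open>(1/4) ^ j\<close> leaves \<open>(1/2) ^ j\<close> after
    weighting with \<open>2 ^ j\<close>. The weighted squares then tend to zero almost everywhere,
    so the increments are eventually below \<open>sqrt (1/2) ^ j\<close> and their series
    converges.\<close>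
  have "\<exists>r. strict_mono r \<and> (\<forall>j. l - b (r j) \<le> (1/4) ^ j \<and> J (r j) \<le> (1/4) ^ j)"
  proof -
    have ev: "\<forall>\<^sub>F k in sequentially. l - b k < (1/4) ^ j \<and> J k < (1/4) ^ j" for j
    proof (rule eventually_conj)
      show "\<forall>\<^sub>F k in sequentially. J k < (1/4) ^ j" using Jlim by (rule order_tendstoD) simp
      have "(\<lambda>k. l - b k) \<longlonglongrightarrow> l - l" by (intro tendsto_intros l)
      then show "\<forall>\<^sub>F k in sequentially. l - b k < (1/4) ^ j" by (rule order_tendstoD) simp
    qed
    have "\<exists>r. \<forall>j. (l - b (r j) \<le> (1/4) ^ j \<and> J (r j) \<le> (1/4) ^ j) \<and> r j < r (Suc j)"
    proof (rule dependent_nat_choice)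
      show "\<exists>x. l - b x \<le> (1/4) ^ 0 \<and> J x \<le> (1/4) ^ 0"
        using eventually_happens[OF ev[of 0]] by (auto intro: less_imp_le)
      show "\<exists>y. (l - b y \<le> (1/4) ^ Suc j \<and> J y \<le> (1/4) ^ Suc j) \<and> x < y" for x j
        using eventually_happens[OF eventually_conj[OF ev[of "Suc j"] eventually_gt_at_top[of x]]] by (auto intro: less_imp_le)
    qed
    then show ?thesis by (auto intro: strict_monoI_Suc)
  qed
  then obtain r where r: "strict_mono r" "\<And>j. l - b (r j) \<le> (1/4) ^ j" "\<And>j. J (r j) \<le> (1/4) ^ j" by blast
  have iD: "integrable lborel (\<lambda>z. (cmod (V k z - V j z))\<^sup>2)" for k j
    unfolding Vd by (rule integrable_continuous_bounded_support[of _ R]) (auto intro!: continuous_intros cv simp: vR)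
  have iJ: "integrable lborel (\<lambda>z. indicator S z * (C - (cmod (V k z))\<^sup>2)\<^sup>2)" for k
  proof (rule integrable_bounded_support[of _ R "C\<^sup>2"])
    have "(\<lambda>z. (C - (cmod (V k z))\<^sup>2)\<^sup>2) \<in> borel_measurable borel"
      by (intro borel_measurable_continuous_onI continuous_intros cV)
    then show "(\<lambda>z. indicator S z * (C - (cmod (V k z))\<^sup>2)\<^sup>2) \<in> borel_measurable borel"
      using S(1) by (intro borel_measurable_times borel_measurable_indicator) auto
    show "indicator S z * (C - (cmod (V k z))\<^sup>2)\<^sup>2 = 0" if "norm z > R" for z using outR[OF that] by simp
    have "(C - (cmod (V k z))\<^sup>2)\<^sup>2 \<le> C\<^sup>2" for z using V2[of k z] by (intro power_mono) auto
    then show "norm (indicator S z * (C - (cmod (V k z))\<^sup>2)\<^sup>2) \<le> C\<^sup>2" for z by (auto simp: indicator_def)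
  qed
  have half: "(2::real) ^ j * (1 / 4) ^ j = (1/2) ^ j" for j
  proof -
    have "(2::real) ^ j * (1 / 4) ^ j = (2 * (1 / 4)) ^ j" by (rule power_mult_distrib[symmetric])
    then show ?thesis by simp
  qed
  have sum_half: "summable (\<lambda>j. (1/2::real) ^ j)" by (rule summable_geometric) simp
  have AE1: "AE z in lborel. (\<lambda>j. 2 ^ j * (cmod (V (r (Suc j)) z - V (r j) z))\<^sup>2) \<longlonglongrightarrow> 0"
  proof (rule AE_tendsto_0_of_summable_integral[OF _ _ _ sum_half])
    show "integrable lborel (\<lambda>z. 2 ^ j * (cmod (V (r (Suc j)) z - V (r j) z))\<^sup>2)" for j using iD by simp
    fix j
    have "r j \<le> r (Suc j)" using r(1) by (simp add: strict_mono_less_eq)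
    then have "D (r (Suc j)) (r j) \<le> (1/4) ^ j" using Db[of "r j" "r (Suc j)"] r(2)[of j] l(2)[of "r (Suc j)"] by linarith
    then have "2 ^ j * D (r (Suc j)) (r j) \<le> 2 ^ j * (1/4) ^ j" by (intro mult_left_mono) auto
    then show "(LINT z|lborel. 2 ^ j * (cmod (V (r (Suc j)) z - V (r j) z))\<^sup>2) \<le> (1/2) ^ j"
      unfolding half De by simp
  qed simp
  have AE2: "AE z in lborel. (\<lambda>j. indicator S z * (C - (cmod (V (r j) z))\<^sup>2)\<^sup>2) \<longlonglongrightarrow> 0"
  proof (rule AE_tendsto_0_of_summable_integral[OF iJ _ _ sum_half])
    fix j
    have "(1/4::real) ^ j \<le> (1/2) ^ j" by (intro power_mono) auto
    then show "(LINT z|lborel. indicator S z * (C - (cmod (V (r j) z))\<^sup>2)\<^sup>2) \<le> (1/2) ^ j"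
      using r(3)[of j] unfolding J_def by linarith
  qed simp
  show thesis
  proof (rule that[of "\<lambda>j. V (r j)" "\<lambda>j. Z (r j)"])
    show "subsolution S C V0 Z0 (V (r k)) (Z (r k))" for k by (rule sub)
    show "\<bar>LINT z|lborel. (V (r k) z - V0) \<bullet> g z\<bar> \<le> \<epsilon>" if g: "g \<in> G" for k g
    proof -
      have "\<bar>ip (v n) g\<bar> \<le> (\<Sum>i<n. eps i)" for n
      proof (induction n)
        case 0
        then show ?case by (simp add: ip_def v_def V0)
      next
        case (Suc n)
        have "\<bar>ip (v (Suc n)) g - ip (v n) g\<bar> \<le> eps n"
          using VG[OF g, of n] ipd[OF G(2)[OF g], of "Suc n" n] unfolding ip_def Vd eps_def by simp
        then show ?case using Suc by simp
      qed
      then show ?thesis using se_le order_trans unfolding ip_def v_def by blast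
    qed
    show "AE z in lborel. convergent (\<lambda>k. V (r k) z)"
      using AE1
    proof (rule AE_mp, intro AE_I2 impI)
      fix z assume "(\<lambda>j. 2 ^ j * (cmod (V (r (Suc j)) z - V (r j) z))\<^sup>2) \<longlonglongrightarrow> 0"
      then have "\<forall>\<^sub>F j in sequentially. 2 ^ j * (cmod (V (r (Suc j)) z - V (r j) z))\<^sup>2 < 1"
        by (rule order_tendstoD) simp
      then obtain N where N: "\<And>j. j \<ge> N \<Longrightarrow> 2 ^ j * (cmod (V (r (Suc j)) z - V (r j) z))\<^sup>2 < 1"
        unfolding eventually_sequentially by blast
      have "summable (\<lambda>j. V (r (Suc j)) z - V (r j) z)"
      proof (rule summable_comparison_test)
        show "summable (\<lambda>j. sqrt (1/2) ^ j)" by (rule summable_geometric) (simp add: real_sqrt_lt_1_iff)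
        have "norm (V (r (Suc j)) z - V (r j) z) \<le> sqrt (1/2) ^ j" if "j \<ge> N" for j
        proof -
          have "(cmod (V (r (Suc j)) z - V (r j) z))\<^sup>2 \<le> (1/2) ^ j"
            using N[OF that] by (simp add: power_divide field_simps)
          then have "cmod (V (r (Suc j)) z - V (r j) z) \<le> sqrt ((1/2) ^ j)" by (rule real_le_rsqrt)
          then show ?thesis by (simp add: real_sqrt_power)
        qed
        then show "\<exists>N. \<forall>n\<ge>N. norm (V (r (Suc n)) z - V (r n) z) \<le> sqrt (1/2) ^ n" by blast
      qed
      then have "convergent (\<lambda>n. \<Sum>j<n. V (r (Suc j)) z - V (r j) z)" by (simp add: summable_iff_convergent)
      moreover have "(\<Sum>j<n. V (r (Suc j)) z - V (r j) z) = V (r n) z - V (r 0) z" for n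
        by (rule sum_lessThan_telescope[of "\<lambda>j. V (r j) z"])
      ultimately have "convergent (\<lambda>n. (V (r n) z - V (r 0) z) + V (r 0) z)"
        by (intro convergent_add convergent_const) simp
      then show "convergent (\<lambda>k. V (r k) z)" by simp
    qed
    show "AE z in lborel. z \<in> S \<longrightarrow> (\<lambda>k. C - (cmod (V (r k) z))\<^sup>2) \<longlonglongrightarrow> 0"
      using AE2
    proof (rule AE_mp, intro AE_I2 impI)
      fix z assume "(\<lambda>j. indicator S z * (C - (cmod (V (r j) z))\<^sup>2)\<^sup>2) \<longlonglongrightarrow> 0" "z \<in> S"
      then have "(\<lambda>j. sqrt ((C - (cmod (V (r j) z))\<^sup>2)\<^sup>2)) \<longlonglongrightarrow> sqrt 0" by (intro tendsto_intros) simp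
      then show "(\<lambda>k. C - (cmod (V (r k) z))\<^sup>2) \<longlonglongrightarrow> 0" by (simp add: tendsto_rabs_zero_iff)
    qed
  qed
qed

text \<open>The strict inequality reads \<open>|V\<^sup>2 - Z| < C - |V|^2\<close> for every
  iterate. Once the right side tends to zero, \<open>Z\<close> converges to the square of the limit
  without any separate control. The last conclusion makes \<open>v\<close> detectable by a
  continuous field, which is what tells solutions apart later.\<close>

lemma convex_integration:
  fixes G :: "(spacetime \<Rightarrow> complex) set"
  assumes S: "open S" "bounded S" and e0: "subsol_energy V0 Z0 < C"
    and G: "finite G" "\<And>g. g \<in> G \<Longrightarrow> continuous_on UNIV g" and \<epsilon>: "\<epsilon> > 0"
  obtains v w :: "spacetime \<Rightarrow> complex" where
    "bounded_borel v" "bounded_borel w" "\<And>z. z \<notin> S \<Longrightarrow> v z = 0 \<and> w z = 0" "lin_euler v w"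
    "\<And>z. cmod (V0 + v z) \<le> sqrt C" "\<And>z. cmod (Z0 + w z) \<le> 2 * C"
    "AE z in lborel. z \<in> S \<longrightarrow> (cmod (V0 + v z))\<^sup>2 = C \<and> Z0 + w z = (V0 + v z)\<^sup>2"
    "\<And>g. g \<in> G \<Longrightarrow> \<bar>LINT z|lborel. v z \<bullet> g z\<bar> \<le> \<epsilon>"
    "S \<noteq> {} \<Longrightarrow> \<exists>g. continuous_on UNIV g \<and> (LINT z|lborel. v z \<bullet> g z) \<noteq> 0"
proof -
  obtain V Z :: "nat \<Rightarrow> spacetime \<Rightarrow> complex" where sub: "\<And>k. subsolution S C V0 Z0 (V k) (Z k)"
    and VG: "\<And>k g. g \<in> G \<Longrightarrow> \<bar>LINT z|lborel. (V k z - V0) \<bullet> g z\<bar> \<le> \<epsilon>"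
    and AE1: "AE z in lborel. convergent (\<lambda>k. V k z)"
    and AE2: "AE z in lborel. z \<in> S \<longrightarrow> (\<lambda>k. C - (cmod (V k z))\<^sup>2) \<longlonglongrightarrow> 0"
    by (rule subsolution_limit[OF S e0 G \<epsilon>]) (assumption | (rule that; assumption))+
  have cV: "continuous_on UNIV (V k)" and cZ: "continuous_on UNIV (Z k)" for k using sub[of k] by (simp_all add: subsolution_def)
  have Vm: "V k \<in> borel_measurable borel" and Zm: "Z k \<in> borel_measurable borel" for k
    using cV cZ by (simp_all add: borel_measurable_continuous_onI)
  have Vout: "V k z = V0" "Z k z = Z0" if "z \<notin> S" for k z using sub[of k] that unfolding subsolution_def by blast+
  have en: "subsol_energy (V k z) (Z k z) < C" for k z using sub[of k] unfolding subsolution_def by blast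
  have V2: "(cmod (V k z))\<^sup>2 < C" for k z
    using en[of k z] norm_ge_zero[of "(V k z)\<^sup>2 - Z k z"] unfolding subsol_energy_def by linarith
  have C: "C > 0" using order_le_less_trans[OF zero_le_power2 V2] .
  have Vle: "cmod (V k z) \<le> sqrt C" for k z using V2[of k z] by (intro real_le_rsqrt) simp
  have Zle: "cmod (Z k z) \<le> 2 * C" for k z
  proof -
    have "cmod (Z k z) \<le> cmod ((V k z)\<^sup>2) + cmod ((V k z)\<^sup>2 - Z k z)"
      using norm_triangle_ineq4[of "(V k z)\<^sup>2" "(V k z)\<^sup>2 - Z k z"] by simp
    also have "\<dots> = subsol_energy (V k z) (Z k z)" by (simp add: subsol_energy_def norm_power)
    finally show ?thesis using en[of k z] C by simp
  qed
  have e0': "(cmod V0)\<^sup>2 < C" "cmod Z0 \<le> 2 * C"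
  proof -
    show "(cmod V0)\<^sup>2 < C" using e0 norm_ge_zero[of "V0\<^sup>2 - Z0"] unfolding subsol_energy_def by linarith
    have "cmod Z0 \<le> cmod (V0\<^sup>2) + cmod (V0\<^sup>2 - Z0)"
      using norm_triangle_ineq4[of "V0\<^sup>2" "V0\<^sup>2 - Z0"] by simp
    also have "\<dots> = subsol_energy V0 Z0" by (simp add: subsol_energy_def norm_power)
    finally show "cmod Z0 \<le> 2 * C" using e0 C by simp
  qed
  have V0C: "cmod V0 \<le> sqrt C" using e0'(1) by (intro real_le_rsqrt) simp
  obtain R where R: "\<And>z. z \<in> S \<Longrightarrow> norm z \<le> R" using S(2) unfolding bounded_iff by blast
  have outR: "z \<notin> S" if "norm z > R" for z using R[of z] that by auto
  define U where "U z = lim (\<lambda>k. V k z)" for z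
  have Um: "U \<in> borel_measurable borel" unfolding U_def[abs_def] by (rule borel_measurable_lim_metric[OF Vm])
  \<comment> \<open>Where the iterates diverge, \<open>lim\<close> is arbitrary; the guard secures
    the bound \<open>sqrt C\<close> at every point. Defining \<open>w\<close> through
    \<open>v\<close> makes the quadratic relation hold on all of \<open>S\<close>, and only the
    value of the modulus is left to hold almost everywhere.\<close>
  define v where "v z = (if z \<in> S \<and> cmod (U z) \<le> sqrt C then U z - V0 else 0)" for z
  define w where "w z = (if z \<in> S then (V0 + v z)\<^sup>2 - Z0 else 0)" for z
  have Sm: "{z. z \<in> S} \<in> sets borel" using S(1) by simp
  have vm: "v \<in> borel_measurable borel"
  proof -
    have "{z. z \<in> S \<and> cmod (U z) \<le> sqrt C} \<in> sets borel"
    proof -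
      have "{z \<in> space borel. cmod (U z) \<le> sqrt C} \<in> sets borel" using Um by measurable
      then have "S \<inter> {z. cmod (U z) \<le> sqrt C} \<in> sets borel" using S(1) by (intro sets.Int) auto
      then show ?thesis by (simp add: Collect_conj_eq)
    qed
    then show ?thesis unfolding v_def[abs_def] using Um by (intro measurable_If) auto
  qed
  have wm: "w \<in> borel_measurable borel"
    unfolding w_def[abs_def] using Sm vm by (intro measurable_If borel_measurable_diff borel_measurable_power borel_measurable_add) auto
  have b1: "cmod (V0 + v z) \<le> sqrt C" for z using V0C by (simp add: v_def)
  have b2: "cmod (Z0 + w z) \<le> 2 * C" for z
  proof (cases "z \<in> S")
    case True
    have "(cmod (V0 + v z))\<^sup>2 \<le> (sqrt C)\<^sup>2" using b1 by (intro power_mono) auto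
    then show ?thesis using True C by (simp add: w_def norm_power)
  qed (use e0' in \<open>simp add: w_def\<close>)
  have conv: "AE z in lborel. (\<lambda>k. V k z - V0) \<longlonglongrightarrow> v z \<and> (\<lambda>k. Z k z - Z0) \<longlonglongrightarrow> w z \<and>
     (z \<in> S \<longrightarrow> (cmod (V0 + v z))\<^sup>2 = C)"
    using AE1 AE2
  proof eventually_elim
    case (elim z)
    show ?case
    proof (cases "z \<in> S")
      case False
      then show ?thesis by (simp add: Vout v_def w_def)
    next
      case True
      have lU: "(\<lambda>k. V k z) \<longlonglongrightarrow> U z" using elim(1) by (simp add: U_def convergent_LIMSEQ_iff)
      have "cmod (U z) \<le> sqrt C"
        by (rule LIMSEQ_le_const2[OF tendsto_norm[OF lU]]) (use Vle in auto)
      then have vU: "V0 + v z = U z" using True by (simp add: v_def)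
      have l0: "(\<lambda>k. C - (cmod (V k z))\<^sup>2) \<longlonglongrightarrow> 0" using elim(2) True by simp
      moreover have "(\<lambda>k. C - (cmod (V k z))\<^sup>2) \<longlonglongrightarrow> C - (cmod (U z))\<^sup>2" by (intro tendsto_intros lU)
      ultimately have UC: "C - (cmod (U z))\<^sup>2 = 0" using LIMSEQ_unique by blast
      have "(\<lambda>k. (V k z)\<^sup>2 - Z k z) \<longlonglongrightarrow> 0"
      proof (rule Lim_null_comparison[OF always_eventually l0], rule allI)
        show "cmod ((V k z)\<^sup>2 - Z k z) \<le> C - (cmod (V k z))\<^sup>2" for k
          using en[of k z] unfolding subsol_energy_def by linarith
      qed
      then have "(\<lambda>k. (V k z)\<^sup>2 - ((V k z)\<^sup>2 - Z k z)) \<longlonglongrightarrow> (U z)\<^sup>2 - 0" by (intro tendsto_intros lU)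
      then have lZ: "(\<lambda>k. Z k z) \<longlonglongrightarrow> (U z)\<^sup>2" by simp
      have "(\<lambda>k. V k z - V0) \<longlonglongrightarrow> U z - V0" "(\<lambda>k. Z k z - Z0) \<longlonglongrightarrow> (U z)\<^sup>2 - Z0" by (intro tendsto_intros lU lZ)+
      moreover have "v z = U z - V0" using vU by (simp add: algebra_simps)
      ultimately show ?thesis using True UC vU by (simp add: w_def)
    qed
  qed
  have lv: "(\<lambda>k. LINT z|lborel. (V k z - V0) \<bullet> g z) \<longlonglongrightarrow> (LINT z|lborel. v z \<bullet> g z)" if g: "continuous_on UNIV g" for g
  proof -
    have "compact (g ` cball 0 R)" by (intro compact_continuous_image continuous_on_subset[OF g]) auto
    then have "bounded (g ` cball 0 R)" by (rule compact_imp_bounded)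
    then obtain M where M: "\<forall>y\<in>g ` cball 0 R. norm y \<le> M" unfolding bounded_iff by blast
    have gm: "g \<in> borel_measurable borel" using g by (rule borel_measurable_continuous_onI)
    show ?thesis
    proof (rule dominated_convergence_bounded_support[where R = R and K = "2 * sqrt C * \<bar>M\<bar>"])
      show "(\<lambda>z. v z \<bullet> g z) \<in> borel_measurable borel" using vm gm by (intro borel_measurable_inner)
      show "(\<lambda>z. (V k z - V0) \<bullet> g z) \<in> borel_measurable borel" for k
        using Vm gm by (intro borel_measurable_inner borel_measurable_diff) auto
      show "AE z in lborel. (\<lambda>k. (V k z - V0) \<bullet> g z) \<longlonglongrightarrow> v z \<bullet> g z"
        using conv by eventually_elim (intro tendsto_intros, simp)
      show "(V k z - V0) \<bullet> g z = 0" if "norm z > R" for k z using Vout(1)[OF outR[OF that]] by simp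
      show "norm ((V k z - V0) \<bullet> g z) \<le> 2 * sqrt C * \<bar>M\<bar>" for k z
      proof (cases "norm z > R")
        case True
        then show ?thesis using Vout(1)[OF outR[OF True]] C by simp
      next
        case False
        then have "norm (g z) \<le> M" using M by auto
        then have "norm (g z) \<le> \<bar>M\<bar>" by linarith
        moreover have "cmod (V k z - V0) \<le> 2 * sqrt C" using norm_triangle_ineq4[of "V k z" V0] Vle[of k z] V0C by simp
        ultimately have "cmod (V k z - V0) * norm (g z) \<le> 2 * sqrt C * \<bar>M\<bar>" by (intro mult_mono) (use C in auto)
        then show ?thesis using Cauchy_Schwarz_ineq2[of "V k z - V0" "g z"] by simp
      qed
    qed
  qed
  show thesis
  proof (rule that[of v w])
    have vb: "cmod (v z) \<le> 2 * sqrt C" for z using norm_triangle_ineq4[of "V0 + v z" V0] b1[of z] V0C by simp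
    have wb: "cmod (w z) \<le> 4 * C" for z using norm_triangle_ineq4[of "Z0 + w z" Z0] b2[of z] e0' by simp
    show "bounded_borel v" "bounded_borel w" using vm wm vb wb unfolding bounded_borel_def by blast+
    show "v z = 0 \<and> w z = 0" if "z \<notin> S" for z using that by (simp add: v_def w_def)
    show "lin_euler v w"
    proof (rule lin_euler_limit[where B = "2 * sqrt C + 4 * C" and V = "\<lambda>k z. V k z - V0" and Z = "\<lambda>k z. Z k z - Z0"])
      show "lin_euler (\<lambda>z. V k z - V0) (\<lambda>z. Z k z - Z0)" for k using sub[of k] by (simp add: subsolution_def)
      show "cmod (V k z - V0) \<le> 2 * sqrt C + 4 * C" for k z
        using norm_triangle_ineq4[of "V k z" V0] Vle[of k z] V0C C by simp
      have "sqrt C > 0" using C by simp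
      then show "cmod (Z k z - Z0) \<le> 2 * sqrt C + 4 * C" for k z
        using norm_triangle_ineq4[of "Z k z" Z0] Zle[of k z] e0'(2) by linarith
      show "AE z in lborel. (\<lambda>k. V k z - V0) \<longlonglongrightarrow> v z" "AE z in lborel. (\<lambda>k. Z k z - Z0) \<longlonglongrightarrow> w z"
        using conv by (eventually_elim, blast)+
    qed (use Vm Zm vm wm in \<open>auto intro!: borel_measurable_diff\<close>)
    show "cmod (V0 + v z) \<le> sqrt C" "cmod (Z0 + w z) \<le> 2 * C" for z by (rule b1, rule b2)
    show "AE z in lborel. z \<in> S \<longrightarrow> (cmod (V0 + v z))\<^sup>2 = C \<and> Z0 + w z = (V0 + v z)\<^sup>2"
      using conv by eventually_elim (simp add: w_def)
    show "\<bar>LINT z|lborel. v z \<bullet> g z\<bar> \<le> \<epsilon>" if "g \<in> G" for g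
      by (rule LIMSEQ_le_const2[OF tendsto_rabs[OF lv[OF G(2)[OF that]]]]) (use VG[OF that] in auto)
    show "\<exists>g. continuous_on UNIV g \<and> (LINT z|lborel. v z \<bullet> g z) \<noteq> 0" if "S \<noteq> {}"
    proof (rule ccontr)
      assume "\<not> ?thesis"
      then have z: "(LINT z|lborel. v z \<bullet> g z) = 0" if "continuous_on UNIV g" for g using that by blast
      \<comment> \<open>The continuous fields \<open>V k - V0\<close> converge to \<open>v\<close>
        itself. If all of them were orthogonal to \<open>v\<close>, then \<open>v\<close> would
        vanish almost everywhere; but on \<open>S\<close> this contradicts
        \<open>|V0|^2 < C = |V0 + v|^2\<close>.\<close>
      have "(\<lambda>k. LINT z|lborel. v z \<bullet> (V k z - V0)) \<longlonglongrightarrow> (LINT z|lborel. v z \<bullet> v z)"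
      proof (rule dominated_convergence_bounded_support[where R = R and K = "2 * sqrt C * (2 * sqrt C)"])
        show "(\<lambda>z. v z \<bullet> v z) \<in> borel_measurable borel" using vm by (intro borel_measurable_inner)
        show "(\<lambda>z. v z \<bullet> (V k z - V0)) \<in> borel_measurable borel" for k
          using Vm vm by (intro borel_measurable_inner borel_measurable_diff) auto
        show "AE z in lborel. (\<lambda>k. v z \<bullet> (V k z - V0)) \<longlonglongrightarrow> v z \<bullet> v z"
          using conv by eventually_elim (intro tendsto_intros, simp)
        show "v z \<bullet> (V k z - V0) = 0" if "norm z > R" for k z using Vout(1)[OF outR[OF that]] by simp
        show "norm (v z \<bullet> (V k z - V0)) \<le> 2 * sqrt C * (2 * sqrt C)" for k z
        proof -
          have "cmod (V k z - V0) \<le> 2 * sqrt C" using norm_triangle_ineq4[of "V k z" V0] Vle[of k z] V0C by simp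
          then have "cmod (v z) * cmod (V k z - V0) \<le> 2 * sqrt C * (2 * sqrt C)" using vb[of z] by (intro mult_mono) (use C in auto)
          then show ?thesis using Cauchy_Schwarz_ineq2[of "v z" "V k z - V0"] by simp
        qed
      qed
      moreover have "(LINT z|lborel. v z \<bullet> (V k z - V0)) = 0" for k by (rule z) (intro continuous_intros cV)
      ultimately have "(LINT z|lborel. v z \<bullet> v z) = 0" by (simp add: LIMSEQ_const_iff)
      moreover have "integrable lborel (\<lambda>z. v z \<bullet> v z)"
      proof (rule integrable_bounded_support[of _ R "(2 * sqrt C)\<^sup>2"])
        show "(\<lambda>z. v z \<bullet> v z) \<in> borel_measurable borel" using vm by (intro borel_measurable_inner)
        show "v z \<bullet> v z = 0" if "norm z > R" for z using outR[OF that] by (simp add: v_def)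
        show "norm (v z \<bullet> v z) \<le> (2 * sqrt C)\<^sup>2" for z
          using power_mono[OF vb[of z], of 2] by (simp add: power2_norm_eq_inner)
      qed
      ultimately have "AE z in lborel. v z \<bullet> v z = 0" by (subst (asm) integral_nonneg_eq_0_iff_AE) auto
      then have "AE z in lborel. z \<notin> S" using conv
        by eventually_elim (use e0'(1) in auto)
      then have "S \<in> null_sets lborel" using AE_iff_null_sets[of S lborel] S(1) by simp
      then have "negligible S" by (simp add: negligible_iff_null_sets null_sets_completionI)
      then show False using open_not_negligible[OF S(1) \<open>S \<noteq> {}\<close>] by blast
    qed
  qed
qed

section \<open>Infinitely many exact solutions on an unbounded open set\<close>

definition wild :: "spacetime set \<Rightarrow> real \<Rightarrow> complex \<Rightarrow> complex \<Rightarrow> (spacetime \<Rightarrow> complex) \<Rightarrow> (spacetime \<Rightarrow> complex) \<Rightarrow> bool" where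
  "wild S C V0 Z0 v w \<longleftrightarrow> v \<in> borel_measurable borel \<and> w \<in> borel_measurable borel \<and>
     (\<forall>z. cmod (V0 + v z) \<le> sqrt C \<and> cmod (Z0 + w z) \<le> 2 * C) \<and>
     (\<forall>z. z \<notin> S \<longrightarrow> v z = 0 \<and> w z = 0) \<and> lin_euler v w \<and>
     (AE z in lborel. z \<in> S \<longrightarrow> (cmod (V0 + v z))\<^sup>2 = C \<and> Z0 + w z = (V0 + v z)\<^sup>2)"

lemma wildD:
  assumes "wild S C V0 Z0 v w"
  shows "v \<in> borel_measurable borel" "w \<in> borel_measurable borel" "cmod (V0 + v z) \<le> sqrt C" "cmod (Z0 + w z) \<le> 2 * C"
    "z \<notin> S \<Longrightarrow> v z = 0" "z \<notin> S \<Longrightarrow> w z = 0" "lin_euler v w"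
    "AE z in lborel. z \<in> S \<longrightarrow> (cmod (V0 + v z))\<^sup>2 = C \<and> Z0 + w z = (V0 + v z)\<^sup>2"
    "cmod (v z) \<le> sqrt C + cmod V0" "cmod (w z) \<le> 2 * C + cmod Z0" "bounded_borel v" "bounded_borel w"
proof -
  note w = assms[unfolded wild_def]
  show "v \<in> borel_measurable borel" "w \<in> borel_measurable borel" "lin_euler v w"
    "AE z in lborel. z \<in> S \<longrightarrow> (cmod (V0 + v z))\<^sup>2 = C \<and> Z0 + w z = (V0 + v z)\<^sup>2" using w by blast+
  show *: "cmod (V0 + v z) \<le> sqrt C" "cmod (Z0 + w z) \<le> 2 * C" for z using w by blast+
  show "z \<notin> S \<Longrightarrow> v z = 0" "z \<notin> S \<Longrightarrow> w z = 0" using w by blast+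
  show b: "cmod (v z) \<le> sqrt C + cmod V0" "cmod (w z) \<le> 2 * C + cmod Z0" for z
    using norm_triangle_ineq4[of "V0 + v z" V0] norm_triangle_ineq4[of "Z0 + w z" Z0] *[of z] by simp_all
  show "bounded_borel v" "bounded_borel w" using w b unfolding bounded_borel_def by blast+
qed

text \<open>Each new solution is almost orthogonal to test fields \<open>g\<close> that detect the earlier ones.\<close>

lemma distinct_wild_bounded:
  assumes S: "open S" "bounded S" "S \<noteq> {}" and e0: "subsol_energy V0 Z0 < C"
  obtains v w :: "nat \<Rightarrow> spacetime \<Rightarrow> complex" where "\<And>i. wild S C V0 Z0 (v i) (w i)"
    "\<And>i j. i \<noteq> j \<Longrightarrow> \<not> (AE z in lborel. v i z = v j z)"
proof -
  define ok where "ok x \<longleftrightarrow> (case x of (v, w, g, H) \<Rightarrow> wild S C V0 Z0 v w \<and> finite H \<and> (\<forall>h\<in>H. continuous_on UNIV h) \<and> g \<in> H \<and>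
     (LINT z|lborel. v z \<bullet> g z) = 1)"
    for x :: "(spacetime \<Rightarrow> complex) \<times> (spacetime \<Rightarrow> complex) \<times> (spacetime \<Rightarrow> complex) \<times> (spacetime \<Rightarrow> complex) set"
  define nx where "nx x x' \<longleftrightarrow> (case x of (v, w, g, H) \<Rightarrow> case x' of (v', w', g', H') \<Rightarrow> H \<subseteq> H' \<and> (\<forall>h\<in>H. \<bar>LINT z|lborel. v' z \<bullet> h z\<bar> \<le> 1 / 2))"
    for x x' :: "(spacetime \<Rightarrow> complex) \<times> (spacetime \<Rightarrow> complex) \<times> (spacetime \<Rightarrow> complex) \<times> (spacetime \<Rightarrow> complex) set"
  have ex: "\<exists>v w g. ok (v, w, g, insert g H) \<and> (\<forall>h\<in>H. \<bar>LINT z|lborel. v z \<bullet> h z\<bar> \<le> 1 / 2)"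
    if H: "finite H" "\<And>h. h \<in> H \<Longrightarrow> continuous_on UNIV h" for H
  proof -
    obtain v w :: "spacetime \<Rightarrow> complex" where vw:
      "bounded_borel v" "bounded_borel w" "\<And>z. z \<notin> S \<Longrightarrow> v z = 0 \<and> w z = 0" "lin_euler v w"
      "\<And>z. cmod (V0 + v z) \<le> sqrt C" "\<And>z. cmod (Z0 + w z) \<le> 2 * C"
      "AE z in lborel. z \<in> S \<longrightarrow> (cmod (V0 + v z))\<^sup>2 = C \<and> Z0 + w z = (V0 + v z)\<^sup>2"
      "\<And>g. g \<in> H \<Longrightarrow> \<bar>LINT z|lborel. v z \<bullet> g z\<bar> \<le> 1 / 2"
      "S \<noteq> {} \<Longrightarrow> \<exists>g. continuous_on UNIV g \<and> (LINT z|lborel. v z \<bullet> g z) \<noteq> 0"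
      by (rule convex_integration[OF S(1,2) e0 H, of "1/2"]) (simp | assumption | (rule that; assumption))+
    obtain g where g: "continuous_on UNIV g" "(LINT z|lborel. v z \<bullet> g z) \<noteq> 0" using vw(9) S(3) by blast
    \<comment> \<open>Normalization to inner product 1: later solutions have inner product at most
      1/2 with the same field, so they differ from this one on a set of positive measure.\<close>
    define c where "c = (LINT z|lborel. v z \<bullet> g z)"
    define g' where "g' z = g z /\<^sub>R c" for z
    have "continuous_on UNIV g'" unfolding g'_def[abs_def] by (intro continuous_intros g)
    moreover have "(LINT z|lborel. v z \<bullet> g' z) = 1" using g(2) by (simp add: g'_def c_def)
    moreover have "wild S C V0 Z0 v w" using vw(1-7) unfolding wild_def bounded_borel_def by blast
    ultimately have "ok (v, w, g', insert g' H)" using H unfolding ok_def by simp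
    then show ?thesis using vw(8) by blast
  qed
  have "\<exists>f. \<forall>n. ok (f n) \<and> nx (f n) (f (Suc n))"
  proof (rule dependent_nat_choice)
    show "\<exists>x. ok x" using ex[of "{}"] by blast
    fix x assume x: "ok x"
    obtain v w g H where xe: "x = (v, w, g, H)" by (cases x)
    have H: "finite H" "\<And>h. h \<in> H \<Longrightarrow> continuous_on UNIV h" using x by (auto simp: ok_def xe)
    obtain v' w' g' where "ok (v', w', g', insert g' H)" "\<forall>h\<in>H. \<bar>LINT z|lborel. v' z \<bullet> h z\<bar> \<le> 1 / 2" using ex[OF H] by blast
    then have "ok (v', w', g', insert g' H) \<and> nx x (v', w', g', insert g' H)" unfolding nx_def xe by auto
    then show "\<exists>y. ok y \<and> nx x y" by blast
  qed
  then obtain f where f: "\<And>n. ok (f n)" "\<And>n. nx (f n) (f (Suc n))" by blast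
  define v w g H where "v n = fst (f n)" and "w n = fst (snd (f n))" and "g n = fst (snd (snd (f n)))" and "H n = snd (snd (snd (f n)))" for n
  have fn: "f n = (v n, w n, g n, H n)" for n by (simp add: v_def w_def g_def H_def)
  have o: "wild S C V0 Z0 (v n) (w n)" "g n \<in> H n" "(LINT z|lborel. v n z \<bullet> g n z) = 1" for n
    using f(1)[of n] unfolding fn ok_def by auto
  have q: "H n \<subseteq> H (Suc n)" "h \<in> H n \<Longrightarrow> \<bar>LINT z|lborel. v (Suc n) z \<bullet> h z\<bar> \<le> 1 / 2" for n h
    using f(2)[of n] unfolding fn nx_def by auto
  have mono: "i \<le> j \<Longrightarrow> H i \<subseteq> H j" for i j using q(1) by (rule lift_Suc_mono_le)
  have ne: "\<not> (AE z in lborel. v i z = v j z)" if "i < j" for i j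
  proof
    assume ae: "AE z in lborel. v i z = v j z"
    obtain k where k: "j = Suc k" "i \<le> k" using \<open>i < j\<close> by (cases j) auto
    have gi: "g i \<in> H k" using o(2)[of i] mono[OF k(2)] by blast
    have "continuous_on UNIV (g i)" using f(1)[of i] unfolding fn ok_def by auto
    then have gm: "g i \<in> borel_measurable borel" by (rule borel_measurable_continuous_onI)
    have "(LINT z|lborel. v i z \<bullet> g i z) = (LINT z|lborel. v j z \<bullet> g i z)"
    proof (rule integral_cong_AE)
      show "AE z in lborel. v i z \<bullet> g i z = v j z \<bullet> g i z" using ae by eventually_elim simp
    qed (use wildD(1)[OF o(1)] gm in \<open>auto intro!: borel_measurable_inner\<close>)
    then show False using q(2)[OF gi] o(3)[of i] k(1) by simp
  qed
  show thesis
  proof (rule that[of v w])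
    show "\<not> (AE z in lborel. v i z = v j z)" if "i \<noteq> j" for i j
      using ne[of i j] ne[of j i] that by (cases i j rule: linorder_cases) (auto simp: eq_commute)
  qed (rule o)
qed

lemma weakly_div_free_local:
  assumes "\<And>R. \<exists>m'. weakly_div_free m' \<and> (\<forall>z. norm z \<le> R \<longrightarrow> m' z = m z)"
  shows "weakly_div_free m"
  unfolding weakly_div_free_def
proof (intro allI impI)
  fix \<psi> assume \<psi>: "C1c \<psi>"
  obtain R where R: "\<And>z h. norm z > R \<Longrightarrow> D \<psi> z h = 0" using C1c_support[OF \<psi>] by metis
  obtain m' where m': "weakly_div_free m'" "\<And>z. norm z \<le> R \<Longrightarrow> m' z = m z" using assms[of R] by blast
  have "D \<psi> z (m z) = D \<psi> z (m' z)" for z using R[of z] m'(2)[of z] by (cases "norm z \<le> R") auto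
  then show "(LINT z|lborel. D \<psi> z (m z)) = 0" using m'(1) \<psi> by (simp add: weakly_div_free_def)
qed

lemma lin_euler_local:
  assumes "\<And>R. \<exists>v' w'. lin_euler v' w' \<and> (\<forall>z. norm z \<le> R \<longrightarrow> v' z = v z \<and> w' z = w z)"
  shows "lin_euler v w"
  unfolding lin_euler_def
proof (intro conjI weakly_div_free_local)
  fix R
  obtain v' w' where vw: "lin_euler v' w'" "\<And>z. norm z \<le> R \<Longrightarrow> v' z = v z \<and> w' z = w z" using assms[of R] by blast
  show "\<exists>m'. weakly_div_free m' \<and> (\<forall>z. norm z \<le> R \<longrightarrow> m' z = fld1 (v z) (w z))"
    using vw unfolding lin_euler_def by (intro exI[of _ "\<lambda>z. fld1 (v' z) (w' z)"]) auto
  show "\<exists>m'. weakly_div_free m' \<and> (\<forall>z. norm z \<le> R \<longrightarrow> m' z = fld2 (v z) (w z))"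
    using vw unfolding lin_euler_def by (intro exI[of _ "\<lambda>z. fld2 (v' z) (w' z)"]) auto
  show "\<exists>m'. weakly_div_free m' \<and> (\<forall>z. norm z \<le> R \<longrightarrow> m' z = fld3 (v z) (w z))"
    using vw unfolding lin_euler_def by (intro exI[of _ "\<lambda>z. fld3 (v' z) (w' z)"]) auto
qed

text \<open>The integer spheres around \<open>p\<close> cut \<open>P\<close> into bounded shells and
  are null sets. Inside any ball only finitely many shells contribute, and a test function sees only
  a bounded region, so the glued field solves the linear system because finite sums do.\<close>

lemma wild_glue:
  fixes p :: spacetime
  defines "shell \<equiv> \<lambda>P n. {z \<in> P. real n < norm (z - p) \<and> norm (z - p) < real (Suc n)}"
  assumes f: "\<And>n. wild (shell P n) C V0 Z0 (f n) (g n)"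
  shows "wild P C V0 Z0 (\<lambda>z. f (nat \<lfloor>norm (z - p)\<rfloor>) z) (\<lambda>z. g (nat \<lfloor>norm (z - p)\<rfloor>) z)"
proof -
  define N where "N z = nat \<lfloor>norm (z - p)\<rfloor>" for z
  have Nm: "N \<in> measurable borel (count_space UNIV)" unfolding N_def[abs_def] by measurable
  have shN: "n = N z" if "z \<in> shell P n" for n z
  proof -
    have "real n < norm (z - p)" "norm (z - p) < real (Suc n)" using that by (auto simp: shell_def)
    then have "\<lfloor>norm (z - p)\<rfloor> = int n" by (intro floor_unique) auto
    then show ?thesis by (simp add: N_def)
  qed
  have shP: "shell P n \<subseteq> P" for n by (auto simp: shell_def)
  have z0: "f n z = 0 \<and> g n z = 0" if "n \<noteq> N z" for n z
    using wildD(5,6)[OF f, of z n] shN[of z n] that by blast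
  show ?thesis unfolding wild_def N_def[symmetric]
  proof (intro conjI allI impI)
    show "(\<lambda>z. f (N z) z) \<in> borel_measurable borel" "(\<lambda>z. g (N z) z) \<in> borel_measurable borel"
      by (rule measurable_compose_countable[OF _ Nm], rule wildD[OF f])+
    show "cmod (V0 + f (N z) z) \<le> sqrt C" "cmod (Z0 + g (N z) z) \<le> 2 * C" for z by (rule wildD[OF f])+
    show "f (N z) z = 0" "g (N z) z = 0" if "z \<notin> P" for z using wildD(5,6)[OF f, of z "N z"] that shP by blast+
    show "lin_euler (\<lambda>z. f (N z) z) (\<lambda>z. g (N z) z)"
    proof (rule lin_euler_local)
      fix R :: real
      define M where "M = nat \<lceil>R + norm p\<rceil>"
      have s: "(\<Sum>n\<in>{..M}. f n z) = f (N z) z \<and> (\<Sum>n\<in>{..M}. g n z) = g (N z) z" if "norm z \<le> R" for z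
      proof -
        have "norm (z - p) \<le> R + norm p" using norm_triangle_ineq4[of z p] that by simp
        then have "\<lfloor>norm (z - p)\<rfloor> \<le> \<lceil>R + norm p\<rceil>" by linarith
        then have "N z \<le> M" by (simp add: N_def M_def nat_mono)
        then have "(\<Sum>n\<in>{..M}. h n) = h (N z) + (\<Sum>n\<in>{..M} - {N z}. h n)" for h :: "nat \<Rightarrow> complex"
          by (intro sum.remove) auto
        then show ?thesis using z0[of _ z] by (simp add: sum.neutral)
      qed
      have "lin_euler (\<lambda>z. \<Sum>n\<in>{..M}. f n z) (\<lambda>z. \<Sum>n\<in>{..M}. g n z)"
        using lin_euler_sum[of "{..M}" f g] wildD(7,11,12)[OF f] by simp
      then show "\<exists>v' w'. lin_euler v' w' \<and> (\<forall>z. norm z \<le> R \<longrightarrow> v' z = f (N z) z \<and> w' z = g (N z) z)"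
        using s by (intro exI[of _ "\<lambda>z. \<Sum>n\<in>{..M}. f n z"] exI[of _ "\<lambda>z. \<Sum>n\<in>{..M}. g n z"]) auto
    qed
    have A1: "AE z in lborel. \<forall>n. z \<in> shell P n \<longrightarrow> (cmod (V0 + f n z))\<^sup>2 = C \<and> Z0 + g n z = (V0 + f n z)\<^sup>2"
      unfolding AE_all_countable using wildD(8)[OF f] by blast
    have "AE z in lborel. z \<notin> sphere p (real n)" for n
    proof -
      have "sphere p (real n) \<in> null_sets lebesgue" using negligible_sphere by (simp add: negligible_iff_null_sets)
      moreover have "sphere p (real n) \<in> sets lborel" by simp
      ultimately have "sphere p (real n) \<in> null_sets lborel" by (simp add: null_sets_def)
      then show ?thesis by (rule AE_not_in)
    qed
    then have A2: "AE z in lborel. \<forall>n. z \<notin> sphere p (real n)" unfolding AE_all_countable by blast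
    show "AE z in lborel. z \<in> P \<longrightarrow> (cmod (V0 + f (N z) z))\<^sup>2 = C \<and> Z0 + g (N z) z = (V0 + f (N z) z)\<^sup>2"
      using A1 A2
    proof eventually_elim
      case (elim z)
      show ?case
      proof
        assume zP: "z \<in> P"
        have "real (N z) \<noteq> norm (z - p)"
        proof
          assume "real (N z) = norm (z - p)"
          then have "z \<in> sphere p (real (N z))" by (simp add: dist_norm norm_minus_commute)
          then show False using elim(2) by blast
        qed
        moreover have "real (N z) \<le> norm (z - p)" "norm (z - p) < real (Suc (N z))" 
          unfolding N_def using real_of_int_floor_add_one_gt[of "norm (z - p)"] by (simp_all add: of_nat_nat add.commute)
        ultimately have "z \<in> shell P (N z)" using zP by (simp add: shell_def)
        then show "(cmod (V0 + f (N z) z))\<^sup>2 = C \<and> Z0 + g (N z) z = (V0 + f (N z) z)\<^sup>2" using elim(1) by blast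
      qed
    qed
  qed
qed

text \<open>Only the innermost shell carries a varying solution; the other shells keep one fixed
  choice. Centring the shells at a point of \<open>P\<close> makes the innermost one
  nonempty.\<close>

lemma infinitely_many_wild:
  assumes P: "open P" "P \<noteq> {}" and e0: "subsol_energy V0 Z0 < C"
  obtains v w :: "nat \<Rightarrow> spacetime \<Rightarrow> complex" where "\<And>i. wild P C V0 Z0 (v i) (w i)"
    "\<And>i j. i \<noteq> j \<Longrightarrow> \<not> (AE z in lborel. v i z = v j z)"
proof -
  obtain p where p: "p \<in> P" using P(2) by blast
  define shell where "shell n = {z \<in> P. real n < norm (z - p) \<and> norm (z - p) < real (Suc n)}" for n
  have os: "open (shell n)" for n
  proof -
    have "shell n = P \<inter> {z. real n < norm (z - p)} \<inter> {z. norm (z - p) < real (Suc n)}" by (auto simp: shell_def)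
    then show ?thesis using P(1) by (auto intro!: open_Int open_Collect_less continuous_intros)
  qed
  have bs: "bounded (shell n)" for n
  proof (rule bounded_subset)
    show "bounded (ball p (real (Suc n)))" by simp
    show "shell n \<subseteq> ball p (real (Suc n))" by (auto simp: shell_def dist_norm norm_minus_commute)
  qed
  have ne: "shell 0 \<noteq> {}"
  proof -
    obtain e where e: "e > 0" "ball p e \<subseteq> P" using P(1) p openE by blast
    define s where "s = min e 1 / 2"
    have s: "s > 0" "s < e" "s < 1" using e by (auto simp: s_def)
    have "norm (s *\<^sub>R E3 :: spacetime) = s" using s by (simp add: norm_Pair)
    then have n: "norm (p + s *\<^sub>R E3 - p) = s" by simp
    then have "p + s *\<^sub>R E3 \<in> ball p e" using s by (simp only: mem_ball dist_norm norm_minus_commute[of p])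
    then have "p + s *\<^sub>R E3 \<in> P" using e(2) by blast
    then have "p + s *\<^sub>R E3 \<in> shell 0" unfolding shell_def mem_Collect_eq n using s by simp
    then show ?thesis by blast
  qed
  obtain v w :: "nat \<Rightarrow> spacetime \<Rightarrow> complex" where vw: "\<And>i. wild (shell 0) C V0 Z0 (v i) (w i)"
    "\<And>i j. i \<noteq> j \<Longrightarrow> \<not> (AE z in lborel. v i z = v j z)"
    by (rule distinct_wild_bounded[OF os bs ne e0]) (assumption | (rule that; assumption))+
  have "\<exists>f g. wild (shell n) C V0 Z0 f g" for n
  proof -
    obtain f g where "bounded_borel f" "bounded_borel g" "\<And>z. z \<notin> shell n \<Longrightarrow> f z = 0 \<and> g z = 0" "lin_euler f g"
      "\<And>z. cmod (V0 + f z) \<le> sqrt C" "\<And>z. cmod (Z0 + g z) \<le> 2 * C"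
      "AE z in lborel. z \<in> shell n \<longrightarrow> (cmod (V0 + f z))\<^sup>2 = C \<and> Z0 + g z = (V0 + f z)\<^sup>2"
      by (rule convex_integration[OF os[of n] bs[of n] e0, of "{}" 1]) (simp | assumption | (rule that; assumption))+
    then show ?thesis unfolding wild_def bounded_borel_def by blast
  qed
  then obtain f g where fg: "\<And>n. wild (shell n) C V0 Z0 (f n) (g n)" by metis
  define F G where "F i n = (if n = 0 then v i else f n)" and "G i n = (if n = 0 then w i else g n)" for i n :: nat
  have FG: "wild (shell n) C V0 Z0 (F i n) (G i n)" for i n using vw(1) fg by (auto simp: F_def G_def)
  show thesis
  proof (rule that[of "\<lambda>i z. F i (nat \<lfloor>norm (z - p)\<rfloor>) z" "\<lambda>i z. G i (nat \<lfloor>norm (z - p)\<rfloor>) z"])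
    show "wild P C V0 Z0 (\<lambda>z. F i (nat \<lfloor>norm (z - p)\<rfloor>) z) (\<lambda>z. G i (nat \<lfloor>norm (z - p)\<rfloor>) z)" for i
      by (rule wild_glue[of P p]) (use FG in \<open>simp add: shell_def\<close>)
    fix i j :: nat assume ij: "i \<noteq> j"
    show "\<not> (AE z in lborel. F i (nat \<lfloor>norm (z - p)\<rfloor>) z = F j (nat \<lfloor>norm (z - p)\<rfloor>) z)"
    proof
      assume "AE z in lborel. F i (nat \<lfloor>norm (z - p)\<rfloor>) z = F j (nat \<lfloor>norm (z - p)\<rfloor>) z"
      then have "AE z in lborel. v i z = v j z"
      proof eventually_elim
        case (elim z)
        show ?case
        proof (cases "z \<in> shell 0")
          case True
          then have "\<lfloor>norm (z - p)\<rfloor> = 0" by (intro floor_unique) (auto simp: shell_def)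
          then show ?thesis using elim by (simp add: F_def)
        next
          case False
          then show ?thesis using wildD(5)[OF vw(1)] by simp
        qed
      qed
      then show False using vw(2)[OF ij] by blast
    qed
  qed
qed

section \<open>Fan subsolutions near the two-shock solution\<close>

lemma pressure_strict_mono: "\<gamma> \<ge> 1 \<Longrightarrow> 0 < r \<Longrightarrow> r < s \<Longrightarrow> pressure \<gamma> r < pressure \<gamma> s"
  by (simp add: pressure_def powr_less_mono2)

text \<open>In terms of the specific volume \<open>1 / \<rho>\<close> the left side is the integral
  of the pressure, and the right side is its trapezoid approximation. The proof differentiates the
  difference in the upper density.\<close>

lemma hugoniot_strict:
  assumes \<gamma>: "\<gamma> \<ge> 1" and r: "0 < r0" "r0 < r"
  shows "internal_energy \<gamma> r - internal_energy \<gamma> r0 < (pressure \<gamma> r + pressure \<gamma> r0) / 2 * (1 / r0 - 1 / r)"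
proof -
  define H where "H x = (pressure \<gamma> x + pressure \<gamma> r0) / 2 * (1 / r0 - 1 / x) - internal_energy \<gamma> x" for x
  have dp: "(pressure \<gamma> has_real_derivative \<gamma> * x powr (\<gamma> - 1)) (at x)" if "x > 0" for x
    unfolding pressure_def[abs_def] using that by (rule has_real_derivative_powr)
  have dH: "(H has_real_derivative ((\<gamma> * x powr (\<gamma> - 1)) / 2 * (1 / r0 - 1 / x) + (1 / x\<^sup>2) * ((pressure \<gamma> x + pressure \<gamma> r0) / 2)
      - pressure \<gamma> x / x\<^sup>2)) (at x)" if "x > 0" for x
    unfolding H_def[abs_def]
  proof -
    have dt: "((\<lambda>x. 1 / r0 - 1 / x) has_real_derivative 1 / x\<^sup>2) (at x)"
      using that by (auto intro!: derivative_eq_intros simp: power2_eq_square)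
    show "((\<lambda>x. (pressure \<gamma> x + pressure \<gamma> r0) / 2 * (1 / r0 - 1 / x) - internal_energy \<gamma> x) has_real_derivative
       ((\<gamma> * x powr (\<gamma> - 1)) / 2 * (1 / r0 - 1 / x) + (1 / x\<^sup>2) * ((pressure \<gamma> x + pressure \<gamma> r0) / 2) - pressure \<gamma> x / x\<^sup>2)) (at x)"
      using DERIV_diff[OF DERIV_mult[OF DERIV_cdivide[OF DERIV_add[OF dp[OF that] DERIV_const[of "pressure \<gamma> r0"]], of 2] dt]
          pressure_eq_deriv_internal_energy[OF that, of \<gamma>]] by simp
  qed
  have "H r0 < H r"
  proof (rule DERIV_pos_imp_increasing_open[OF r(2)])
    fix x assume x: "r0 < x" "x < r"
    then have x0: "x > 0" using r by simp
    obtain \<xi> where \<xi>: "r0 < \<xi>" "\<xi> < x" "pressure \<gamma> x - pressure \<gamma> r0 = (x - r0) * (\<gamma> * \<xi> powr (\<gamma> - 1))"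
      using MVT2[of r0 x "pressure \<gamma>" "\<lambda>x. \<gamma> * x powr (\<gamma> - 1)"] x r dp by (metis less_le_trans)
    have "\<gamma> * \<xi> powr (\<gamma> - 1) \<le> \<gamma> * x powr (\<gamma> - 1)"
      using \<xi> r \<gamma> by (intro mult_left_mono powr_mono2) auto
    then have 1: "pressure \<gamma> x - pressure \<gamma> r0 \<le> (x - r0) * (\<gamma> * x powr (\<gamma> - 1))"
      unfolding \<xi>(3) by (rule mult_left_mono) (use x in simp)
    have g: "\<gamma> * x powr (\<gamma> - 1) > 0" using \<gamma> x0 by simp
    \<comment> \<open>Convexity of the pressure in the density gives only \<open>1\<close>, with
      equality for \<open>\<gamma> = 1\<close>. Strictness comes from the factor
      \<open>x / r0 > 1\<close>, which reflects strict convexity in the specific volume.\<close>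
    have "1 * ((x - r0) * (\<gamma> * x powr (\<gamma> - 1))) < (x / r0) * ((x - r0) * (\<gamma> * x powr (\<gamma> - 1)))"
      by (rule mult_strict_right_mono, use x r in simp, rule mult_pos_pos, use x in simp, rule g)
    then have 2: "(pressure \<gamma> x - pressure \<gamma> r0) < (x / r0) * ((x - r0) * (\<gamma> * x powr (\<gamma> - 1)))"
      using 1 by simp
    have eq: "((\<gamma> * x powr (\<gamma> - 1)) / 2 * (1 / r0 - 1 / x) + (1 / x\<^sup>2) * ((pressure \<gamma> x + pressure \<gamma> r0) / 2)
      - pressure \<gamma> x / x\<^sup>2) = ((x / r0) * ((x - r0) * (\<gamma> * x powr (\<gamma> - 1))) - (pressure \<gamma> x - pressure \<gamma> r0)) / (2 * x\<^sup>2)"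
      using x0 r by (simp add: field_simps power2_eq_square)
    have "((x / r0) * ((x - r0) * (\<gamma> * x powr (\<gamma> - 1))) - (pressure \<gamma> x - pressure \<gamma> r0)) / (2 * x\<^sup>2) > 0"
      using 2 x0 by simp
    then show "\<exists>y. (H has_real_derivative y) (at x) \<and> 0 < y" using dH[OF x0] unfolding eq by blast
  next
    show "continuous_on {r0..r} H"
      using dH r by (intro continuous_at_imp_continuous_on ballI DERIV_isCont) (auto intro: less_le_trans)
  qed
  moreover have "H r0 = - internal_energy \<gamma> r0" by (simp add: H_def)
  ultimately show ?thesis unfolding H_def[of r] by linarith
qed

context
  fixes \<gamma> :: real
begin

text \<open>Jumps from a state of density \<open>r0\<close> and normal velocity \<open>u\<close> to density \<open>r\<close> when the extra stress \<open>r \<delta>\<close>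
  acts as pressure in the momentum balance but not in the energy flux. Meaningful for \<open>0 < r0 < r\<close>.\<close>

definition eff_pressure :: "real \<Rightarrow> real \<Rightarrow> real" where
  "eff_pressure \<delta> r = pressure \<gamma> r + r * \<delta>"

definition vel_jump :: "real \<Rightarrow> real \<Rightarrow> real \<Rightarrow> real" where
  "vel_jump r0 \<delta> r = sqrt ((eff_pressure \<delta> r - pressure \<gamma> r0) * (1 / r0 - 1 / r))"

definition mass_flux :: "real \<Rightarrow> real \<Rightarrow> real \<Rightarrow> real" where
  "mass_flux r0 \<delta> r = sqrt ((eff_pressure \<delta> r - pressure \<gamma> r0) / (1 / r0 - 1 / r))"

text \<open>Net energy production at the jump, in the frame moving with it: mass flux times the jump
  of the specific energy, plus the jump of the work of the pressure. The summand
  \<open>\<delta>\<close> is the specific kinetic energy of the unresolved oscillations.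
  Admissibility asks for a nonpositive value.\<close>

definition energy_prod :: "real \<Rightarrow> real \<Rightarrow> real \<Rightarrow> real \<Rightarrow> real" where
  "energy_prod r0 u \<delta> r = mass_flux r0 \<delta> r * (internal_energy \<gamma> r + (u - vel_jump r0 \<delta> r)\<^sup>2 / 2 + \<delta> - internal_energy \<gamma> r0 - u\<^sup>2 / 2)
     + pressure \<gamma> r * (u - vel_jump r0 \<delta> r) - pressure \<gamma> r0 * u"

text \<open>These are the Rankine-Hugoniot relations for momentum and mass in the frame of the jump.
  \<open>S\<close> and \<open>m\<close> are their solution: the product and the quotient of the two
  jumps under a square root.\<close>

lemma jump_relations:
  assumes "0 < r0" "r0 < r" and P: "eff_pressure \<delta> r > pressure \<gamma> r0"
  defines "S \<equiv> vel_jump r0 \<delta> r" and "m \<equiv> mass_flux r0 \<delta> r"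
  shows "m > 0" "m * S = eff_pressure \<delta> r - pressure \<gamma> r0" "m * (1 / r0 - 1 / r) = S" "S > 0"
proof -
  let ?q = "eff_pressure \<delta> r - pressure \<gamma> r0" and ?t = "1 / r0 - 1 / r"
  have q: "?q > 0" using P by simp
  have t: "?t > 0" using assms(1,2) by (simp add: frac_less2)
  show "m > 0" "S > 0" using q t by (auto simp: m_def S_def mass_flux_def vel_jump_def)
  have "sqrt (q / t) * sqrt (q * t) = q \<and> sqrt (q / t) * t = sqrt (q * t)" if "q > 0" "t > 0" for q t :: real
  proof
    have "sqrt (q / t) * sqrt (q * t) = sqrt (q / t * (q * t))" by (rule real_sqrt_mult[symmetric])
    also have "q / t * (q * t) = q\<^sup>2" using that by (simp add: power2_eq_square)
    finally show "sqrt (q / t) * sqrt (q * t) = q" using that by simp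
    have "sqrt (q / t) * sqrt (t\<^sup>2) = sqrt (q / t * t\<^sup>2)" by (rule real_sqrt_mult[symmetric])
    also have "q / t * t\<^sup>2 = q * t" using that by (simp add: power2_eq_square)
    finally show "sqrt (q / t) * t = sqrt (q * t)" using that by simp
  qed
  from this[OF q t] show "m * S = ?q" "m * ?t = S"
    unfolding m_def S_def mass_flux_def vel_jump_def by blast+
qed

lemma energy_prod_isCont:
  assumes "0 < r0" "r0 < r"
  shows "isCont (\<lambda>x. energy_prod r0 u (snd x) (fst x)) (r, 0)"
proof -
  have "isCont (pressure \<gamma>) r" unfolding pressure_def[abs_def] using assms by (intro continuous_intros) auto
  then have p: "isCont (\<lambda>x::real \<times> real. pressure \<gamma> (fst x)) (r, 0)"
    by (intro isCont_o2[where f = fst and g = "pressure \<gamma>"] continuous_intros) auto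
  have "isCont (internal_energy \<gamma>) r" using DERIV_isCont[OF pressure_eq_deriv_internal_energy] assms by simp
  then have i: "isCont (\<lambda>x::real \<times> real. internal_energy \<gamma> (fst x)) (r, 0)"
    by (intro isCont_o2[where f = fst and g = "internal_energy \<gamma>"] continuous_intros) auto
  have "1 / r0 - 1 / r \<noteq> 0" "r \<noteq> 0" using assms by (auto simp: field_simps)
  then show ?thesis
    unfolding energy_prod_def mass_flux_def vel_jump_def eff_pressure_def
    by (intro continuous_intros p i) auto
qed

lemma isCont_eventually_less:
  fixes f :: "'b::t2_space \<Rightarrow> real"
  assumes "isCont f a" "f a < c"
  shows "\<forall>\<^sub>F x in nhds a. f x < c"
  using assms order_tendstoD(2)[of f "f a" "at a" c] by (auto simp: isCont_def eventually_nhds_conv_at)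

text \<open>By Galilean invariance \<open>u\<close> cancels. What remains is \<open>m\<close> times
  the defect of the trapezoid rule in \<open>hugoniot_strict\<close>.\<close>

lemma energy_prod_shock_neg:
  assumes \<gamma>: "\<gamma> \<ge> 1" and r: "0 < r0" "r0 < r"
  shows "energy_prod r0 u 0 r < 0"
proof -
  let ?p = "pressure \<gamma> r" and ?q = "pressure \<gamma> r0"
  have P: "eff_pressure 0 r > ?q" using pressure_strict_mono[OF \<gamma> r] by (simp add: eff_pressure_def)
  define S m where "S = vel_jump r0 0 r" and "m = mass_flux r0 0 r"
  note j = jump_relations[OF r P, folded S_def m_def]
  have e: "m * S = ?p - ?q" using j(2) unfolding eff_pressure_def by linarith
  have "energy_prod r0 u 0 r = m * (internal_energy \<gamma> r - internal_energy \<gamma> r0) + m * S * (S - 2 * u) / 2 + ?p * (u - S) - ?q * u"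
    by (simp add: energy_prod_def S_def m_def power2_eq_square algebra_simps diff_divide_distrib add_divide_distrib)
  also have "\<dots> = m * (internal_energy \<gamma> r - internal_energy \<gamma> r0) - (?p + ?q) / 2 * S"
    unfolding e by (simp add: algebra_simps diff_divide_distrib add_divide_distrib)
  also have "\<dots> = m * (internal_energy \<gamma> r - internal_energy \<gamma> r0 - (?p + ?q) / 2 * (1 / r0 - 1 / r))"
    unfolding j(3)[symmetric] by (simp add: algebra_simps)
  also have "\<dots> < 0" using hugoniot_strict[OF \<gamma> r] j(1) by (simp add: mult_pos_neg)
  finally show ?thesis .
qed

lemma vel_jump_strict_mono:
  assumes \<gamma>: "\<gamma> \<ge> 1" and r: "0 < r0" "r0 \<le> r" "r < s"
  shows "vel_jump r0 0 r < vel_jump r0 0 s"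
proof -
  have "pressure \<gamma> r0 \<le> pressure \<gamma> r" "pressure \<gamma> r < pressure \<gamma> s"
    using pressure_strict_mono[OF \<gamma>, of r0 r] pressure_strict_mono[OF \<gamma>, of r s] r by (cases "r0 = r"; auto)+
  moreover have "1 / r0 - 1 / r \<ge> 0" "1 / r0 - 1 / r < 1 / r0 - 1 / s" using r by (auto simp: frac_le frac_less2)
  ultimately have "(pressure \<gamma> r - pressure \<gamma> r0) * (1 / r0 - 1 / r) < (pressure \<gamma> s - pressure \<gamma> r0) * (1 / r0 - 1 / s)"
    by (intro mult_strict_mono') auto
  then show ?thesis by (simp add: vel_jump_def eff_pressure_def)
qed

lemma vel_jump_continuous_on:
  assumes "0 < r0"
  shows "continuous_on {0<..} (vel_jump r0 \<delta>)"
  unfolding vel_jump_def[abs_def] eff_pressure_def pressure_def by (intro continuous_intros) auto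

text \<open>At the larger of the two outer densities one drop vanishes and the other is the square
  root in the assumption, so the total there is too small. It exceeds \<open>um - up\<close> for
  large densities, and the intermediate value theorem applies.\<close>

lemma intermediate_density:
  assumes \<gamma>: "\<gamma> \<ge> 1" and r: "0 < rm" "0 < rp"
    and jump: "um - up > sqrt ((rm - rp) * (pressure \<gamma> rm - pressure \<gamma> rp) / (rm * rp))"
  obtains r where "r > max rm rp" "vel_jump rm 0 r + vel_jump rp 0 r = um - up"
proof -
  let ?\<Delta> = "um - up" and ?R = "max rm rp" and ?f = "\<lambda>r. vel_jump rm 0 r + vel_jump rp 0 r"
  have R: "?R > 0" using r by simp
  have fR: "?f ?R = sqrt ((rm - rp) * (pressure \<gamma> rm - pressure \<gamma> rp) / (rm * rp))"
  proof (cases "rm \<ge> rp")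
    case True
    then have "?f ?R = sqrt ((pressure \<gamma> rm - pressure \<gamma> rp) * (1 / rp - 1 / rm))"
      by (simp add: vel_jump_def eff_pressure_def max_def)
    also have "(pressure \<gamma> rm - pressure \<gamma> rp) * (1 / rp - 1 / rm) = (rm - rp) * (pressure \<gamma> rm - pressure \<gamma> rp) / (rm * rp)"
      using r by (simp add: field_simps)
    finally show ?thesis .
  next
    case False
    then have "?f ?R = sqrt ((pressure \<gamma> rp - pressure \<gamma> rm) * (1 / rm - 1 / rp))"
      by (simp add: vel_jump_def eff_pressure_def max_def)
    also have "(pressure \<gamma> rp - pressure \<gamma> rm) * (1 / rm - 1 / rp) = (rm - rp) * (pressure \<gamma> rm - pressure \<gamma> rp) / (rm * rp)"
      using r by (simp add: field_simps)
    finally show ?thesis .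
  qed
  have "(rm - rp) * (pressure \<gamma> rm - pressure \<gamma> rp) \<ge> 0"
    using pressure_strict_mono[OF \<gamma>, of rm rp] pressure_strict_mono[OF \<gamma>, of rp rm] r
    by (cases rm rp rule: linorder_cases) (auto intro: mult_nonneg_nonneg mult_nonpos_nonpos)
  then have \<Delta>: "?\<Delta> > 0" using jump r by (smt (verit) divide_nonneg_pos mult_pos_pos real_sqrt_ge_zero)
  \<comment> \<open>For \<open>x \<ge> 1\<close> the pressure is at least \<open>x\<close>, and for
    \<open>x \<ge> 2 * ?R\<close> the jump of the specific volume is at least
    \<open>1 / (2 * ?R)\<close>. The third bound makes the product of the two jumps at least
    \<open>?\<Delta>\<^sup>2\<close>.\<close>
  define x where "x = max (2 * ?R) (max 1 (pressure \<gamma> rm + 2 * ?R * ?\<Delta>\<^sup>2))"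
  have x: "x \<ge> 2 * ?R" "x \<ge> 1" "x \<ge> pressure \<gamma> rm + 2 * ?R * ?\<Delta>\<^sup>2" by (auto simp: x_def)
  have fx: "?f x \<ge> ?\<Delta>"
  proof -
    have "x powr 1 \<le> x powr \<gamma>" using \<gamma> x(2) by (intro powr_mono) auto
    then have px: "pressure \<gamma> x \<ge> x" using x(2) by (simp add: pressure_def)
    have rx: "rm \<le> ?R" "rp \<le> ?R" by auto
    have "1 / rm - 1 / x \<ge> 1 / ?R - 1 / (2 * ?R)" using x R r rx by (intro diff_mono frac_le) auto
    then have t: "1 / rm - 1 / x \<ge> 1 / (2 * ?R)" using R by (simp add: field_simps)
    have "?\<Delta>\<^sup>2 = (2 * ?R * ?\<Delta>\<^sup>2) * (1 / (2 * ?R))" using R by simp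
    also have "\<dots> \<le> (pressure \<gamma> x - pressure \<gamma> rm) * (1 / rm - 1 / x)"
    proof (rule mult_mono)
      have "2 * ?R * ?\<Delta>\<^sup>2 \<ge> 0" using R by (intro mult_nonneg_nonneg) auto
      then show "0 \<le> pressure \<gamma> x - pressure \<gamma> rm" "2 * ?R * ?\<Delta>\<^sup>2 \<le> pressure \<gamma> x - pressure \<gamma> rm"
        using px x(3) by linarith+
    qed (use t R in auto)
    finally have "?\<Delta> \<le> vel_jump rm 0 x" by (simp add: vel_jump_def eff_pressure_def real_le_rsqrt)
    moreover have "vel_jump rp 0 x \<ge> 0"
    proof -
      have "rp < x" using x(1) rx R by linarith
      then have "vel_jump rp 0 rp < vel_jump rp 0 x" using vel_jump_strict_mono[OF \<gamma> r(2)] by simp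
      then show ?thesis by (simp add: vel_jump_def eff_pressure_def)
    qed
    ultimately show ?thesis by simp
  qed
  have "\<exists>y\<ge>?R. y \<le> x \<and> ?f y = ?\<Delta>"
  proof (rule IVT')
    show "?f ?R \<le> ?\<Delta>" using fR jump by simp
    show "?R \<le> x" using x R by linarith
    show "continuous_on {?R..x} ?f"
      by (intro continuous_intros continuous_on_subset[OF vel_jump_continuous_on[OF r(1)]] continuous_on_subset[OF vel_jump_continuous_on[OF r(2)]])
        (use R in auto)
  qed (rule fx)
  then obtain y where y: "y \<ge> ?R" "?f y = ?\<Delta>" by blast
  have "y \<noteq> ?R" using y fR jump by auto
  then have "y > ?R" by (intro order_le_neq_trans[OF y(1)]) simp
  then show thesis using that y(2) by blast
qed

text \<open>At the two-shock density \<open>y\<close> the stress can only increase the drops. At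
  some \<open>z < y\<close> the drops without stress fall short of \<open>um - up\<close>, and they
  still do for small \<open>\<delta>\<close>. A suitable density lies in between, and closeness of
  \<open>(r, \<delta>)\<close> to \<open>(y, 0)\<close> keeps both energy productions
  negative.\<close>

lemma perturbed_shocks:
  assumes \<gamma>: "\<gamma> \<ge> 1" and r: "0 < rm" "0 < rp"
    and jump: "um - up > sqrt ((rm - rp) * (pressure \<gamma> rm - pressure \<gamma> rp) / (rm * rp))"
  obtains r \<delta> where "\<delta> > 0" "r > rm" "r > rp" "vel_jump rm \<delta> r + vel_jump rp \<delta> r = um - up"
    "energy_prod rm um \<delta> r < 0" "energy_prod rp (- up) \<delta> r < 0"
proof -
  obtain y where y: "y > max rm rp" "vel_jump rm 0 y + vel_jump rp 0 y = um - up"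
    using intermediate_density[OF assms] by blast
  have ym: "rm < y" "rp < y" using y by auto
  have "\<forall>\<^sub>F x in nhds (y, 0). energy_prod rm um (snd x) (fst x) < 0 \<and> energy_prod rp (- up) (snd x) (fst x) < 0"
  proof (rule eventually_conj)
    show "\<forall>\<^sub>F x in nhds (y, 0). energy_prod rm um (snd x) (fst x) < 0"
      by (rule isCont_eventually_less[OF energy_prod_isCont[OF r(1) ym(1)]])
         (use energy_prod_shock_neg[OF \<gamma> r(1) ym(1)] in simp)
    show "\<forall>\<^sub>F x in nhds (y, 0). energy_prod rp (- up) (snd x) (fst x) < 0"
      by (rule isCont_eventually_less[OF energy_prod_isCont[OF r(2) ym(2)]])
         (use energy_prod_shock_neg[OF \<gamma> r(2) ym(2)] in simp)
  qed
  then obtain d where d: "d > 0" "\<And>x. dist x (y, 0) < d \<Longrightarrow> energy_prod rm um (snd x) (fst x) < 0 \<and> energy_prod rp (- up) (snd x) (fst x) < 0"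
    unfolding eventually_nhds_metric by blast
  \<comment> \<open>The maximum keeps \<open>z\<close> in the range where \<open>vel_jump\<close> is
    monotone; a density above \<open>z\<close> is then strictly larger than both outer ones. The
    bound \<open>y - d / 2\<close> leaves room for \<open>\<delta>\<close> within the distance
    \<open>d\<close>.\<close>
  define z where "z = max (max rm rp) (y - d / 2)"
  have z: "z < y" "z \<ge> rm" "z \<ge> rp" using d y by (auto simp: z_def)
  have "y - d / 2 \<le> z" by (simp add: z_def)
  then have z4: "y - z \<le> d / 2" by simp
  have z0: "z > 0" using z r by linarith
  have fz: "vel_jump rm 0 z + vel_jump rp 0 z < um - up"
    using vel_jump_strict_mono[OF \<gamma> r(1) z(2,1)] vel_jump_strict_mono[OF \<gamma> r(2) z(3,1)] y(2) by linarith
  have "isCont (\<lambda>\<delta>. vel_jump rm \<delta> z + vel_jump rp \<delta> z) 0"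
    unfolding vel_jump_def eff_pressure_def by (intro continuous_intros)
  then have "\<forall>\<^sub>F \<delta> in nhds 0. vel_jump rm \<delta> z + vel_jump rp \<delta> z < um - up"
    by (rule isCont_eventually_less) (rule fz)
  then obtain d' where d': "d' > 0" "\<And>\<delta>. dist \<delta> 0 < d' \<Longrightarrow> vel_jump rm \<delta> z + vel_jump rp \<delta> z < um - up"
    unfolding eventually_nhds_metric by blast
  define \<delta> where "\<delta> = min (d / 4) (d' / 2)"
  have \<delta>: "\<delta> > 0" "\<delta> < d / 2" "dist \<delta> 0 < d'" using d d' by (auto simp: \<delta>_def)
  have mono: "vel_jump r0 0 y \<le> vel_jump r0 \<delta> y" if "0 < r0" "r0 < y" for r0
  proof -
    have "1 / r0 - 1 / y \<ge> 0" using that by (simp add: frac_le)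
    then show ?thesis unfolding vel_jump_def eff_pressure_def
      using \<delta>(1) that by (intro real_sqrt_le_mono mult_right_mono) auto
  qed
  have "\<exists>x\<ge>z. x \<le> y \<and> vel_jump rm \<delta> x + vel_jump rp \<delta> x = um - up"
  proof (rule IVT')
    show "vel_jump rm \<delta> z + vel_jump rp \<delta> z \<le> um - up" using d'(2)[OF \<delta>(3)] by simp
    show "um - up \<le> vel_jump rm \<delta> y + vel_jump rp \<delta> y"
      using mono[OF r(1) ym(1)] mono[OF r(2) ym(2)] y(2) by linarith
    show "continuous_on {z..y} (\<lambda>x. vel_jump rm \<delta> x + vel_jump rp \<delta> x)"
      by (intro continuous_intros continuous_on_subset[OF vel_jump_continuous_on[OF r(1)]] continuous_on_subset[OF vel_jump_continuous_on[OF r(2)]])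
        (use z0 in auto)
  qed (use z in simp)
  then obtain x where x: "z \<le> x" "x \<le> y" "vel_jump rm \<delta> x + vel_jump rp \<delta> x = um - up" by blast
  have "x \<noteq> z" using x(3) d'(2)[OF \<delta>(3)] by auto
  then have xz: "x > z" using x(1) by simp
  have "dist (x, \<delta>) (y, 0) \<le> dist x y + dist \<delta> 0"
    unfolding dist_Pair_Pair by (rule sqrt_sum_squares_le_sum) auto
  also have "\<dots> < d" using x z4 \<delta> by (auto simp: dist_real_def)
  finally have "energy_prod rm um \<delta> x < 0 \<and> energy_prod rp (- up) \<delta> x < 0" using d(2)[of "(x, \<delta>)"] by simp
  then show thesis using that[of \<delta> x] \<delta>(1) x(3) xz z by auto
qed

text \<open>With this speed \<open>\<nu>\<close> the mass flux through the jump is the same from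
  both sides, \<open>r0 * (u - \<nu>) = m = r * (\<beta> - \<nu>)\<close>. Momentum and energy
  balance then become \<open>m\<close> times jumps of specific quantities, and the tangential speed
  \<open>a\<close>, equal on both sides, drops out.\<close>

lemma jump_conditions:
  fixes r0 r \<delta> u a :: real
  assumes \<gamma>: "\<gamma> \<ge> 1" and r: "0 < r0" "r0 < r" and \<delta>: "\<delta> > 0"
  defines "\<beta> \<equiv> u - vel_jump r0 \<delta> r"
  defines "\<nu> \<equiv> \<beta> - mass_flux r0 \<delta> r / r"
  shows "\<nu> < \<beta>"
    and "\<nu> * (r0 - r) = r0 * u - r * \<beta>"
    and "\<nu> * (r0 * u - r * \<beta>) = r0 * u\<^sup>2 + pressure \<gamma> r0 - (r * \<beta>\<^sup>2 + pressure \<gamma> r + r * \<delta>)"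
    and "energy_prod r0 u \<delta> r \<le> 0 \<Longrightarrow>
      \<nu> * (r0 * internal_energy \<gamma> r0 + r0 * ((a\<^sup>2 + u\<^sup>2) / 2) - (r * internal_energy \<gamma> r + r * ((a\<^sup>2 + \<beta>\<^sup>2 + 2 * \<delta>) / 2)))
      \<le> (r0 * internal_energy \<gamma> r0 + r0 * ((a\<^sup>2 + u\<^sup>2) / 2) + pressure \<gamma> r0) * u
        - (r * internal_energy \<gamma> r + r * ((a\<^sup>2 + \<beta>\<^sup>2 + 2 * \<delta>) / 2) + pressure \<gamma> r) * \<beta>"
proof -
  have P: "eff_pressure \<delta> r > pressure \<gamma> r0"
  proof -
    have "r * \<delta> > 0" using r \<delta> by (intro mult_pos_pos) auto
    then show ?thesis using pressure_strict_mono[OF \<gamma> r] unfolding eff_pressure_def by linarith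
  qed
  define S m where "S = vel_jump r0 \<delta> r" and "m = mass_flux r0 \<delta> r"
  note j = jump_relations[OF r P, folded S_def m_def]
  have r0: "r > 0" using r by simp
  show "\<nu> < \<beta>" using j(1) r0 by (simp add: \<nu>_def m_def)
  have b: "\<beta> = u - S" by (simp add: \<beta>_def S_def)
  have m1: "r * (\<beta> - \<nu>) = m" using r0 by (simp add: \<nu>_def m_def)
  have m0: "r0 * (u - \<nu>) = m"
  proof -
    have "u - \<nu> = S + m / r" by (simp add: \<nu>_def \<beta>_def S_def m_def)
    also have "\<dots> = m / r0" using j(3) by (simp add: algebra_simps)
    finally show ?thesis using r by simp
  qed
  show "\<nu> * (r0 - r) = r0 * u - r * \<beta>" using m0 m1 by (simp add: algebra_simps)
  have "r0 * u\<^sup>2 - \<nu> * (r0 * u) = u * m" unfolding m0[symmetric] by (simp add: power2_eq_square algebra_simps)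
  moreover have "r * \<beta>\<^sup>2 - \<nu> * (r * \<beta>) = \<beta> * m" unfolding m1[symmetric] by (simp add: power2_eq_square algebra_simps)
  moreover have "u * m - \<beta> * m = pressure \<gamma> r + r * \<delta> - pressure \<gamma> r0"
    using j(2) by (simp add: b eff_pressure_def algebra_simps)
  ultimately show "\<nu> * (r0 * u - r * \<beta>) = r0 * u\<^sup>2 + pressure \<gamma> r0 - (r * \<beta>\<^sup>2 + pressure \<gamma> r + r * \<delta>)"
    by (simp add: algebra_simps)
  assume e: "energy_prod r0 u \<delta> r \<le> 0"
  have ep: "energy_prod r0 u \<delta> r = m * (internal_energy \<gamma> r + \<beta>\<^sup>2 / 2 + \<delta> - internal_energy \<gamma> r0 - u\<^sup>2 / 2) + pressure \<gamma> r * \<beta> - pressure \<gamma> r0 * u"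
    by (simp add: energy_prod_def m_def \<beta>_def)
  let ?e1 = "internal_energy \<gamma> r + (a\<^sup>2 + \<beta>\<^sup>2 + 2 * \<delta>) / 2" and ?e0 = "internal_energy \<gamma> r0 + (a\<^sup>2 + u\<^sup>2) / 2"
  have "r * (\<beta> - \<nu>) * ?e1 - r0 * (u - \<nu>) * ?e0 + pressure \<gamma> r * \<beta> - pressure \<gamma> r0 * u = energy_prod r0 u \<delta> r"
    unfolding ep m0 m1 by (simp add: algebra_simps add_divide_distrib)
  then have "r * (\<beta> - \<nu>) * ?e1 - r0 * (u - \<nu>) * ?e0 + pressure \<gamma> r * \<beta> - pressure \<gamma> r0 * u \<le> 0" using e by simp
  from this show "\<nu> * (r0 * internal_energy \<gamma> r0 + r0 * ((a\<^sup>2 + u\<^sup>2) / 2) - (r * internal_energy \<gamma> r + r * ((a\<^sup>2 + \<beta>\<^sup>2 + 2 * \<delta>) / 2)))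
      \<le> (r0 * internal_energy \<gamma> r0 + r0 * ((a\<^sup>2 + u\<^sup>2) / 2) + pressure \<gamma> r0) * u
        - (r * internal_energy \<gamma> r + r * ((a\<^sup>2 + \<beta>\<^sup>2 + 2 * \<delta>) / 2) + pressure \<gamma> r) * \<beta>"
  proof -
    have gen: "\<nu> * (r0 * i0 + r0 * x - (r * i1 + r * y)) \<le> (r0 * i0 + r0 * x + q0) * u - (r * i1 + r * y + q) * \<beta>"
      if "r * (\<beta> - \<nu>) * (i1 + y) - r0 * (u - \<nu>) * (i0 + x) + q * \<beta> - q0 * u \<le> 0" for i0 i1 x y q q0 :: real
      using that by (simp add: algebra_simps)
    show ?thesis by (rule gen) fact
  qed
qed

end

text \<open>The right jump is the left one reflected in \<open>x2\<close>:
  \<open>jump_conditions\<close> is applied with \<open>- up\<close>, and its \<open>\<beta>\<close>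
  and \<open>\<nu>\<close> come out with the opposite sign.\<close>

lemma fan_subsolution:
  assumes \<gamma>: "\<gamma> \<ge> 1" and r: "0 < rm" "0 < rp"
    and jump: "um - up > sqrt ((rm - rp) * (pressure \<gamma> rm - pressure \<gamma> rp) / (rm * rp))"
  obtains r \<beta> \<delta> \<nu>m \<nu>p where "r > 0" "\<delta> > 0" "\<nu>m < \<nu>p"
    "\<nu>m * (rm - r) = rm * um - r * \<beta>" "\<nu>p * (r - rp) = r * \<beta> - rp * up"
    "\<nu>m * (rm * um - r * \<beta>) = rm * um\<^sup>2 + pressure \<gamma> rm - (r * \<beta>\<^sup>2 + pressure \<gamma> r + r * \<delta>)"
    "\<nu>p * (r * \<beta> - rp * up) = (r * \<beta>\<^sup>2 + pressure \<gamma> r + r * \<delta>) - (rp * up\<^sup>2 + pressure \<gamma> rp)"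
    "\<nu>m * (rm * internal_energy \<gamma> rm + rm * ((a\<^sup>2 + um\<^sup>2) / 2) - (r * internal_energy \<gamma> r + r * ((a\<^sup>2 + \<beta>\<^sup>2 + 2 * \<delta>) / 2)))
      \<le> (rm * internal_energy \<gamma> rm + rm * ((a\<^sup>2 + um\<^sup>2) / 2) + pressure \<gamma> rm) * um
        - (r * internal_energy \<gamma> r + r * ((a\<^sup>2 + \<beta>\<^sup>2 + 2 * \<delta>) / 2) + pressure \<gamma> r) * \<beta>"
    "\<nu>p * ((r * internal_energy \<gamma> r + r * ((a\<^sup>2 + \<beta>\<^sup>2 + 2 * \<delta>) / 2)) - (rp * internal_energy \<gamma> rp + rp * ((a\<^sup>2 + up\<^sup>2) / 2)))
      \<le> (r * internal_energy \<gamma> r + r * ((a\<^sup>2 + \<beta>\<^sup>2 + 2 * \<delta>) / 2) + pressure \<gamma> r) * \<beta>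
       - (rp * internal_energy \<gamma> rp + rp * ((a\<^sup>2 + up\<^sup>2) / 2) + pressure \<gamma> rp) * up"
proof -
  obtain \<rho> \<delta> where s: "\<delta> > 0" "\<rho> > rm" "\<rho> > rp" "vel_jump \<gamma> rm \<delta> \<rho> + vel_jump \<gamma> rp \<delta> \<rho> = um - up"
    "energy_prod \<gamma> rm um \<delta> \<rho> < 0" "energy_prod \<gamma> rp (- up) \<delta> \<rho> < 0"
    using perturbed_shocks[OF assms] by blast
  define \<beta> where "\<beta> = um - vel_jump \<gamma> rm \<delta> \<rho>"
  have \<beta>': "- up - vel_jump \<gamma> rp \<delta> \<rho> = - \<beta>" using s(4) by (simp add: \<beta>_def)
  define \<nu>m \<nu>p where "\<nu>m = \<beta> - mass_flux \<gamma> rm \<delta> \<rho> / \<rho>" and "\<nu>p = - (- \<beta> - mass_flux \<gamma> rp \<delta> \<rho> / \<rho>)"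
  note L = jump_conditions[OF \<gamma> r(1) s(2,1), of um, folded \<beta>_def, folded \<nu>m_def]
  have np: "- \<beta> - mass_flux \<gamma> rp \<delta> \<rho> / \<rho> = - \<nu>p" by (simp add: \<nu>p_def)
  note R = jump_conditions[OF \<gamma> r(2) s(3,1), of "- up", unfolded \<beta>' np]
  show thesis
  proof (rule that[of \<rho> \<delta> \<nu>m \<nu>p \<beta>])
    show "\<rho> > 0" using s r by simp
    show "\<nu>m < \<nu>p" using L(1) R(1) by simp
    show "\<nu>p * (\<rho> - rp) = \<rho> * \<beta> - rp * up" using R(2) by (simp add: algebra_simps)
    show "\<nu>p * (\<rho> * \<beta> - rp * up) = (\<rho> * \<beta>\<^sup>2 + pressure \<gamma> \<rho> + \<rho> * \<delta>) - (rp * up\<^sup>2 + pressure \<gamma> rp)"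
      using R(3) by (simp add: algebra_simps)
    show "\<nu>p * ((\<rho> * internal_energy \<gamma> \<rho> + \<rho> * ((a\<^sup>2 + \<beta>\<^sup>2 + 2 * \<delta>) / 2)) - (rp * internal_energy \<gamma> rp + rp * ((a\<^sup>2 + up\<^sup>2) / 2)))
      \<le> (\<rho> * internal_energy \<gamma> \<rho> + \<rho> * ((a\<^sup>2 + \<beta>\<^sup>2 + 2 * \<delta>) / 2) + pressure \<gamma> \<rho>) * \<beta>
       - (rp * internal_energy \<gamma> rp + rp * ((a\<^sup>2 + up\<^sup>2) / 2) + pressure \<gamma> rp) * up"
    proof -
      have gen: "\<nu> * (E - E') \<le> (E + q) * b - (E' + q') * b'"
        if "- \<nu> * (E' - E) \<le> (E' + q') * - b' - (E + q) * - b" for \<nu> E E' q q' b b' :: real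
        using that by (simp add: algebra_simps)
      show ?thesis by (rule gen) (use R(4)[of a] s(6) in simp)
    qed
  qed (use L L(4)[of a] s in auto)
qed

section \<open>Weak formulation on a fan\<close>

text \<open>A fan is a linear combination of the indicators of \<open>future\<close> and of two such
  sets, so all weak formulations reduce to integrals of derivatives over them. The edge is included,
  as in \<open>fan\<close>, which makes this identity hold pointwise.\<close>

definition half :: "real \<Rightarrow> spacetime set" where
  "half \<nu> = {z. snd z \<ge> 0 \<and> fst z $ 2 \<ge> \<nu> * snd z}"

lemma half_borel [measurable]: "half \<nu> \<in> sets borel"
proof -
  have "closed (half \<nu>)" unfolding half_def
    by (intro closed_Collect_conj closed_Collect_le continuous_intros)
  then show ?thesis by simp
qed

lemma future_borel [measurable]: "future \<in> sets borel"
proof -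
  have "future = {z. snd z \<ge> 0}" by (auto simp: future_def)
  moreover have "closed {z::spacetime. snd z \<ge> 0}" by (intro closed_Collect_le continuous_intros)
  ultimately show ?thesis by simp
qed

lemma integrable_indicator_D:
  assumes "C1c \<psi>" "S \<in> sets borel"
  shows "integrable lborel (\<lambda>z. indicator S z * D \<psi> z h)"
proof -
  have "integrable lborel (\<lambda>z. D \<psi> z h)" by (rule integrable_D[OF assms(1), of "\<lambda>z. h" "norm h"]) auto
  from integrable_real_mult_indicator[OF _ this, of S] show ?thesis using assms(2) by (simp add: mult.commute)
qed

lemma D_bounded_borel:
  assumes "C1c \<psi>"
  obtains K where "\<And>z. \<bar>D \<psi> z h\<bar> \<le> K"
  using C1c_bounded[OF assms] by metis

lemma integral_D_invariant:
  assumes \<psi>: "C1c \<psi>" and S: "S \<in> sets borel" "\<And>x s. x + s *\<^sub>R e \<in> S \<longleftrightarrow> x \<in> S"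
  shows "(LINT z|lborel. indicator S z * D \<psi> z e) = 0"
proof -
  obtain R where R: "\<And>z. norm z > R \<Longrightarrow> \<psi> z = 0" using C1c_support[OF \<psi>] by metis
  obtain K where K: "\<And>z. \<bar>D \<psi> z e\<bar> \<le> K" using D_bounded_borel[OF \<psi>] by metis
  show ?thesis
    by (rule integral_directional_derivative_eq_0[OF C1cD(4)[OF \<psi>] R _ K C1cD(5)[OF \<psi>] S])
       (assumption | rule borel_measurable_continuous_onI[OF C1cD(2)[OF \<psi>]])+
qed

text \<open>The integral is minus the integral of \<open>\<psi>\<close> along the edge. The sign is
  obtained without a trace: shifting \<open>half \<nu>\<close> in direction \<open>E2\<close>
  shrinks it, and \<open>\<psi>\<close> is nonnegative on what is lost.\<close>

lemma integral_half_D2_le_0: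
  assumes \<psi>: "C1c \<psi>" and pos: "\<And>z. z \<in> future \<Longrightarrow> \<psi> z \<ge> 0"
  shows "(LINT z|lborel. indicator (half \<nu>) z * D \<psi> z E2) \<le> 0"
proof -
  obtain R where R: "\<And>z. norm z > R \<Longrightarrow> \<psi> z = 0" using C1c_support[OF \<psi>] by metis
  obtain K where K: "\<And>z. \<bar>D \<psi> z E2\<bar> \<le> K" using D_bounded_borel[OF \<psi>] by metis
  have \<psi>m: "\<psi> \<in> borel_measurable borel" using C1cD(4)[OF \<psi>] borel_measurable_continuous_onI by blast
  have i\<psi>: "integrable lborel \<psi>" by (rule integrable_continuous_bounded_support[OF C1cD(4)[OF \<psi>] R])
  have i1: "integrable lborel (\<lambda>z. indicator (half \<nu>) z * \<psi> z)"
    using integrable_real_mult_indicator[OF _ i\<psi>, of "half \<nu>"] by (simp add: mult.commute)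
  obtain M where M: "\<And>z. norm (\<psi> z) \<le> M"
    using continuous_bounded_support_bounded[OF C1cD(4)[OF \<psi>] R] by metis
  have neg: "(LINT z|lborel. indicator (half \<nu>) z * (\<psi> (z + h *\<^sub>R E2) - \<psi> z)) \<le> 0" if h: "h > 0" for h
  proof -
    have i2: "integrable lborel (\<lambda>z. indicator (half \<nu>) z * \<psi> (z + h *\<^sub>R E2))"
    proof (rule integrable_bounded_support[of _ "R + norm (h *\<^sub>R E2)"])
      show "norm (indicator (half \<nu>) z * \<psi> (z + h *\<^sub>R E2)) \<le> M" for z
        using M[of "z + h *\<^sub>R E2"] M[of 0] norm_ge_zero[of "\<psi> 0"] by (auto simp: indicator_def)
      show "indicator (half \<nu>) z * \<psi> (z + h *\<^sub>R E2) = 0" if "norm z > R + norm (h *\<^sub>R E2)" for z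
        using R[of "z + h *\<^sub>R E2"] that norm_triangle_ineq4[of "z + h *\<^sub>R E2" "h *\<^sub>R E2"] by simp
      show "(\<lambda>z. indicator (half \<nu>) z * \<psi> (z + h *\<^sub>R E2)) \<in> borel_measurable borel"
        by (intro borel_measurable_times borel_measurable_indicator half_borel measurable_compose[OF _ \<psi>m]) auto
    qed
    have i3: "(\<lambda>z. indicator (half \<nu>) (z - h *\<^sub>R E2) * \<psi> z) \<in> borel_measurable borel"
      by (intro borel_measurable_times \<psi>m measurable_compose[OF _ borel_measurable_indicator[OF half_borel]]) auto
    have i4: "integrable lborel (\<lambda>z. indicator (half \<nu>) (z - h *\<^sub>R E2) * \<psi> z)"
    proof (rule Bochner_Integration.integrable_bound[OF i\<psi>])
      show "AE z in lborel. norm (indicator (half \<nu>) (z - h *\<^sub>R E2) * \<psi> z) \<le> norm (\<psi> z)"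
        by (intro AE_I2) (auto simp: indicator_def)
    qed (use i3 in simp)
    have "(LINT z|lborel. indicator (half \<nu>) z * (\<psi> (z + h *\<^sub>R E2) - \<psi> z)) =
        (LINT z|lborel. indicator (half \<nu>) z * \<psi> (z + h *\<^sub>R E2)) - (LINT z|lborel. indicator (half \<nu>) z * \<psi> z)"
      using i1 i2 by (simp add: right_diff_distrib)
    also have "(LINT z|lborel. indicator (half \<nu>) z * \<psi> (z + h *\<^sub>R E2)) = (LINT z|lborel. indicator (half \<nu>) (z - h *\<^sub>R E2) * \<psi> z)"
      using integral_translate[OF i3, of "h *\<^sub>R E2"] by simp
    also have "(LINT z|lborel. indicator (half \<nu>) (z - h *\<^sub>R E2) * \<psi> z) \<le> (LINT z|lborel. indicator (half \<nu>) z * \<psi> z)"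
    proof (rule integral_mono[OF i4 i1])
      fix z
      have "z - h *\<^sub>R E2 \<in> half \<nu> \<Longrightarrow> z \<in> half \<nu>" using h by (auto simp: half_def axis_def)
      moreover have "z \<in> half \<nu> \<Longrightarrow> \<psi> z \<ge> 0" using pos[of z] by (cases z) (auto simp: half_def future_def)
      ultimately show "indicator (half \<nu>) (z - h *\<^sub>R E2) * \<psi> z \<le> indicator (half \<nu>) z * \<psi> z"
        by (auto simp: indicator_def)
    qed
    finally show ?thesis by simp
  qed
  have "(\<lambda>n. (LINT x|lborel. indicator (half \<nu>) x * (\<psi> (x + inverse (real (Suc n)) *\<^sub>R E2) - \<psi> x)) * real (Suc n))
    \<longlonglongrightarrow> (LINT x|lborel. indicator (half \<nu>) x * D \<psi> x E2)"
    by (rule difference_quotient_tendsto[OF C1cD(4)[OF \<psi>] R _ K C1cD(5)[OF \<psi>] half_borel])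
       (assumption | rule borel_measurable_continuous_onI[OF C1cD(2)[OF \<psi>]])+
  then show ?thesis
    by (rule LIMSEQ_le_const2) (use neg in \<open>auto intro!: mult_nonpos_nonneg\<close>)
qed

text \<open>The shear that follows the direction \<open>(w, 1)\<close> turns the derivative into a
  time derivative along straight lines. Fubini and the fundamental theorem of calculus leave the
  initial value.\<close>

lemma integral_transport:
  fixes w :: "real^2"
  assumes \<psi>: "C1c \<psi>" and A: "A \<in> sets borel"
  shows "(LINT z|lborel. indicator {z. snd z \<ge> 0 \<and> fst z - snd z *\<^sub>R w \<in> A} z * D \<psi> z (w, 1)) =
     - (LINT x|lborel. indicator A x * \<psi> (x, 0))"
proof -
  obtain R where R: "R > 0" "\<And>z. norm z > R \<Longrightarrow> \<psi> z = 0" "\<And>z h. norm z > R \<Longrightarrow> D \<psi> z h = 0"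
    using C1c_support[OF \<psi>] by metis
  obtain K where K: "\<And>z. \<bar>D \<psi> z (w, 1)\<bar> \<le> K" using D_bounded_borel[OF \<psi>] by metis
  define g where "g z = D \<psi> z (w, 1)" for z
  have cg: "continuous_on UNIV g" using C1cD(2)[OF \<psi>] by (simp add: g_def[abs_def])
  have gm: "g \<in> borel_measurable borel" using cg borel_measurable_continuous_onI by blast
  let ?S = "{z::spacetime. snd z \<ge> 0 \<and> fst z - snd z *\<^sub>R w \<in> A}"
  have Sm: "?S \<in> sets borel"
  proof -
    have "(\<lambda>z::spacetime. fst z - snd z *\<^sub>R w) \<in> borel_measurable borel"
      by (intro borel_measurable_continuous_onI continuous_intros)
    then have m: "(\<lambda>z::spacetime. fst z - snd z *\<^sub>R w) -` A \<inter> space borel \<in> sets borel" using A by (rule measurable_sets)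
    have c: "closed {z::spacetime. snd z \<ge> 0}" by (intro closed_Collect_le continuous_intros)
    have eq: "?S = {z. snd z \<ge> 0} \<inter> ((\<lambda>z. fst z - snd z *\<^sub>R w) -` A \<inter> space borel)" by auto
    show ?thesis unfolding eq by (intro sets.Int borel_closed c m)
  qed
  have gi: "integrable lborel (\<lambda>z. indicator ?S z * g z)"
    using integrable_indicator_D[OF \<psi> Sm] by (simp add: g_def)
  have fst_b: "(LINT z|lborel. indicator ?S z * g z) = (LINT t|lborel. LINT x|lborel. indicator ?S (x, t) * g (x, t))"
    using lborel_pair.integral_snd[of "\<lambda>x t. indicator ?S (x, t) * g (x, t)"] gi by (simp add: lborel_prod case_prod_beta')
  have inner: "(LINT x|lborel. indicator ?S (x, t) * g (x, t)) = (LINT x|lborel. indicator {0..} t * (indicator A x * g (x + t *\<^sub>R w, t)))" for t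
  proof -
    have sl: "(\<lambda>x. indicator ?S (x, t) * g (x, t)) \<in> borel_measurable borel"
    proof -
      have c: "(\<lambda>x::real^2. (x, t)) \<in> borel_measurable borel"
        by (intro borel_measurable_continuous_onI continuous_intros)
      have "(\<lambda>z. indicator ?S z * g z) \<in> borel_measurable borel" using gi by auto
      from measurable_compose[OF c this] show ?thesis by simp
    qed
    have "(LINT x|lborel. indicator ?S (x, t) * g (x, t)) = (LINT x|lborel. indicator ?S (x + t *\<^sub>R w, t) * g (x + t *\<^sub>R w, t))"
      using integral_translate[OF sl, of "t *\<^sub>R w"] by simp
    also have "\<dots> = (LINT x|lborel. indicator {0..} t * (indicator A x * g (x + t *\<^sub>R w, t)))"
      by (intro Bochner_Integration.integral_cong) (auto simp: indicator_def)
    finally show ?thesis .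
  qed
  define h where "h z = indicator {0..} (snd z) * (indicator A (fst z) * g (fst z + snd z *\<^sub>R w, snd z))" for z :: spacetime
  have hm: "h \<in> borel_measurable borel"
  proof -
    have "(\<lambda>z::spacetime. g (fst z + snd z *\<^sub>R w, snd z)) \<in> borel_measurable borel"
      by (rule measurable_compose[OF _ gm]) (intro borel_measurable_continuous_onI continuous_intros)
    moreover have "(\<lambda>z::spacetime. indicator A (fst z) :: real) \<in> borel_measurable borel"
      by (rule measurable_compose[OF _ borel_measurable_indicator[OF A]]) (intro borel_measurable_continuous_onI continuous_intros)
    moreover have "(\<lambda>z::spacetime. indicator {0..} (snd z) :: real) \<in> borel_measurable borel"
      by (rule measurable_compose[of snd _ borel]) (auto intro!: borel_measurable_continuous_onI continuous_intros)
    ultimately show ?thesis unfolding h_def[abs_def] by (intro borel_measurable_times)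
  qed
  have hi: "integrable lborel h"
  proof (rule integrable_bounded_support[OF hm, of "R + R * norm w + R"])
    show "norm (h z) \<le> K" for z
      using K[of "(fst z + snd z *\<^sub>R w, snd z)"] K[of 0] abs_ge_zero[of "D \<psi> 0 (w, 1)"]
      by (auto simp: h_def g_def indicator_def)
    show "h z = 0" if z: "norm z > R + R * norm w + R" for z
    proof (rule ccontr)
      assume "h z \<noteq> 0"
      then have "g (fst z + snd z *\<^sub>R w, snd z) \<noteq> 0" by (auto simp: h_def)
      then have n: "norm (fst z + snd z *\<^sub>R w, snd z) \<le> R" using R(3) unfolding g_def by (meson not_le)
      have n1: "norm (fst z + snd z *\<^sub>R w) \<le> R" "\<bar>snd z\<bar> \<le> R"
        using order_trans[OF norm_fst_le n] order_trans[OF norm_snd_le n] by auto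
      have "norm (fst z) \<le> norm (fst z + snd z *\<^sub>R w) + norm (snd z *\<^sub>R w)"
        by (metis add_diff_cancel_right' norm_triangle_ineq4)
      also have "\<dots> \<le> R + R * norm w" using n1 by (intro add_mono) (auto intro: mult_right_mono)
      finally have "norm (fst z, snd z) \<le> R + R * norm w + R"
        using n1(2) norm_Pair_le[of "fst z" "snd z"] by simp
      then show False using z by simp
    qed
  qed
  have "(LINT z|lborel. indicator ?S z * g z) = (LINT t|lborel. LINT x|lborel. h (x, t))"
    unfolding fst_b inner by (simp add: h_def)
  also have "\<dots> = integral\<^sup>L lborel h"
    using lborel_pair.integral_snd[of "\<lambda>x t. h (x, t)"] hi by (simp add: lborel_prod case_prod_beta')
  also have "\<dots> = (LINT x|lborel. LINT t|lborel. h (x, t))"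
    using lborel_pair.integral_fst'[of h] hi by (simp add: lborel_prod)
  also have "\<dots> = (LINT x|lborel. - (indicator A x * \<psi> (x, 0)))"
  proof (rule Bochner_Integration.integral_cong)
    fix x :: "real^2"
    define \<phi> where "\<phi> t = \<psi> (x + t *\<^sub>R w, t)" for t
    have d\<phi>: "(\<phi> has_real_derivative g (x + t *\<^sub>R w, t)) (at t)" for t
    proof -
      have "((\<lambda>s. \<psi> ((x + t *\<^sub>R w, t) + s *\<^sub>R (w, 1))) has_real_derivative g (x + t *\<^sub>R w, t)) (at (t - t))"
        using C1cD(5)[OF \<psi>, of "(x + t *\<^sub>R w, t)" "(w, 1)"] by (simp add: g_def)
      then have "((\<lambda>s. \<psi> ((x + t *\<^sub>R w, t) + (s - t) *\<^sub>R (w, 1))) has_real_derivative g (x + t *\<^sub>R w, t) * 1) (at t)"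
        by (intro DERIV_chain2[where g = "\<lambda>s. s - t"]) (auto intro!: derivative_eq_intros)
      then show ?thesis unfolding \<phi>_def by (simp add: algebra_simps)
    qed
    have out: "norm (x + t *\<^sub>R w, t) > R" if "t > R" for t
      using norm_snd_le[of t "x + t *\<^sub>R w"] that by simp
    have "(LINT t|lborel. h (x, t)) = (LINT t|lborel. indicator A x * (g (x + t *\<^sub>R w, t) * indicator {0..R + 1} t))"
    proof (rule Bochner_Integration.integral_cong)
      fix t
      show "h (x, t) = indicator A x * (g (x + t *\<^sub>R w, t) * indicator {0..R + 1} t)"
      proof (cases "t > R")
        case True
        then have "g (x + t *\<^sub>R w, t) = 0" using R(3)[OF out[OF True]] by (simp add: g_def)
        then show ?thesis by (simp add: h_def)
      qed (auto simp: h_def indicator_def)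
    qed simp
    also have "\<dots> = indicator A x * (LINT t|lborel. g (x + t *\<^sub>R w, t) * indicator {0..R + 1} t)" by simp
    \<comment> \<open>The support is controlled only for times strictly above \<open>R\<close>,
      hence the upper end \<open>R + 1\<close>, at which \<open>\<phi>\<close> vanishes.\<close>
    also have "(LINT t|lborel. g (x + t *\<^sub>R w, t) * indicator {0..R + 1} t) = \<phi> (R + 1) - \<phi> 0"
    proof (rule integral_FTC_Icc_real)
      show "0 \<le> R + 1" using R by simp
      show "isCont (\<lambda>t. g (x + t *\<^sub>R w, t)) t" for t
      proof -
        have "continuous_on UNIV (\<lambda>t. g (x + t *\<^sub>R w, t))"
          by (intro continuous_on_compose2[OF cg] continuous_intros) auto
        then show ?thesis by (simp add: continuous_on_eq_continuous_at)
      qed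
    qed (rule d\<phi>)
    also have "\<phi> (R + 1) = 0" using R(2)[OF out[of "R + 1"]] by (simp add: \<phi>_def)
    finally show "(LINT t|lborel. h (x, t)) = - (indicator A x * \<psi> (x, 0))" by (simp add: \<phi>_def)
  qed simp
  finally show ?thesis by (simp add: g_def)
qed

text \<open>\<open>half \<nu>\<close> is swept out by the initial half plane moving with velocity
  \<open>\<nu>\<close> in direction \<open>x2\<close>. A time derivative is thus traded for
  \<open>- \<nu>\<close> times an \<open>x2\<close>-derivative and an initial term.\<close>

lemma integral_half_transport:
  assumes \<psi>: "C1c \<psi>"
  shows "(LINT z|lborel. indicator (half \<nu>) z * D \<psi> z E3) =
    - (LINT x|lborel. indicator {x. x $ 2 \<ge> 0} x * \<psi> (x, 0)) - \<nu> * (LINT z|lborel. indicator (half \<nu>) z * D \<psi> z E2)"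
proof -
  let ?w = "\<nu> *\<^sub>R axis 2 1 :: real^2"
  have "closed {x::real^2. x $ 2 \<ge> 0}" by (intro closed_Collect_le continuous_intros)
  then have "{x::real^2. x $ 2 \<ge> 0} \<in> sets borel" by simp
  from integral_transport[OF \<psi> this, of ?w]
  have "(LINT z|lborel. indicator (half \<nu>) z * D \<psi> z (?w, 1)) = - (LINT x|lborel. indicator {x. x $ 2 \<ge> 0} x * \<psi> (x, 0))"
    by (simp add: half_def axis_def mult.commute)
  moreover have "D \<psi> z (?w, 1) = D \<psi> z E3 + \<nu> * D \<psi> z E2" for z
    using C1c_decomp[OF \<psi>, of z "(?w, 1)"] by (simp add: axis_def)
  then have "(LINT z|lborel. indicator (half \<nu>) z * D \<psi> z (?w, 1)) =
      (LINT z|lborel. indicator (half \<nu>) z * D \<psi> z E3) + \<nu> * (LINT z|lborel. indicator (half \<nu>) z * D \<psi> z E2)"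
    using integrable_indicator_D[OF \<psi> half_borel, of \<nu>] by (simp add: distrib_left mult.left_commute)
  ultimately show ?thesis by simp
qed

lemma integral_future_D:
  assumes \<psi>: "C1c \<psi>"
  shows "(LINT z|lborel. indicator future z * D \<psi> z E1) = 0" "(LINT z|lborel. indicator future z * D \<psi> z E2) = 0"
    "(LINT z|lborel. indicator future z * D \<psi> z E3) = - (LINT x|lborel. \<psi> (x, 0))"
    "(LINT z|lborel. indicator (half \<nu>) z * D \<psi> z E1) = 0"
proof -
  show "(LINT z|lborel. indicator future z * D \<psi> z E1) = 0" "(LINT z|lborel. indicator future z * D \<psi> z E2) = 0"
    by (rule integral_D_invariant[OF \<psi> future_borel]; force simp: future_def)+
  show "(LINT z|lborel. indicator (half \<nu>) z * D \<psi> z E1) = 0"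
    by (rule integral_D_invariant[OF \<psi> half_borel]) (simp add: half_def axis_def)
  have "{z::spacetime. snd z \<ge> 0 \<and> fst z - snd z *\<^sub>R 0 \<in> UNIV} = future" by (auto simp: future_def)
  then show "(LINT z|lborel. indicator future z * D \<psi> z E3) = - (LINT x|lborel. \<psi> (x, 0))"
    using integral_transport[OF \<psi>, of UNIV 0] by simp
qed

definition fan :: "real \<Rightarrow> real \<Rightarrow> 'b \<Rightarrow> 'b \<Rightarrow> 'b \<Rightarrow> spacetime \<Rightarrow> 'b" where
  "fan \<nu> \<nu>' l m r z = (if fst z $ 2 < \<nu> * snd z then l else if fst z $ 2 < \<nu>' * snd z then m else r)"

text \<open>The initial terms cancel, and the fluxes \<open>k1 k2 k3\<close> along \<open>x1\<close>
  integrate to zero. Each edge contributes its Rankine-Hugoniot defect times one and the same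
  integral, so conservation needs zero defects and the energy inequality needs only their
  sign.\<close>

lemma fan_conservation:
  assumes \<psi>: "C1c \<psi>" and \<nu>: "\<nu> < \<nu>'"
  shows "(LINT z|lborel. indicator future z * (fan \<nu> \<nu>' f1 f2 f3 z * D \<psi> z E3 + fan \<nu> \<nu>' k1 k2 k3 z * D \<psi> z E1
           + fan \<nu> \<nu>' g1 g2 g3 z * D \<psi> z E2))
       + (LINT x|lborel. riemann_data f1 f3 x * \<psi> (x, 0)) =
     ((g2 - g1) - \<nu> * (f2 - f1)) * (LINT z|lborel. indicator (half \<nu>) z * D \<psi> z E2)
     + ((g3 - g2) - \<nu>' * (f3 - f2)) * (LINT z|lborel. indicator (half \<nu>') z * D \<psi> z E2)"
proof -
  have fan: "indicator future z * fan \<nu> \<nu>' a1 a2 a3 z =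
     a1 * indicator future z + (a2 - a1) * indicator (half \<nu>) z + (a3 - a2) * indicator (half \<nu>') z"
    for a1 a2 a3 :: real and z
  proof (cases "z \<in> future")
    case True
    then have "snd z \<ge> 0" by (auto simp: future_def)
    then have "\<nu> * snd z \<le> \<nu>' * snd z" using \<nu> by (simp add: mult_right_mono)
    then show ?thesis using True \<open>snd z \<ge> 0\<close> by (auto simp: fan_def half_def indicator_def)
  next
    case False
    then have "\<not> snd z \<ge> 0" by (cases z) (auto simp: future_def)
    then show ?thesis using False by (auto simp: half_def indicator_def)
  qed
  have i: "integrable lborel (\<lambda>z. indicator future z * D \<psi> z e)" "integrable lborel (\<lambda>z. indicator (half \<nu>) z * D \<psi> z e)"
    "integrable lborel (\<lambda>z. indicator (half \<nu>') z * D \<psi> z e)" for e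
    by (intro integrable_indicator_D[OF \<psi>] future_borel half_borel)+
  have e: "(LINT z|lborel. indicator future z * fan \<nu> \<nu>' a1 a2 a3 z * D \<psi> z e) =
     a1 * (LINT z|lborel. indicator future z * D \<psi> z e) + (a2 - a1) * (LINT z|lborel. indicator (half \<nu>) z * D \<psi> z e)
     + (a3 - a2) * (LINT z|lborel. indicator (half \<nu>') z * D \<psi> z e) \<and>
     integrable lborel (\<lambda>z. indicator future z * fan \<nu> \<nu>' a1 a2 a3 z * D \<psi> z e)" for a1 a2 a3 e
    unfolding fan using i by (simp add: distrib_right mult.assoc)
  have r: "riemann_data f1 f3 x * \<psi> (x, 0) = f1 * \<psi> (x, 0) + (f3 - f1) * (indicator {x. x $ 2 \<ge> 0} x * \<psi> (x, 0))" for x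
    by (auto simp: riemann_data_def indicator_def algebra_simps)
  obtain R where R: "\<And>z. norm z > R \<Longrightarrow> \<psi> z = 0" using C1c_support[OF \<psi>] by metis
  have i0: "integrable lborel (\<lambda>x. \<psi> (x, 0))"
    by (rule integrable_continuous_bounded_support[of _ R])
       (auto intro!: continuous_on_compose2[OF C1cD(4)[OF \<psi>]] continuous_intros R simp: norm_Pair)
  have "closed {x::real^2. x $ 2 \<ge> 0}" by (intro closed_Collect_le continuous_intros)
  then have "{x::real^2. x $ 2 \<ge> 0} \<in> sets lborel" by simp
  from integrable_real_mult_indicator[OF this i0]
  have i1: "integrable lborel (\<lambda>x. indicator {x. x $ 2 \<ge> 0} x * \<psi> (x, 0))" by (simp add: mult.commute)
  have rr: "(LINT x|lborel. riemann_data f1 f3 x * \<psi> (x, 0)) = f1 * (LINT x|lborel. \<psi> (x, 0))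
     + (f3 - f1) * (LINT x|lborel. indicator {x. x $ 2 \<ge> 0} x * \<psi> (x, 0))"
    unfolding r using i0 i1 by simp
  have "(LINT z|lborel. indicator future z * (fan \<nu> \<nu>' f1 f2 f3 z * D \<psi> z E3 + fan \<nu> \<nu>' k1 k2 k3 z * D \<psi> z E1
           + fan \<nu> \<nu>' g1 g2 g3 z * D \<psi> z E2)) =
     (LINT z|lborel. indicator future z * fan \<nu> \<nu>' f1 f2 f3 z * D \<psi> z E3)
     + (LINT z|lborel. indicator future z * fan \<nu> \<nu>' k1 k2 k3 z * D \<psi> z E1)
     + (LINT z|lborel. indicator future z * fan \<nu> \<nu>' g1 g2 g3 z * D \<psi> z E2)"
    using e[of f1 f2 f3 E3] e[of k1 k2 k3 E1] e[of g1 g2 g3 E2] by (simp add: distrib_left mult.assoc)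
  also have "\<dots> = f1 * (LINT z|lborel. indicator future z * D \<psi> z E3) + (f2 - f1) * (LINT z|lborel. indicator (half \<nu>) z * D \<psi> z E3)
     + (f3 - f2) * (LINT z|lborel. indicator (half \<nu>') z * D \<psi> z E3)
     + (g2 - g1) * (LINT z|lborel. indicator (half \<nu>) z * D \<psi> z E2) + (g3 - g2) * (LINT z|lborel. indicator (half \<nu>') z * D \<psi> z E2)"
    using e[of f1 f2 f3 E3] e[of k1 k2 k3 E1] e[of g1 g2 g3 E2] integral_future_D[OF \<psi>] by simp
  finally show ?thesis
    unfolding rr integral_half_transport[OF \<psi>] integral_future_D(3)[OF \<psi>] by (simp add: algebra_simps)
qed

section \<open>From the given test functions and measures to C1 functions and Borel
  integrals\<close>

lemma test_function_C1c:
  fixes \<psi> :: "spacetime \<Rightarrow> real"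
  assumes "test_function \<psi>"
  shows "C1c \<psi>"
  using assms bounded_subset[OF compact_imp_bounded closure_subset]
  unfolding test_function_def C1c_def by blast

lemma test_function_component:
  fixes \<phi> :: "spacetime \<Rightarrow> real^2"
  assumes "test_function \<phi>"
  shows "C1c (\<lambda>z. \<phi> z $ i)" "frechet_derivative \<phi> (at z) h $ i = D (\<lambda>z. \<phi> z $ i) z h"
proof -
  have "Ck 1 \<phi>" using assms by (simp add: test_function_def)
  then have "(\<forall>z. \<phi> differentiable (at z)) \<and> (\<forall>h. continuous_on UNIV (\<lambda>z. frechet_derivative \<phi> (at z) h))"
    unfolding One_nat_def Ck.simps by blast
  then have d: "\<phi> differentiable (at z)" and c: "continuous_on UNIV (\<lambda>z. frechet_derivative \<phi> (at z) h)" for z h by blast+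
  have hd: "((\<lambda>z. \<phi> z $ i) has_derivative (\<lambda>h. frechet_derivative \<phi> (at z) h $ i)) (at z)" for z
    using d[of z] unfolding frechet_derivative_works
    by (rule bounded_linear.has_derivative[OF bounded_linear_vec_nth])
  have D: "D (\<lambda>z. \<phi> z $ i) z = (\<lambda>h. frechet_derivative \<phi> (at z) h $ i)" for z
    using frechet_derivative_at[OF hd] by simp
  then show "frechet_derivative \<phi> (at z) h $ i = D (\<lambda>z. \<phi> z $ i) z h" by simp
  have "bounded {z. \<phi> z \<noteq> 0}"
    using assms bounded_subset[OF compact_imp_bounded closure_subset] unfolding test_function_def by blast
  then have "bounded {z. \<phi> z $ i \<noteq> 0}" by (rule bounded_subset) auto
  moreover have "Ck 1 (\<lambda>z. \<phi> z $ i)"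
    unfolding One_nat_def Ck.simps D using hd c unfolding differentiable_def
    by (intro conjI allI continuous_intros) blast+
  ultimately show "C1c (\<lambda>z. \<phi> z $ i)" by (simp add: C1c_def)
qed

lemma integral_lebesgue_on_future:
  fixes f :: "spacetime \<Rightarrow> real"
  assumes "f \<in> borel_measurable borel"
  shows "(LINT z|lebesgue_on future. f z) = (LINT z|lborel. indicator future z * f z)"
proof -
  have "(LINT z|lebesgue_on future. f z) = (LINT z|lebesgue. indicator future z *\<^sub>R f z)"
    by (rule integral_restrict_space) simp
  also have "\<dots> = (LINT z|lborel. indicator future z *\<^sub>R f z)"
    using assms by (intro integral_completion) simp
  finally show ?thesis by simp
qed

lemma measurable_fan:
  fixes f :: "spacetime \<Rightarrow> 'b::real_normed_vector"
  assumes "f \<in> borel_measurable borel"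
  shows "(\<lambda>z. fan \<nu> \<nu>' l (f z) r z) \<in> borel_measurable borel"
proof -
  have "open {z::spacetime. fst z $ 2 < c * snd z}" for c by (intro open_Collect_less continuous_intros)
  then have "{z \<in> space borel. fst z $ 2 < c * snd z} \<in> sets (borel :: spacetime measure)" for c by simp
  then show ?thesis unfolding fan_def using assms by (intro measurable_If) auto
qed

lemma borel_measurable_riemann:
  fixes l r :: real
  shows "riemann_data l r \<in> borel_measurable borel"
proof -
  have "open {x::real^2. x $ 2 < 0}" by (intro open_Collect_less continuous_intros)
  then show ?thesis unfolding riemann_data_def[abs_def] by (intro measurable_If) auto
qed

lemma riemann_trace:
  assumes "C1c \<psi>"
  shows "(LINT x|lebesgue. riemann_data l r x * \<psi> (x, 0)) = (LINT x|lborel. riemann_data l r x * \<psi> (x, 0))"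
    and "integrable lborel (\<lambda>x. riemann_data l r x * \<psi> (x, 0))"
    and "(\<lambda>x. riemann_data l r x * \<psi> (x, 0)) \<in> borel_measurable borel"
proof -
  obtain R where R: "\<And>z. norm z > R \<Longrightarrow> \<psi> z = 0" using C1c_support[OF assms] by metis
  obtain K where K: "\<And>z. norm (\<psi> z) \<le> K" using continuous_bounded_support_bounded[OF C1cD(4)[OF assms] R] by metis
  have "continuous_on UNIV (\<lambda>x. \<psi> (x, 0))"
    by (intro continuous_on_compose2[OF C1cD(4)[OF assms]] continuous_intros) auto
  then have m: "(\<lambda>x. \<psi> (x, 0)) \<in> borel_measurable borel" by (rule borel_measurable_continuous_onI)
  show rm: "(\<lambda>x. riemann_data l r x * \<psi> (x, 0)) \<in> borel_measurable borel"
    by (intro borel_measurable_times borel_measurable_riemann m)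
  then show "(LINT x|lebesgue. riemann_data l r x * \<psi> (x, 0)) = (LINT x|lborel. riemann_data l r x * \<psi> (x, 0))"
    by (intro integral_completion) simp
  show "integrable lborel (\<lambda>x. riemann_data l r x * \<psi> (x, 0))"
  proof (rule integrable_bounded_support[OF rm, of R "max \<bar>l\<bar> \<bar>r\<bar> * K"])
    show "riemann_data l r x * \<psi> (x, 0) = 0" if "norm x > R" for x using R[of "(x, 0)"] that by (simp add: norm_Pair)
    show "norm (riemann_data l r x * \<psi> (x, 0)) \<le> max \<bar>l\<bar> \<bar>r\<bar> * K" for x
      using K[of "(x, 0)"] by (auto simp: riemann_data_def abs_mult intro!: mult_mono)
  qed
qed

text \<open>A constant multiple of a divergence-free field that lives in \<open>future\<close>
  contributes nothing, so the balance is the one of the constant fan.\<close>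

lemma fan_wild_conservation:
  fixes f1 f2 f3 k1 k2 k3 g1 g2 g3 c \<nu> \<nu>' B :: real and \<psi> :: "spacetime \<Rightarrow> real" and m :: "spacetime \<Rightarrow> spacetime"
  assumes \<psi>: "C1c \<psi>" and \<nu>: "\<nu> < \<nu>'" and m: "weakly_div_free m" "m \<in> borel_measurable borel" "\<And>z. norm (m z) \<le> B"
    "\<And>z. z \<notin> future \<Longrightarrow> m z = 0"
  defines "F \<equiv> \<lambda>z. fan \<nu> \<nu>' f1 f2 f3 z * D \<psi> z E3 + fan \<nu> \<nu>' k1 k2 k3 z * D \<psi> z E1
           + fan \<nu> \<nu>' g1 g2 g3 z * D \<psi> z E2 + c * D \<psi> z (m z)"
  shows "(LINT z|lborel. indicator future z * F z) + (LINT x|lborel. riemann_data f1 f3 x * \<psi> (x, 0)) =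
     ((g2 - g1) - \<nu> * (f2 - f1)) * (LINT z|lborel. indicator (half \<nu>) z * D \<psi> z E2)
     + ((g3 - g2) - \<nu>' * (f3 - f2)) * (LINT z|lborel. indicator (half \<nu>') z * D \<psi> z E2)"
    and "integrable lborel (\<lambda>z. indicator future z * F z)" and "F \<in> borel_measurable borel"
proof -
  let ?F0 = "\<lambda>z. fan \<nu> \<nu>' f1 f2 f3 z * D \<psi> z E3 + fan \<nu> \<nu>' k1 k2 k3 z * D \<psi> z E1 + fan \<nu> \<nu>' g1 g2 g3 z * D \<psi> z E2"
  have fm: "(\<lambda>z. fan \<nu> \<nu>' a b d z) \<in> borel_measurable borel" for a b d :: real by (rule measurable_fan) simp
  have Dm: "(\<lambda>z. D \<psi> z h) \<in> borel_measurable borel" for h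
    using C1cD(2)[OF \<psi>] by (rule borel_measurable_continuous_onI)
  show "F \<in> borel_measurable borel"
    unfolding F_def by (intro borel_measurable_add borel_measurable_times fm Dm borel_measurable_D[OF \<psi> m(2)]) auto
  have iD: "integrable lborel (\<lambda>z. D \<psi> z h)" for h by (rule integrable_D[OF \<psi>, of "\<lambda>z. h" "norm h"]) auto
  have fD: "integrable lborel (\<lambda>z. indicator future z * (fan \<nu> \<nu>' a b d z * D \<psi> z h))" for a b d h
  proof (rule Bochner_Integration.integrable_bound)
    show "integrable lborel (\<lambda>z. (\<bar>a\<bar> + \<bar>b\<bar> + \<bar>d\<bar>) * D \<psi> z h)" using iD by simp
    show "(\<lambda>z. indicator future z * (fan \<nu> \<nu>' a b d z * D \<psi> z h)) \<in> borel_measurable lborel"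
      using fm Dm future_borel by (auto intro!: borel_measurable_times)
    show "AE z in lborel. norm (indicator future z * (fan \<nu> \<nu>' a b d z * D \<psi> z h)) \<le> norm ((\<bar>a\<bar> + \<bar>b\<bar> + \<bar>d\<bar>) * D \<psi> z h)"
      by (intro AE_I2) (auto simp: indicator_def fan_def abs_mult intro!: mult_right_mono)
  qed
  have i0: "integrable lborel (\<lambda>z. indicator future z * ?F0 z)"
    using fD[of f1 f2 f3 E3] fD[of k1 k2 k3 E1] fD[of g1 g2 g3 E2] by (simp add: distrib_left)
  have mF: "indicator future z * (c * D \<psi> z (m z)) = c * D \<psi> z (m z)" for z
    using m(4)[of z] linear_0[OF C1cD(3)[OF \<psi>]] by (cases "z \<in> future") auto
  have im: "integrable lborel (\<lambda>z. c * D \<psi> z (m z))" using integrable_D[OF \<psi> m(2,3)] by simp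
  have Fe: "indicator future z * F z = indicator future z * ?F0 z + c * D \<psi> z (m z)" for z
    unfolding F_def by (subst distrib_left) (simp only: mF)
  show "integrable lborel (\<lambda>z. indicator future z * F z)" unfolding Fe using i0 im by simp
  have "(LINT z|lborel. c * D \<psi> z (m z)) = 0" using m(1) \<psi> by (simp add: weakly_div_free_def)
  then have "(LINT z|lborel. indicator future z * F z) = (LINT z|lborel. indicator future z * ?F0 z)"
    unfolding Fe using i0 im by simp
  then show "(LINT z|lborel. indicator future z * F z) + (LINT x|lborel. riemann_data f1 f3 x * \<psi> (x, 0)) =
     ((g2 - g1) - \<nu> * (f2 - f1)) * (LINT z|lborel. indicator (half \<nu>) z * D \<psi> z E2)
     + ((g3 - g2) - \<nu>' * (f3 - f2)) * (LINT z|lborel. indicator (half \<nu>') z * D \<psi> z E2)"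
    using fan_conservation[OF \<psi> \<nu>] by simp
qed

section \<open>Admissibility of the perturbed fan\<close>

definition wedge :: "real \<Rightarrow> real \<Rightarrow> spacetime set" where
  "wedge \<nu> \<nu>' = {z. snd z > 0 \<and> \<nu> * snd z < fst z $ 2 \<and> fst z $ 2 < \<nu>' * snd z}"

lemma open_wedge: "open (wedge \<nu> \<nu>')"
  unfolding wedge_def by (intro open_Collect_conj open_Collect_less continuous_intros)

lemma wedge_nonempty:
  assumes "\<nu> < \<nu>'"
  shows "wedge \<nu> \<nu>' \<noteq> {}"
proof -
  have "(((\<nu> + \<nu>') / 2) *\<^sub>R axis 2 1, 1) \<in> wedge \<nu> \<nu>'"
    using assms by (simp add: wedge_def axis_def)
  then show ?thesis by blast
qed

lemma in_future_iff: "z \<in> future \<longleftrightarrow> snd z \<ge> 0"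
  by (cases z) (auto simp: future_def)

definition vel :: "real \<Rightarrow> real \<Rightarrow> real^2 \<Rightarrow> complex \<Rightarrow> real^2 \<Rightarrow> (spacetime \<Rightarrow> complex) \<Rightarrow> spacetime \<Rightarrow> real^2" where
  "vel \<nu> \<nu>' l V0 r v z = fan \<nu> \<nu>' l (vector [Re (V0 + v z), Im (V0 + v z)]) r z"

lemma norm_real2: "(norm (x::real^2))\<^sup>2 = (x $ 1)\<^sup>2 + (x $ 2)\<^sup>2"
  by (simp add: norm_vec_def L2_set_def sum_2)

text \<open>\<open>(q1, q2)\<close> is the actual velocity and \<open>(A, B)\<close> its deviation
  from \<open>(a, \<beta>)\<close>; \<open>X\<close> and \<open>Y\<close> are the real and imaginary
  part of the deviation of \<open>Z\<close>. The last two summands of each line collect into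
  \<open>r / 2\<close> times \<open>fld2\<close> and \<open>fld3\<close>, which contain
  \<open>2 V\<close> and \<open>2 U\<close>.\<close>

lemma momentum_flux_identity:
  fixes a \<beta> \<delta> r p q1 q2 A B X Y :: real
  assumes "q1 = a + A" "q2 = \<beta> + B" and "q1 * q1 = a\<^sup>2 + \<delta> + X / 2" "q2 * q2 = \<beta>\<^sup>2 + \<delta> - X / 2" "q1 * q2 = a * \<beta> + Y / 2"
  shows "r * (q1 * t1 + q2 * t2) + r * (q1 * q1 * d11 + q1 * q2 * d12 + (q1 * q2 * d21 + q2 * q2 * d22)) + p * (d11 + d22) =
    (r * a * t1 + (r * (a\<^sup>2 + \<delta>) + p) * d11 + r * a * \<beta> * d12 + r / 2 * (X * d11 + Y * d12 + 2 * A * t1)) +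
    (r * \<beta> * t2 + r * a * \<beta> * d21 + (r * (\<beta>\<^sup>2 + \<delta>) + p) * d22 + r / 2 * (Y * d21 + - X * d22 + 2 * B * t2))"
  unfolding assms(3-5) unfolding assms(1,2) by (simp add: field_simps)

text \<open>In the wedge every balance law is that of a constant state plus a constant multiple of a
  divergence-free field: \<open>r\<close> times \<open>fld1\<close> for the mass,
  \<open>r / 2\<close> times \<open>fld2\<close> and \<open>fld3\<close> for the two momentum
  components, and energy density plus pressure times \<open>fld1\<close> for the energy.\<close>

lemma wild_fan_solution:
  fixes \<gamma> \<rho>m \<rho>p r a \<beta> \<delta> \<nu> \<nu>' :: real and vm vp :: "real^2"
  assumes pos: "\<rho>m > 0" "\<rho>p > 0" "r > 0" "\<delta> > 0" and \<nu>: "\<nu> < \<nu>'"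
    and a: "vm $ 1 = a" "vp $ 1 = a"
    and mass: "\<nu> * (\<rho>m - r) = \<rho>m * vm $ 2 - r * \<beta>" "\<nu>' * (r - \<rho>p) = r * \<beta> - \<rho>p * vp $ 2"
    and mom: "\<nu> * (\<rho>m * vm $ 2 - r * \<beta>) = \<rho>m * (vm $ 2)\<^sup>2 + pressure \<gamma> \<rho>m - (r * \<beta>\<^sup>2 + pressure \<gamma> r + r * \<delta>)"
      "\<nu>' * (r * \<beta> - \<rho>p * vp $ 2) = (r * \<beta>\<^sup>2 + pressure \<gamma> r + r * \<delta>) - (\<rho>p * (vp $ 2)\<^sup>2 + pressure \<gamma> \<rho>p)"
    and en: "\<nu> * (\<rho>m * internal_energy \<gamma> \<rho>m + \<rho>m * ((a\<^sup>2 + (vm $ 2)\<^sup>2) / 2) - (r * internal_energy \<gamma> r + r * ((a\<^sup>2 + \<beta>\<^sup>2 + 2 * \<delta>) / 2)))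
      \<le> (\<rho>m * internal_energy \<gamma> \<rho>m + \<rho>m * ((a\<^sup>2 + (vm $ 2)\<^sup>2) / 2) + pressure \<gamma> \<rho>m) * vm $ 2
        - (r * internal_energy \<gamma> r + r * ((a\<^sup>2 + \<beta>\<^sup>2 + 2 * \<delta>) / 2) + pressure \<gamma> r) * \<beta>"
    "\<nu>' * ((r * internal_energy \<gamma> r + r * ((a\<^sup>2 + \<beta>\<^sup>2 + 2 * \<delta>) / 2)) - (\<rho>p * internal_energy \<gamma> \<rho>p + \<rho>p * ((a\<^sup>2 + (vp $ 2)\<^sup>2) / 2)))
      \<le> (r * internal_energy \<gamma> r + r * ((a\<^sup>2 + \<beta>\<^sup>2 + 2 * \<delta>) / 2) + pressure \<gamma> r) * \<beta>
       - (\<rho>p * internal_energy \<gamma> \<rho>p + \<rho>p * ((a\<^sup>2 + (vp $ 2)\<^sup>2) / 2) + pressure \<gamma> \<rho>p) * vp $ 2"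
  defines "V0 \<equiv> Complex a \<beta>" and "C \<equiv> a\<^sup>2 + \<beta>\<^sup>2 + 2 * \<delta>"
  assumes wild: "wild (wedge \<nu> \<nu>') C V0 (V0\<^sup>2) v w"
  shows "admissible_weak_solution \<gamma> (riemann_data \<rho>m \<rho>p) (riemann_data vm vp) (fan \<nu> \<nu>' \<rho>m r \<rho>p) (vel \<nu> \<nu>' vm V0 vp v)"
proof -
  define \<rho> where "\<rho> = fan \<nu> \<nu>' \<rho>m r \<rho>p"
  define u where "u = vel \<nu> \<nu>' vm V0 vp v"
  note wd = wildD[OF wild]
  \<comment> \<open>The region where \<open>fan\<close> takes its middle value contains the lower
    edge, unlike the open \<open>wedge\<close>. Within \<open>future\<close> the two differ only on
    the hyperplane \<open>x2 = \<nu> t\<close>, which is a null set.\<close>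
  define mid where "mid z \<longleftrightarrow> \<nu> * snd z \<le> fst z $ 2 \<and> fst z $ 2 < \<nu>' * snd z" for z :: spacetime
  have wedge_future: "wedge \<nu> \<nu>' \<subseteq> future" by (auto simp: wedge_def in_future_iff)
  have vw0: "v z = 0 \<and> w z = 0" if "\<not> mid z" for z
  proof -
    have "z \<notin> wedge \<nu> \<nu>'" using that by (auto simp: wedge_def mid_def)
    then show ?thesis using wd(5,6) by blast
  qed
  have AEm: "AE z in lborel. z \<in> future \<longrightarrow> mid z \<longrightarrow> (cmod (V0 + v z))\<^sup>2 = C \<and> V0\<^sup>2 + w z = (V0 + v z)\<^sup>2"
  proof -
    let ?H = "{z::spacetime. (axis 2 1, - \<nu>) \<bullet> z = 0}"
    have "(axis 2 1, - \<nu>) \<noteq> (0::spacetime)" by (auto simp: zero_prod_def axis_eq_0_iff)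
    then have "?H \<in> null_sets lebesgue"
      using negligible_hyperplane[of "(axis 2 1, - \<nu>) :: spacetime" 0] by (simp add: negligible_iff_null_sets)
    moreover have "closed ?H" by (intro closed_hyperplane)
    ultimately have "?H \<in> null_sets lborel" by (simp add: null_sets_def borel_closed)
    then have "AE z in lborel. z \<notin> ?H" by (rule AE_not_in)
    then show ?thesis using wd(8)
    proof eventually_elim
      case (elim z)
      show ?case
      proof (intro impI)
        assume z: "z \<in> future" "mid z"
        have "fst z $ 2 \<noteq> \<nu> * snd z" using elim(1) by (auto simp: inner_spacetime axis_def)
        then have lt: "\<nu> * snd z < fst z $ 2" "fst z $ 2 < \<nu>' * snd z" using z(2) by (auto simp: mid_def)
        have "snd z \<ge> 0" using z(1) by (simp add: in_future_iff)
        moreover have "snd z \<noteq> 0" using lt by auto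
        ultimately have "z \<in> wedge \<nu> \<nu>'" using lt by (simp add: wedge_def)
        then show "(cmod (V0 + v z))\<^sup>2 = C \<and> V0\<^sup>2 + w z = (V0 + v z)\<^sup>2" using elim(2) by blast
      qed
    qed
  qed
  have \<rho>m': "\<rho> \<in> borel_measurable borel" unfolding \<rho>_def by (rule measurable_fan[of "\<lambda>_. r"]) simp
  have pm: "(\<lambda>z. pressure \<gamma> (\<rho> z)) \<in> borel_measurable borel"
  proof -
    have "pressure \<gamma> (\<rho> z) = fan \<nu> \<nu>' (pressure \<gamma> \<rho>m) (pressure \<gamma> r) (pressure \<gamma> \<rho>p) z" for z
      by (simp add: \<rho>_def fan_def)
    then show ?thesis using measurable_fan[of "\<lambda>_. pressure \<gamma> r"] by simp
  qed
  have uc: "u z $ 1 = fan \<nu> \<nu>' a (Re (V0 + v z)) a z" "u z $ 2 = fan \<nu> \<nu>' (vm $ 2) (Im (V0 + v z)) (vp $ 2) z" for z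
    by (auto simp: u_def vel_def fan_def vector_2 a)
  have um: "(\<lambda>z. u z $ 1) \<in> borel_measurable borel" "(\<lambda>z. u z $ 2) \<in> borel_measurable borel"
    unfolding uc using wd(1) by (intro measurable_fan borel_measurable_Re borel_measurable_Im; measurable)+
  have umv: "u \<in> borel_measurable borel"
  proof -
    have "u = (\<lambda>z. (u z $ 1) *\<^sub>R axis 1 1 + (u z $ 2) *\<^sub>R axis 2 1)"
      by (auto simp: fun_eq_iff vec_eq_iff forall_2 axis_def)
    moreover have "(\<lambda>z. (u z $ 1) *\<^sub>R (axis 1 1 :: real^2) + (u z $ 2) *\<^sub>R axis 2 1) \<in> borel_measurable borel"
      using um by (intro borel_measurable_add borel_measurable_scaleR) auto
    ultimately show ?thesis by simp
  qed
  have norm_mid: "norm (u z) = cmod (V0 + v z)" if "mid z" for z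
  proof -
    have "(norm (u z))\<^sup>2 = (cmod (V0 + v z))\<^sup>2"
      using that unfolding norm_real2 uc cmod_power2 by (simp add: fan_def mid_def)
    then show ?thesis by (simp add: power2_eq_iff_nonneg)
  qed
  have ub: "norm (u z) \<le> norm vm + norm vp + sqrt C" for z
  proof (cases "mid z")
    case True
    show ?thesis unfolding norm_mid[OF True] using wd(3)[of z] norm_ge_zero[of vm] norm_ge_zero[of vp] by linarith
  next
    case False
    then have "u z = vm \<or> u z = vp" by (auto simp: u_def vel_def fan_def mid_def)
    moreover have "sqrt C \<ge> 0" using pos by (simp add: C_def)
    ultimately show ?thesis using norm_ge_zero[of vm] norm_ge_zero[of vp] by auto
  qed
  have leb: "f \<in> borel_measurable (lebesgue_on future)" if "f \<in> borel_measurable borel"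
    for f :: "spacetime \<Rightarrow> 'c::{real_normed_vector, second_countable_topology}"
    using that by (intro measurable_restrict_space1 measurable_completion) simp
  have L\<rho>: "Linfty \<rho>" unfolding Linfty_def
    using leb[OF \<rho>m'] by (intro conjI exI[of _ "\<bar>\<rho>m\<bar> + \<bar>r\<bar> + \<bar>\<rho>p\<bar>"] AE_I2) (auto simp: \<rho>_def fan_def)
  have Lu: "Linfty u" unfolding Linfty_def using leb[OF umv] ub by blast
  have \<rho>pos: "AE z in lebesgue_on future. \<rho> z > 0" using pos by (intro AE_I2) (auto simp: \<rho>_def fan_def)
  have vwm: "v \<in> borel_measurable borel" "w \<in> borel_measurable borel" by (rule wd)+
  have vwb: "2 * (cmod (v z) + cmod (w z)) \<le> 2 * ((sqrt C + cmod V0) + (2 * C + cmod (V0\<^sup>2)))" for z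
    by (intro mult_left_mono add_mono wd(9,10)) simp
  have out: "fld1 (v z) (w z) = 0 \<and> fld2 (v z) (w z) = 0 \<and> fld3 (v z) (w z) = 0" if "z \<notin> future" for z
  proof -
    have "v z = 0" "w z = 0" using wd(5,6) wedge_future that by blast+
    then show ?thesis by (simp add: fld1_def fld2_def fld3_def zero_prod_def vec_eq_iff forall_2 vector_2)
  qed
  note lin = wd(7)[unfolded lin_euler_def]
  note c1 = fan_wild_conservation[OF _ \<nu> _ borel_measurable_fld(1)[OF vwm] order_trans[OF norm_fld_le(1) vwb]]
  note c2 = fan_wild_conservation[OF _ \<nu> _ borel_measurable_fld(2)[OF vwm] order_trans[OF norm_fld_le(2) vwb]]
  note c3 = fan_wild_conservation[OF _ \<nu> _ borel_measurable_fld(3)[OF vwm] order_trans[OF norm_fld_le(3) vwb]]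
  have Dm: "(\<lambda>z. D \<psi> z h) \<in> borel_measurable borel" if "C1c \<psi>" for \<psi> h
    using C1cD(2)[OF that] by (rule borel_measurable_continuous_onI)
  have mass_eq: "(LINT z|lebesgue_on future. \<rho> z * dt \<psi> z + (\<rho> z *\<^sub>R u z) \<bullet> grad_x \<psi> z)
        + (LINT x|lebesgue. riemann_data \<rho>m \<rho>p x * \<psi> (x, 0)) = 0" if t: "test_function \<psi>" for \<psi> :: "spacetime \<Rightarrow> real"
  proof -
    note \<psi> = test_function_C1c[OF t]
    let ?F = "\<lambda>z. fan \<nu> \<nu>' \<rho>m r \<rho>p z * D \<psi> z E3 + fan \<nu> \<nu>' (\<rho>m * a) (r * a) (\<rho>p * a) z * D \<psi> z E1
           + fan \<nu> \<nu>' (\<rho>m * vm $ 2) (r * \<beta>) (\<rho>p * vp $ 2) z * D \<psi> z E2 + r * D \<psi> z (fld1 (v z) (w z))"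
    have eq: "\<rho> z * dt \<psi> z + (\<rho> z *\<^sub>R u z) \<bullet> grad_x \<psi> z = ?F z" for z
    proof -
      have "\<rho> z * dt \<psi> z + (\<rho> z *\<^sub>R u z) \<bullet> grad_x \<psi> z = \<rho> z * D \<psi> z E3 + \<rho> z * (u z $ 1 * D \<psi> z E1 + u z $ 2 * D \<psi> z E2)"
        by (simp add: dt_def grad_x_def dx_def inner_vec_def sum_2 distrib_left mult.assoc)
      also have "\<dots> = ?F z"
        unfolding C1c_decomp[OF \<psi>, of z "fld1 (v z) (w z)"] uc
        using vw0[of z] by (auto simp: \<rho>_def fan_def mid_def fld1_def vector_2 V0_def algebra_simps)
      finally show ?thesis .
    qed
    note c = c1[OF \<psi>, where c = r and ?f1.0 = \<rho>m and ?f2.0 = r and ?f3.0 = \<rho>p and ?k1.0 = "\<rho>m * a" and ?k2.0 = "r * a" and ?k3.0 = "\<rho>p * a"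
        and ?g1.0 = "\<rho>m * vm $ 2" and ?g2.0 = "r * \<beta>" and ?g3.0 = "\<rho>p * vp $ 2"]
    have c': "(LINT z|lborel. indicator future z * ?F z) + (LINT x|lborel. riemann_data \<rho>m \<rho>p x * \<psi> (x, 0)) =
     ((r * \<beta> - \<rho>m * vm $ 2) - \<nu> * (r - \<rho>m)) * (LINT z|lborel. indicator (half \<nu>) z * D \<psi> z E2)
     + ((\<rho>p * vp $ 2 - r * \<beta>) - \<nu>' * (\<rho>p - r)) * (LINT z|lborel. indicator (half \<nu>') z * D \<psi> z E2)"
      by (rule c(1)) (use lin out in auto)
    have Fm: "?F \<in> borel_measurable borel" by (rule c(3)) (use lin out in auto)
    have z: "(r * \<beta> - \<rho>m * vm $ 2) - \<nu> * (r - \<rho>m) = 0" "(\<rho>p * vp $ 2 - r * \<beta>) - \<nu>' * (\<rho>p - r) = 0"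
      using mass by (simp_all add: algebra_simps)
    show ?thesis unfolding eq integral_lebesgue_on_future[OF Fm] riemann_trace(1)[OF \<psi>] c' z by simp
  qed
  have mom_eq: "(LINT z|lebesgue_on future. (\<rho> z *\<^sub>R u z) \<bullet> dt \<phi> z
           + \<rho> z * frobenius (u z \<otimes>\<^sub>t u z) (jacobian_x \<phi> z) + pressure \<gamma> (\<rho> z) * div_x \<phi> z)
        + (LINT x|lebesgue. (riemann_data \<rho>m \<rho>p x *\<^sub>R riemann_data vm vp x) \<bullet> \<phi> (x, 0)) = 0"
    if t: "test_function \<phi>" for \<phi> :: "spacetime \<Rightarrow> real^2"
  proof -
    define \<phi>1 \<phi>2 where "\<phi>1 z = \<phi> z $ 1" and "\<phi>2 z = \<phi> z $ 2" for z
    have \<phi>: "C1c \<phi>1" "C1c \<phi>2" using test_function_component(1)[OF t] by (simp_all add: \<phi>1_def[abs_def] \<phi>2_def[abs_def])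
    have fr: "frechet_derivative \<phi> (at z) h $ 1 = D \<phi>1 z h" "frechet_derivative \<phi> (at z) h $ 2 = D \<phi>2 z h" for z h
      using test_function_component(2)[OF t] by (simp_all add: \<phi>1_def[abs_def] \<phi>2_def[abs_def])
    let ?pm = "pressure \<gamma> \<rho>m" and ?pc = "pressure \<gamma> r" and ?pp = "pressure \<gamma> \<rho>p"
    let ?M = "\<lambda>z. \<rho> z * (u z $ 1 * D \<phi>1 z E3 + u z $ 2 * D \<phi>2 z E3)
       + \<rho> z * (u z $ 1 * u z $ 1 * D \<phi>1 z E1 + u z $ 1 * u z $ 2 * D \<phi>1 z E2 + (u z $ 1 * u z $ 2 * D \<phi>2 z E1 + u z $ 2 * u z $ 2 * D \<phi>2 z E2))
       + pressure \<gamma> (\<rho> z) * (D \<phi>1 z E1 + D \<phi>2 z E2)"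
    have eqM: "(\<rho> z *\<^sub>R u z) \<bullet> dt \<phi> z + \<rho> z * frobenius (u z \<otimes>\<^sub>t u z) (jacobian_x \<phi> z) + pressure \<gamma> (\<rho> z) * div_x \<phi> z = ?M z" for z
      by (simp add: dt_def jacobian_x_def div_x_def dx_def frobenius_def tensor_product_def inner_vec_def sum_2 fr algebra_simps)
    have Mm: "?M \<in> borel_measurable borel"
      by (intro borel_measurable_add borel_measurable_times \<rho>m' um Dm \<phi> pm)
    let ?F1 = "\<lambda>z. fan \<nu> \<nu>' (\<rho>m * a) (r * a) (\<rho>p * a) z * D \<phi>1 z E3
      + fan \<nu> \<nu>' (\<rho>m * a\<^sup>2 + ?pm) (r * (a\<^sup>2 + \<delta>) + ?pc) (\<rho>p * a\<^sup>2 + ?pp) z * D \<phi>1 z E1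
      + fan \<nu> \<nu>' (\<rho>m * a * vm $ 2) (r * a * \<beta>) (\<rho>p * a * vp $ 2) z * D \<phi>1 z E2 + r / 2 * D \<phi>1 z (fld2 (v z) (w z))"
    let ?F2 = "\<lambda>z. fan \<nu> \<nu>' (\<rho>m * vm $ 2) (r * \<beta>) (\<rho>p * vp $ 2) z * D \<phi>2 z E3
      + fan \<nu> \<nu>' (\<rho>m * a * vm $ 2) (r * a * \<beta>) (\<rho>p * a * vp $ 2) z * D \<phi>2 z E1
      + fan \<nu> \<nu>' (\<rho>m * (vm $ 2)\<^sup>2 + ?pm) (r * (\<beta>\<^sup>2 + \<delta>) + ?pc) (\<rho>p * (vp $ 2)\<^sup>2 + ?pp) z * D \<phi>2 z E2 + r / 2 * D \<phi>2 z (fld3 (v z) (w z))"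
    have AEM: "AE z in lborel. indicator future z * ?M z = indicator future z * ?F1 z + indicator future z * ?F2 z"
      using AEm
    proof eventually_elim
      case (elim z)
      show ?case
      proof (cases "z \<in> future")
        case True
        have "?M z = ?F1 z + ?F2 z"
        proof (cases "mid z")
          case False
          then have vw: "v z = 0" "w z = 0" using vw0 by auto
          have "\<not> (\<nu> * snd z \<le> fst z $ 2 \<and> fst z $ 2 < \<nu>' * snd z)" using False by (simp add: mid_def)
          then show ?thesis
            unfolding C1c_decomp[OF \<phi>(1), of z "fld2 (v z) (w z)"] C1c_decomp[OF \<phi>(2), of z "fld3 (v z) (w z)"] uc
            by (auto simp: \<rho>_def fan_def fld2_def fld3_def vector_2 vw power2_eq_square algebra_simps)
        next
          case mz: True
          have f: "fan \<nu> \<nu>' x1 x2 x3 z = x2" for x1 x2 x3 :: real using mz by (simp add: fan_def mid_def)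
          have e: "(cmod (V0 + v z))\<^sup>2 = C" "V0\<^sup>2 + w z = (V0 + v z)\<^sup>2" using elim True mz by auto
          define q1 q2 where "q1 = a + Re (v z)" and "q2 = \<beta> + Im (v z)"
          have s1: "q1 * q1 + q2 * q2 = a\<^sup>2 + \<beta>\<^sup>2 + 2 * \<delta>"
            using e(1) unfolding cmod_power2 by (simp add: q1_def q2_def V0_def C_def power2_eq_square)
          have s2: "a\<^sup>2 - \<beta>\<^sup>2 + Re (w z) = q1 * q1 - q2 * q2"
            using arg_cong[OF e(2), of Re] by (simp add: q1_def q2_def V0_def power2_eq_square)
          have s3: "2 * a * \<beta> + Im (w z) = 2 * (q1 * q2)"
            using arg_cong[OF e(2), of Im] by (simp add: q1_def q2_def V0_def power2_eq_square algebra_simps)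
          \<comment> \<open>The modulus gives the sum of the squared components, the real part of
            \<open>Z = V\<^sup>2\<close> their difference, and the imaginary part their product.
            Together they determine the whole momentum tensor.\<close>
          have q: "q1 * q1 = a\<^sup>2 + \<delta> + Re (w z) / 2" "q2 * q2 = \<beta>\<^sup>2 + \<delta> - Re (w z) / 2" "q1 * q2 = a * \<beta> + Im (w z) / 2"
            using s1 s2 s3 by simp_all
          have u12: "u z $ 1 = q1" "u z $ 2 = q2" unfolding uc f by (simp_all add: q1_def q2_def V0_def)
          have \<rho>z: "\<rho> z = r" by (simp add: \<rho>_def f)
          show ?thesis
            unfolding C1c_decomp[OF \<phi>(1), of z "fld2 (v z) (w z)"] C1c_decomp[OF \<phi>(2), of z "fld3 (v z) (w z)"] u12 \<rho>z f
            using momentum_flux_identity[OF q1_def q2_def q, of r "D \<phi>1 z E3" "D \<phi>2 z E3" "D \<phi>1 z E1" "D \<phi>1 z E2" "D \<phi>2 z E1" "D \<phi>2 z E2" ?pc]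
            by (simp add: fld2_def fld3_def vector_2)
        qed
        then show ?thesis by (simp only: distrib_left)
      qed simp
    qed
    note d1 = c2[OF \<phi>(1), where c = "r / 2" and ?f1.0 = "\<rho>m * a" and ?f2.0 = "r * a" and ?f3.0 = "\<rho>p * a"
        and ?k1.0 = "\<rho>m * a\<^sup>2 + ?pm" and ?k2.0 = "r * (a\<^sup>2 + \<delta>) + ?pc" and ?k3.0 = "\<rho>p * a\<^sup>2 + ?pp"
        and ?g1.0 = "\<rho>m * a * vm $ 2" and ?g2.0 = "r * a * \<beta>" and ?g3.0 = "\<rho>p * a * vp $ 2"]
    note d2 = c3[OF \<phi>(2), where c = "r / 2" and ?f1.0 = "\<rho>m * vm $ 2" and ?f2.0 = "r * \<beta>" and ?f3.0 = "\<rho>p * vp $ 2"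
        and ?k1.0 = "\<rho>m * a * vm $ 2" and ?k2.0 = "r * a * \<beta>" and ?k3.0 = "\<rho>p * a * vp $ 2"
        and ?g1.0 = "\<rho>m * (vm $ 2)\<^sup>2 + ?pm" and ?g2.0 = "r * (\<beta>\<^sup>2 + \<delta>) + ?pc" and ?g3.0 = "\<rho>p * (vp $ 2)\<^sup>2 + ?pp"]
    \<comment> \<open>The tangential velocity is \<open>a\<close> in all three states, so the
      tangential momentum relations are \<open>a\<close> times the mass relations.\<close>
    have z1: "(r * a * \<beta> - \<rho>m * a * vm $ 2) - \<nu> * (r * a - \<rho>m * a) = 0" "(\<rho>p * a * vp $ 2 - r * a * \<beta>) - \<nu>' * (\<rho>p * a - r * a) = 0"
    proof -
      have "a * (\<nu> * (\<rho>m - r)) = a * (\<rho>m * vm $ 2 - r * \<beta>)" "a * (\<nu>' * (r - \<rho>p)) = a * (r * \<beta> - \<rho>p * vp $ 2)" using mass by simp_all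
      then show "(r * a * \<beta> - \<rho>m * a * vm $ 2) - \<nu> * (r * a - \<rho>m * a) = 0" "(\<rho>p * a * vp $ 2 - r * a * \<beta>) - \<nu>' * (\<rho>p * a - r * a) = 0"
        by (simp_all add: algebra_simps)
    qed
    have z2: "((r * (\<beta>\<^sup>2 + \<delta>) + ?pc) - (\<rho>m * (vm $ 2)\<^sup>2 + ?pm)) - \<nu> * (r * \<beta> - \<rho>m * vm $ 2) = 0"
      "((\<rho>p * (vp $ 2)\<^sup>2 + ?pp) - (r * (\<beta>\<^sup>2 + \<delta>) + ?pc)) - \<nu>' * (\<rho>p * vp $ 2 - r * \<beta>) = 0"
      using mom by (simp_all add: algebra_simps)
    have i1: "(LINT z|lborel. indicator future z * ?F1 z) + (LINT x|lborel. riemann_data (\<rho>m * a) (\<rho>p * a) x * \<phi>1 (x, 0)) =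
       ((r * a * \<beta> - \<rho>m * a * vm $ 2) - \<nu> * (r * a - \<rho>m * a)) * (LINT z|lborel. indicator (half \<nu>) z * D \<phi>1 z E2)
       + ((\<rho>p * a * vp $ 2 - r * a * \<beta>) - \<nu>' * (\<rho>p * a - r * a)) * (LINT z|lborel. indicator (half \<nu>') z * D \<phi>1 z E2)"
      by (rule d1(1)) (use lin out in auto)
    have i2: "(LINT z|lborel. indicator future z * ?F2 z) + (LINT x|lborel. riemann_data (\<rho>m * vm $ 2) (\<rho>p * vp $ 2) x * \<phi>2 (x, 0)) =
       (((r * (\<beta>\<^sup>2 + \<delta>) + ?pc) - (\<rho>m * (vm $ 2)\<^sup>2 + ?pm)) - \<nu> * (r * \<beta> - \<rho>m * vm $ 2)) * (LINT z|lborel. indicator (half \<nu>) z * D \<phi>2 z E2)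
       + (((\<rho>p * (vp $ 2)\<^sup>2 + ?pp) - (r * (\<beta>\<^sup>2 + \<delta>) + ?pc)) - \<nu>' * (\<rho>p * vp $ 2 - r * \<beta>)) * (LINT z|lborel. indicator (half \<nu>') z * D \<phi>2 z E2)"
      by (rule d2(1)) (use lin out in auto)
    have j1: "integrable lborel (\<lambda>z. indicator future z * ?F1 z)" by (rule d1(2)) (use lin out in auto)
    have j2: "integrable lborel (\<lambda>z. indicator future z * ?F2 z)" by (rule d2(2)) (use lin out in auto)
    have "(LINT z|lborel. indicator future z * ?M z) = (LINT z|lborel. indicator future z * ?F1 z + indicator future z * ?F2 z)"
    proof (rule integral_cong_AE[OF _ _ AEM])
      show "(\<lambda>z. indicator future z * ?M z) \<in> borel_measurable lborel"
        using Mm future_borel by (simp add: borel_measurable_times borel_measurable_indicator)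
      show "(\<lambda>z. indicator future z * ?F1 z + indicator future z * ?F2 z) \<in> borel_measurable lborel"
        by (rule borel_measurable_add[OF borel_measurable_integrable[OF j1] borel_measurable_integrable[OF j2]])
    qed
    also have "\<dots> = (LINT z|lborel. indicator future z * ?F1 z) + (LINT z|lborel. indicator future z * ?F2 z)"
      by (rule Bochner_Integration.integral_add[OF j1 j2])
    finally have IM: "(LINT z|lborel. indicator future z * ?M z) = \<dots>" .
    have rx: "(riemann_data \<rho>m \<rho>p x *\<^sub>R riemann_data vm vp x) \<bullet> \<phi> (x, 0) =
        riemann_data (\<rho>m * a) (\<rho>p * a) x * \<phi>1 (x, 0) + riemann_data (\<rho>m * vm $ 2) (\<rho>p * vp $ 2) x * \<phi>2 (x, 0)" for x
      by (auto simp: riemann_data_def inner_vec_def sum_2 \<phi>1_def \<phi>2_def a algebra_simps)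
    have "(LINT x|lebesgue. (riemann_data \<rho>m \<rho>p x *\<^sub>R riemann_data vm vp x) \<bullet> \<phi> (x, 0)) =
        (LINT x|lborel. riemann_data (\<rho>m * a) (\<rho>p * a) x * \<phi>1 (x, 0) + riemann_data (\<rho>m * vm $ 2) (\<rho>p * vp $ 2) x * \<phi>2 (x, 0))"
      unfolding rx using riemann_trace(3)[OF \<phi>(1)] riemann_trace(3)[OF \<phi>(2)] by (intro integral_completion) simp
    also have "\<dots> = (LINT x|lborel. riemann_data (\<rho>m * a) (\<rho>p * a) x * \<phi>1 (x, 0)) + (LINT x|lborel. riemann_data (\<rho>m * vm $ 2) (\<rho>p * vp $ 2) x * \<phi>2 (x, 0))"
      by (rule Bochner_Integration.integral_add[OF riemann_trace(2)[OF \<phi>(1)] riemann_trace(2)[OF \<phi>(2)]])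
    finally show ?thesis
      unfolding eqM integral_lebesgue_on_future[OF Mm] IM using i1 i2 unfolding z1 z2 by simp
  qed
  have en_ge: "(LINT z|lebesgue_on future. energy \<gamma> (\<rho> z) (u z) * dt \<phi> z
           + (energy \<gamma> (\<rho> z) (u z) + pressure \<gamma> (\<rho> z)) * (u z \<bullet> grad_x \<phi> z))
        + (LINT x|lebesgue. energy \<gamma> (riemann_data \<rho>m \<rho>p x) (riemann_data vm vp x) * \<phi> (x, 0)) \<ge> 0"
    if t: "test_function \<phi>" "\<forall>z\<in>future. \<phi> z \<ge> 0" for \<phi> :: "spacetime \<Rightarrow> real"
  proof -
    note \<phi> = test_function_C1c[OF t(1)]
    define Em Ec Ep where "Em = \<rho>m * internal_energy \<gamma> \<rho>m + \<rho>m * ((a\<^sup>2 + (vm $ 2)\<^sup>2) / 2)"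
      and "Ec = r * internal_energy \<gamma> r + r * ((a\<^sup>2 + \<beta>\<^sup>2 + 2 * \<delta>) / 2)"
      and "Ep = \<rho>p * internal_energy \<gamma> \<rho>p + \<rho>p * ((a\<^sup>2 + (vp $ 2)\<^sup>2) / 2)"
    let ?pm = "pressure \<gamma> \<rho>m" and ?pc = "pressure \<gamma> r" and ?pp = "pressure \<gamma> \<rho>p"
    have E: "energy \<gamma> \<rho>m vm = Em" "energy \<gamma> \<rho>p vp = Ep" by (simp_all add: energy_def Em_def Ep_def norm_real2 a)
    let ?M = "\<lambda>z. energy \<gamma> (\<rho> z) (u z) * D \<phi> z E3
           + (energy \<gamma> (\<rho> z) (u z) + pressure \<gamma> (\<rho> z)) * (u z $ 1 * D \<phi> z E1 + u z $ 2 * D \<phi> z E2)"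
    have eqM: "energy \<gamma> (\<rho> z) (u z) * dt \<phi> z + (energy \<gamma> (\<rho> z) (u z) + pressure \<gamma> (\<rho> z)) * (u z \<bullet> grad_x \<phi> z) = ?M z" for z
      by (simp add: dt_def grad_x_def dx_def inner_vec_def sum_2)
    have im: "(\<lambda>z. internal_energy \<gamma> (\<rho> z)) \<in> borel_measurable borel"
    proof -
      have "internal_energy \<gamma> (\<rho> z) = fan \<nu> \<nu>' (internal_energy \<gamma> \<rho>m) (internal_energy \<gamma> r) (internal_energy \<gamma> \<rho>p) z" for z
        by (simp add: \<rho>_def fan_def)
      then show ?thesis using measurable_fan[of "\<lambda>_. internal_energy \<gamma> r"] by simp
    qed
    have Emeas: "(\<lambda>z. energy \<gamma> (\<rho> z) (u z)) \<in> borel_measurable borel"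
      unfolding energy_def using \<rho>m' im umv
      by (intro borel_measurable_add borel_measurable_times borel_measurable_divide borel_measurable_power borel_measurable_norm) auto
    have Mm: "?M \<in> borel_measurable borel"
      by (intro borel_measurable_add borel_measurable_times Emeas um Dm \<phi> pm)
    let ?F = "\<lambda>z. fan \<nu> \<nu>' Em Ec Ep z * D \<phi> z E3
      + fan \<nu> \<nu>' ((Em + ?pm) * a) ((Ec + ?pc) * a) ((Ep + ?pp) * a) z * D \<phi> z E1
      + fan \<nu> \<nu>' ((Em + ?pm) * vm $ 2) ((Ec + ?pc) * \<beta>) ((Ep + ?pp) * vp $ 2) z * D \<phi> z E2 + (Ec + ?pc) * D \<phi> z (fld1 (v z) (w z))"
    have AEM: "AE z in lborel. indicator future z * ?M z = indicator future z * ?F z"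
      using AEm
    proof eventually_elim
      case (elim z)
      show ?case
      proof (cases "z \<in> future")
        case True
        have "?M z = ?F z"
        proof (cases "mid z")
          case False
          then have vw: "v z = 0" "w z = 0" using vw0 by auto
          have "\<not> (\<nu> * snd z \<le> fst z $ 2 \<and> fst z $ 2 < \<nu>' * snd z)" using False by (simp add: mid_def)
          moreover have "u z = fan \<nu> \<nu>' vm (vector [Re V0, Im V0]) vp z" by (simp add: u_def vel_def vw)
          ultimately show ?thesis
            unfolding C1c_decomp[OF \<phi>, of z "fld1 (v z) (w z)"]
            by (auto simp: \<rho>_def fan_def fld1_def vector_2 vw E a algebra_simps)
        next
          case mz: True
          have f: "fan \<nu> \<nu>' x1 x2 x3 z = x2" for x1 x2 x3 :: real using mz by (simp add: fan_def mid_def)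
          have "(norm (u z))\<^sup>2 = C" using elim True mz norm_mid[OF mz] by simp
          then have e: "energy \<gamma> (\<rho> z) (u z) = Ec" by (simp add: energy_def \<rho>_def f Ec_def C_def)
          have \<rho>z: "\<rho> z = r" by (simp add: \<rho>_def f)
          show ?thesis
            unfolding C1c_decomp[OF \<phi>, of z "fld1 (v z) (w z)"] e uc f
            by (simp add: fld1_def vector_2 V0_def \<rho>z algebra_simps)
        qed
        then show ?thesis by simp
      qed simp
    qed
    note d = c1[OF \<phi>, where c = "Ec + ?pc" and ?f1.0 = Em and ?f2.0 = Ec and ?f3.0 = Ep
        and ?k1.0 = "(Em + ?pm) * a" and ?k2.0 = "(Ec + ?pc) * a" and ?k3.0 = "(Ep + ?pp) * a"
        and ?g1.0 = "(Em + ?pm) * vm $ 2" and ?g2.0 = "(Ec + ?pc) * \<beta>" and ?g3.0 = "(Ep + ?pp) * vp $ 2"]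
    have i1: "(LINT z|lborel. indicator future z * ?F z) + (LINT x|lborel. riemann_data Em Ep x * \<phi> (x, 0)) =
       (((Ec + ?pc) * \<beta> - (Em + ?pm) * vm $ 2) - \<nu> * (Ec - Em)) * (LINT z|lborel. indicator (half \<nu>) z * D \<phi> z E2)
       + (((Ep + ?pp) * vp $ 2 - (Ec + ?pc) * \<beta>) - \<nu>' * (Ep - Ec)) * (LINT z|lborel. indicator (half \<nu>') z * D \<phi> z E2)"
      by (rule d(1)) (use lin out in auto)
    have Fm: "?F \<in> borel_measurable borel" by (rule d(3)) (use lin out in auto)
    have s: "((Ec + ?pc) * \<beta> - (Em + ?pm) * vm $ 2) - \<nu> * (Ec - Em) \<le> 0" "((Ep + ?pp) * vp $ 2 - (Ec + ?pc) * \<beta>) - \<nu>' * (Ep - Ec) \<le> 0"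
      using en unfolding Em_def[symmetric] Ec_def[symmetric] Ep_def[symmetric] by (simp_all add: algebra_simps)
    have "(LINT z|lborel. indicator future z * ?M z) = (LINT z|lborel. indicator future z * ?F z)"
    proof (rule integral_cong_AE[OF _ _ AEM])
      show "(\<lambda>z. indicator future z * ?M z) \<in> borel_measurable lborel" "(\<lambda>z. indicator future z * ?F z) \<in> borel_measurable lborel"
        using Mm Fm future_borel by (simp_all add: borel_measurable_times borel_measurable_indicator)
    qed
    moreover have "energy \<gamma> (riemann_data \<rho>m \<rho>p x) (riemann_data vm vp x) = riemann_data Em Ep x" for x
      by (simp add: riemann_data_def E)
    \<comment> \<open>Both energy defects are nonpositive, and so are both integrals over
      \<open>half\<close>; hence each product is nonnegative.\<close>
    moreover have "(LINT z|lborel. indicator future z * ?F z) + (LINT x|lborel. riemann_data Em Ep x * \<phi> (x, 0)) \<ge> 0"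
      unfolding i1 using s t(2) integral_half_D2_le_0[OF \<phi>] by (intro add_nonneg_nonneg mult_nonpos_nonpos) auto
    ultimately show ?thesis
      unfolding eqM integral_lebesgue_on_future[OF Mm] by (simp add: riemann_trace(1)[OF \<phi>])
  qed
  show ?thesis
    unfolding admissible_weak_solution_def weak_solution_def \<rho>_def[symmetric] u_def[symmetric]
    using L\<rho> Lu \<rho>pos mass_eq mom_eq en_ge by blast
qed

theorem theorem1:
  fixes \<gamma> \<rho>m \<rho>p :: real and vm vp :: "real^2"
  assumes "\<gamma> \<ge> 1"
    and "\<rho>m > 0" and "\<rho>p > 0"
    and "vm $ 1 = vp $ 1"
    and "vp $ 2 - vm $ 2 <
           - sqrt ((\<rho>m - \<rho>p) * (pressure \<gamma> \<rho>m - pressure \<gamma> \<rho>p) / (\<rho>m * \<rho>p))"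
  shows "\<exists>S :: ((spacetime \<Rightarrow> real) \<times> (spacetime \<Rightarrow> real^2)) set.
           infinite S \<and>
           (\<forall>(\<rho>, v) \<in> S.
              admissible_weak_solution \<gamma> (riemann_data \<rho>m \<rho>p) (riemann_data vm vp) \<rho> v) \<and>
           pairwise (\<lambda>s s'. \<not> ae_equal s s') S"
proof -
  define a where "a = vm $ 1"
  have jump: "vm $ 2 - vp $ 2 > sqrt ((\<rho>m - \<rho>p) * (pressure \<gamma> \<rho>m - pressure \<gamma> \<rho>p) / (\<rho>m * \<rho>p))"
    using assms(5) by linarith
  obtain r \<beta> \<delta> \<nu> \<nu>' where sub: "r > 0" "\<delta> > 0" "\<nu> < \<nu>'"
    "\<nu> * (\<rho>m - r) = \<rho>m * vm $ 2 - r * \<beta>" "\<nu>' * (r - \<rho>p) = r * \<beta> - \<rho>p * vp $ 2"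
    "\<nu> * (\<rho>m * vm $ 2 - r * \<beta>) = \<rho>m * (vm $ 2)\<^sup>2 + pressure \<gamma> \<rho>m - (r * \<beta>\<^sup>2 + pressure \<gamma> r + r * \<delta>)"
    "\<nu>' * (r * \<beta> - \<rho>p * vp $ 2) = (r * \<beta>\<^sup>2 + pressure \<gamma> r + r * \<delta>) - (\<rho>p * (vp $ 2)\<^sup>2 + pressure \<gamma> \<rho>p)"
    "\<nu> * (\<rho>m * internal_energy \<gamma> \<rho>m + \<rho>m * ((a\<^sup>2 + (vm $ 2)\<^sup>2) / 2) - (r * internal_energy \<gamma> r + r * ((a\<^sup>2 + \<beta>\<^sup>2 + 2 * \<delta>) / 2)))
      \<le> (\<rho>m * internal_energy \<gamma> \<rho>m + \<rho>m * ((a\<^sup>2 + (vm $ 2)\<^sup>2) / 2) + pressure \<gamma> \<rho>m) * vm $ 2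
        - (r * internal_energy \<gamma> r + r * ((a\<^sup>2 + \<beta>\<^sup>2 + 2 * \<delta>) / 2) + pressure \<gamma> r) * \<beta>"
    "\<nu>' * ((r * internal_energy \<gamma> r + r * ((a\<^sup>2 + \<beta>\<^sup>2 + 2 * \<delta>) / 2)) - (\<rho>p * internal_energy \<gamma> \<rho>p + \<rho>p * ((a\<^sup>2 + (vp $ 2)\<^sup>2) / 2)))
      \<le> (r * internal_energy \<gamma> r + r * ((a\<^sup>2 + \<beta>\<^sup>2 + 2 * \<delta>) / 2) + pressure \<gamma> r) * \<beta>
       - (\<rho>p * internal_energy \<gamma> \<rho>p + \<rho>p * ((a\<^sup>2 + (vp $ 2)\<^sup>2) / 2) + pressure \<gamma> \<rho>p) * vp $ 2"
    by (rule fan_subsolution[OF assms(1-3) jump, where a = a]) (rule that; assumption)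
  define V0 where "V0 = Complex a \<beta>"
  define C where "C = a\<^sup>2 + \<beta>\<^sup>2 + 2 * \<delta>"
  \<comment> \<open>With \<open>Z0 = V0\<^sup>2\<close> the second summand of
    \<open>subsol_energy\<close> vanishes, and the gap to \<open>C\<close> is exactly
    \<open>2 * \<delta>\<close>.\<close>
  have "subsol_energy V0 (V0\<^sup>2) < C" using sub(2) by (simp add: subsol_energy_def V0_def C_def cmod_power2)
  then obtain v w :: "nat \<Rightarrow> spacetime \<Rightarrow> complex" where vw: "\<And>i. wild (wedge \<nu> \<nu>') C V0 (V0\<^sup>2) (v i) (w i)"
    "\<And>i j. i \<noteq> j \<Longrightarrow> \<not> (AE z in lborel. v i z = v j z)"
    by (rule infinitely_many_wild[OF open_wedge wedge_nonempty[OF sub(3)]]) (assumption | (rule that; assumption))+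
  define s where "s i = (fan \<nu> \<nu>' \<rho>m r \<rho>p, vel \<nu> \<nu>' vm V0 vp (v i))" for i
  have adm: "admissible_weak_solution \<gamma> (riemann_data \<rho>m \<rho>p) (riemann_data vm vp) (fst (s i)) (snd (s i))" for i
    unfolding s_def fst_conv snd_conv V0_def
  proof (rule wild_fan_solution[where \<delta> = \<delta> and w = "w i"])
    show "vm $ 1 = a" "vp $ 1 = a" using assms(4) by (simp_all add: a_def)
    show "wild (wedge \<nu> \<nu>') (a\<^sup>2 + \<beta>\<^sup>2 + 2 * \<delta>) (Complex a \<beta>) ((Complex a \<beta>)\<^sup>2) (v i) (w i)"
      using vw(1)[of i] by (simp add: C_def V0_def)
  qed (fact assms sub)+
  have dist: "\<not> ae_equal (s i) (s j)" if "i \<noteq> j" for i j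
  proof
    assume "ae_equal (s i) (s j)"
    then have "AE z in lebesgue_on future. vel \<nu> \<nu>' vm V0 vp (v i) z = vel \<nu> \<nu>' vm V0 vp (v j) z"
      unfolding ae_equal_def s_def by simp
    then have "AE z in lebesgue. z \<in> future \<longrightarrow> vel \<nu> \<nu>' vm V0 vp (v i) z = vel \<nu> \<nu>' vm V0 vp (v j) z"
      by (subst (asm) AE_restrict_space_iff) auto
    then have "AE z in lborel. z \<in> future \<longrightarrow> vel \<nu> \<nu>' vm V0 vp (v i) z = vel \<nu> \<nu>' vm V0 vp (v j) z"
      by (simp add: AE_completion_iff)
    then have "AE z in lborel. v i z = v j z"
    proof eventually_elim
      case (elim z)
      show ?case
      proof (cases "z \<in> wedge \<nu> \<nu>'")
        case True
        then have "z \<in> future" by (auto simp: wedge_def in_future_iff)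
        then have e: "vel \<nu> \<nu>' vm V0 vp (v i) z = vel \<nu> \<nu>' vm V0 vp (v j) z" using elim by blast
        have f: "vel \<nu> \<nu>' vm V0 vp x z = vector [Re (V0 + x z), Im (V0 + x z)]" for x
          using True by (simp add: vel_def fan_def wedge_def)
        have "Re (V0 + v i z) = Re (V0 + v j z)" "Im (V0 + v i z) = Im (V0 + v j z)"
          using arg_cong[OF e[unfolded f], of "\<lambda>x. x $ 1"] arg_cong[OF e[unfolded f], of "\<lambda>x. x $ 2"] by (simp_all only: vector_2)
        then show ?thesis by (simp add: complex_eq_iff)
      next
        case False
        then show ?thesis using wildD(5)[OF vw(1)] by simp
      qed
    qed
    then show False using vw(2)[OF that] by blast
  qed
  have refl: "ae_equal x x" for x by (simp add: ae_equal_def)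
  have "inj s"
  proof (rule injI, rule ccontr)
    fix i j assume "s i = s j" "i \<noteq> j"
    then show False using dist[of i j] refl[of "s i"] by simp
  qed
  then have "infinite (range s)" by (rule range_inj_infinite)
  moreover have "pairwise (\<lambda>s s'. \<not> ae_equal s s') (range s)"
  proof (intro pairwiseI)
    fix x y assume "x \<in> range s" "y \<in> range s" "x \<noteq> y"
    then obtain i j where "x = s i" "y = s j" "i \<noteq> j" by blast
    then show "\<not> ae_equal x y" using dist by blast
  qed
  ultimately show ?thesis using adm by (intro exI[of _ "range s"]) (auto simp: case_prod_beta)
qed

end
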